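(* Let $V$ be a simple Yetter-Drinfel'd module over $H$ whose Nichols algebra $\mathcal{B}(V)$ is finite dimensional. (1) If the braided vector space $V$ is of diagonal type, then $\mathcal{B}(V)$ is of type $A_1$, of type $A_2$, or a quantum plane. (2) If the braided vector space $V$ is not of diagonal type, then $\mathcal{B}(V)$ has dimension $8$ or $16$.
   Context: $\Bbbk$ is an algebraically closed field of characteristic $0$. $G=\langle x,y\mid x^4=1=y^2,\ xy=yx\rangle$, and $\mathbb{Z}_2=\{1,t\}$ acts on $G$ by group automorphisms via $x\triangleleft t=xy$, $y\triangleleft t=y$. Put $\sigma(x^iy^j;t,t)=(-1)^{i(i-1)/2}$ and $\tau(x^iy^j,x^ky^l;t)=(-1)^{jk}$. The Hopf algebra $H=H_{c:\sigma_0}$ is the $16$-dimensional Hopf algebra with basis $\{e_g,\ e_gt : g\in G\}$, generated as an algebra by $e_g$ ($g\in G$) and $t$ with $1=\sum_g e_g$, $e_ge_h=\delta_{g,h}e_g$, $te_g=e_{g\triangleleft t}t$, $t^2=\sum_{g}\sigma(g;t,t)e_g$; coalgebra structure $\Delta(e_g)=\sum_{hk=g}e_h\otimes e_k$, $\Delta(t)=\big[\sum_{g,h}\tau(g,h;t)e_g\otimes e_h\big](t\otimes t)$, $\epsilon(e_g)=\delta_{g,1}$, $\epsilon(t)=1$; antipode $\mathcal{S}(e_g)=e_{g^{-1}}$, $\mathcal{S}(e_gt)=\sigma(g^{-1};t,t)^{-1}\tau(g^{-1},g;t)^{-1}e_{(g\triangleleft t)^{-1}}t$. Yetter-Drinfel'd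 modules here are left-left: a left $H$-module $V$ with left coaction $\rho_l(v)=v_{-1}\otimes v_0\in H\otimes V$ satisfying $\rho_l(h\cdot v)=h_1v_{-1}\mathcal{S}(h_3)\otimes h_2\cdot v_0$; the category is braided by $c_{V,W}(v\otimes w)=v_{-1}\cdot w\otimes v_0$, so $(V,c_{V,V})$ is a braided vector space. (Simple left-left Yetter-Drinfel'd modules correspond to simple left-right ones $(V,\cdot,\rho)$, $\rho(v)=v_0\otimes v_1$, via $\rho_l(v)=\mathcal{S}(v_1)\otimes v_0$.) A braided vector space $(V,c)$ of dimension $\theta$ is of diagonal type if there are a basis $x_1,\dots,x_\theta$ of $V$ and scalars $q_{ij}\in\Bbbk$ with $c(x_i\otimes x_j)=q_{ij}x_j\otimes x_i$ for all $i,j$; $(q_{ij})$ is a braiding matrix. The Nichols algebra $\mathcal{B}(V)=\bigoplus_{n\ge0}\mathcal{B}^n(V)$ is the graded braided Hopf algebra $R=\bigoplus_{n\ge 0}R(n)$ in the category of left-left Yetter-Drinfel'd modules with $R(0)\simeq\Bbbk$, $R(1)\simeq V$, $R(1)$ equal to the space of primitive elements of $R$, and $R$ generated as an algebra by $R(1)$. Equivalently, as a vector space $\mathcal{B}(V)=\Bbbk\oplus V\oplus\bigoplus_{n\ge2}V^{\otimes n}/\ker\Omega_n$, where, with $c_i$ the braiding applied in positions $i,i+1$, $\Omega_1=\mathrm{id}$, $\Omega_{n,1}=\mathrm{id}+c_n+c_nc_{n-1}+\cdots+c_nc_{n-1}\cdots c_1$ and $\Omega_n=(\Omega_{n-1}\otimes\mathrm{id})\,\Omega_{n-1,1}$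 for $n\ge2$. Terminology (standard): for $V$ of diagonal type with braiding matrix $(q_{ij})$ whose diagonal entries are roots of unity different from $1$, $\mathcal{B}(V)$ is of type $A_1$ if $\dim V=1$; of (Cartan) type $A_2$ if $\dim V=2$, $q_{11}=q_{22}$ and $q_{12}q_{21}=q_{11}^{-1}$; and a quantum plane if $\dim V=2$ and $q_{12}q_{21}=1$, in which case, with $N_i$ the order of $q_{ii}$, $\mathcal{B}(V)\simeq T(V)/\langle x_1x_2-q_{12}x_2x_1,\ x_1^{N_1},\ x_2^{N_2}\rangle$. *)

theory Defs
  imports
    "HOL-Computational_Algebra.Polynomial"
    "HOL-Library.Function_Algebras"
begin

section \<open>Hopf algebras with a finite basis and their Yetter-Drinfel'd modules\<close>

text \<open>
  A finite-dimensional algebra with basis indexed by the finite type \<open>'b\<close> has the functions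
  \<open>'b \<Rightarrow> 'k\<close> as elements: \<open>h\<close> stands for the sum of all \<open>h b \<cdot> b\<close>.  In the same way an element of
  \<open>H \<otimes> H\<close> is a function \<open>'b \<times> 'b \<Rightarrow> 'k\<close>, and an element of \<open>H \<otimes> V\<close> is a function \<open>'b \<Rightarrow> 'v\<close>,
  standing for the sum of all \<open>b \<otimes> f b\<close>.
\<close>

record ('b, 'k) hopf =
  hmult :: "('b \<Rightarrow> 'k) \<Rightarrow> ('b \<Rightarrow> 'k) \<Rightarrow> 'b \<Rightarrow> 'k"
  hone :: "'b \<Rightarrow> 'k"
  hcomult :: "('b \<Rightarrow> 'k) \<Rightarrow> 'b \<times> 'b \<Rightarrow> 'k"
  hcounit :: "('b \<Rightarrow> 'k) \<Rightarrow> 'k"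
  hantipode :: "('b \<Rightarrow> 'k) \<Rightarrow> 'b \<Rightarrow> 'k"

definition hbas :: "'b \<Rightarrow> 'b \<Rightarrow> 'k::zero_neq_one" where
  "hbas b = (\<lambda>c. if c = b then 1 else 0)"

definition hcomult2 :: "('b::finite, 'k::field) hopf \<Rightarrow> ('b \<Rightarrow> 'k) \<Rightarrow> 'b \<times> 'b \<times> 'b \<Rightarrow> 'k" where
  "hcomult2 H h = (\<lambda>(p, q, r). \<Sum>s\<in>UNIV. hcomult H h (s, r) * hcomult H (hbas s) (p, q))"

text \<open>
  Left-left Yetter-Drinfel'd modules: \<open>act h v\<close> is \<open>h \<cdot> v\<close> and \<open>coact v\<close> is the coaction
  \<open>v\<^sub>-\<^sub>1 \<otimes> v\<^sub>0\<close>.  The last axiom is \<open>\<rho>(h \<cdot> v) = h\<^sub>1 v\<^sub>-\<^sub>1 S(h\<^sub>3) \<otimes> h\<^sub>2 \<cdot> v\<^sub>0\<close>, read off at the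
  basis element \<open>d\<close>.
\<close>

locale yd_module = vector_space scale
  for scale :: "'k::field \<Rightarrow> 'v::ab_group_add \<Rightarrow> 'v" +
  fixes H :: "('b::finite, 'k) hopf"
    and act :: "('b \<Rightarrow> 'k) \<Rightarrow> 'v \<Rightarrow> 'v"
    and coact :: "'v \<Rightarrow> 'b \<Rightarrow> 'v"
  assumes act_linear: "Vector_Spaces.linear scale scale (act h)"
    and act_add: "act (\<lambda>b. h b + h' b) v = act h v + act h' v"
    and act_scale: "act (\<lambda>b. r * h b) v = scale r (act h v)"
    and act_one: "act (hone H) v = v"
    and act_mult: "act (hmult H h h') v = act h (act h' v)"
    and coact_linear: "Vector_Spaces.linear scale scale (\<lambda>v. coact v b)"
    and coact_counit: "(\<Sum>b\<in>UNIV. scale (hcounit H (hbas b)) (coact v b)) = v"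
    and coact_coassoc:
      "coact (coact v p) q = (\<Sum>b\<in>UNIV. scale (hcomult H (hbas b) (p, q)) (coact v b))"
    and yetter_drinfeld:
      "coact (act h v) d =
        (\<Sum>p\<in>UNIV. \<Sum>q\<in>UNIV. \<Sum>r\<in>UNIV. \<Sum>b\<in>UNIV.
          scale (hcomult2 H h (p, q, r)
                  * hmult H (hmult H (hbas p) (hbas b)) (hantipode H (hbas r)) d)
            (act (hbas q) (coact v b)))"

locale simple_yd_module = yd_module scale H act coact
  for scale :: "'k::field \<Rightarrow> 'v::ab_group_add \<Rightarrow> 'v"
    and H :: "('b::finite, 'k) hopf"
    and act coact +
  assumes nonzero: "\<exists>v::'v. v \<noteq> 0"
    and simple:
      "\<lbrakk>subspace W; \<And>h w. w \<in> W \<Longrightarrow> act h w \<in> W; \<And>w b. w \<in> W \<Longrightarrow> coact w b \<in> W\<rbrakk>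
        \<Longrightarrow> W = {0} \<or> W = UNIV"


section \<open>Tensor powers and braided vector spaces\<close>

text \<open>
  Tensors over a field are modelled as the functions they induce on tuples of linear forms:
  \<open>v\<^sub>1 \<otimes> \<dots> \<otimes> v\<^sub>n\<close> is the function sending a list \<open>[f\<^sub>1, \<dots>, f\<^sub>n]\<close> of linear forms to
  \<open>f\<^sub>1 v\<^sub>1 \<cdots> f\<^sub>n v\<^sub>n\<close>, and every other list to \<open>0\<close>.  Since linear forms separate points, the canonical
  map from the usual tensor power to such functions is injective; the spans of these functions
  are therefore the tensor powers of \<open>V\<close>, and together they form the tensor algebra.
\<close>

type_synonym ('v, 'k) tensor = "('v \<Rightarrow> 'k) list \<Rightarrow> 'k"

definition linear_form :: "('k::field \<Rightarrow> 'v::ab_group_add \<Rightarrow> 'v) \<Rightarrow> ('v \<Rightarrow> 'k) \<Rightarrow> bool" where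
  "linear_form scale f \<longleftrightarrow> Vector_Spaces.linear scale (*) f"

definition pure_tensor ::
    "('k::field \<Rightarrow> 'v::ab_group_add \<Rightarrow> 'v) \<Rightarrow> 'v list \<Rightarrow> ('v, 'k) tensor" where
  "pure_tensor scale vs = (\<lambda>fs.
     if length fs = length vs \<and> (\<forall>f\<in>set fs. linear_form scale f)
     then \<Prod>i<length vs. (fs ! i) (vs ! i) else 0)"

definition tscale :: "'k::field \<Rightarrow> ('v, 'k) tensor \<Rightarrow> ('v, 'k) tensor" where
  "tscale r T = (\<lambda>fs. r * T fs)"

definition tensor_power ::
    "('k::field \<Rightarrow> 'v::ab_group_add \<Rightarrow> 'v) \<Rightarrow> nat \<Rightarrow> ('v, 'k) tensor set" where
  "tensor_power scale n = module.span tscale {pure_tensor scale vs |vs. length vs = n}"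

definition tensor_algebra ::
    "('k::field \<Rightarrow> 'v::ab_group_add \<Rightarrow> 'v) \<Rightarrow> ('v, 'k) tensor set" where
  "tensor_algebra scale = module.span tscale (range (pure_tensor scale))"

definition tcomp :: "nat \<Rightarrow> ('v, 'k::field) tensor \<Rightarrow> ('v, 'k) tensor" where
  "tcomp n T = (\<lambda>fs. if length fs = n then T fs else 0)"

text \<open>
  The braiding \<open>c(v \<otimes> w) = v\<^sub>-\<^sub>1 \<cdot> w \<otimes> v\<^sub>0\<close> of a Yetter-Drinfel'd module \<open>V\<close>, as a linear map on
  \<open>V \<otimes> V\<close>.  The value of \<open>c(v \<otimes> w)\<close> at \<open>[f, g]\<close> is the sum over \<open>b\<close> of
  \<open>f (act b w) \<cdot> g (coact v b)\<close>, which is the value of \<open>v \<otimes> w\<close> at the list of the two forms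
  \<open>\<lambda>v. g (coact v b)\<close> and \<open>\<lambda>w. f (act b w)\<close>; see \<open>yd_braiding_pure_tensor\<close> below.
\<close>

definition yd_braiding ::
    "('k::field \<Rightarrow> 'v::ab_group_add \<Rightarrow> 'v) \<Rightarrow> (('b::finite \<Rightarrow> 'k) \<Rightarrow> 'v \<Rightarrow> 'v) \<Rightarrow> ('v \<Rightarrow> 'b \<Rightarrow> 'v)
      \<Rightarrow> ('v, 'k) tensor \<Rightarrow> ('v, 'k) tensor" where
  "yd_braiding scale act coact T = (\<lambda>fs.
     if length fs = 2 \<and> (\<forall>f\<in>set fs. linear_form scale f)
     then \<Sum>b\<in>UNIV. T [\<lambda>v. (fs ! 1) (coact v b), \<lambda>w. (fs ! 0) (act (hbas b) w)]
     else 0)"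

lemma sum_fun_apply: "(\<Sum>a\<in>A. T a) x = (\<Sum>a\<in>A. T a x :: 'c::comm_monoid_add)"
  by (induct A rule: infinite_finite_induct) (auto simp: plus_fun_def zero_fun_def)

lemma (in vector_space) linear_form_comp:
  assumes "linear_form scale f" "Vector_Spaces.linear scale scale g"
  shows "linear_form scale (\<lambda>v. f (g v))"
  using Vector_Spaces.linear_compose[OF assms(2), of "(*)" f] assms(1) by (simp add: linear_form_def o_def)

lemma (in yd_module) yd_braiding_pure_tensor:
  "yd_braiding scale act coact (pure_tensor scale [v, w]) =
     (\<Sum>b\<in>UNIV. pure_tensor scale [act (hbas b) w, coact v b])"
proof
  fix fs :: "('v \<Rightarrow> 'k) list"
  show "yd_braiding scale act coact (pure_tensor scale [v, w]) fs =
      (\<Sum>b\<in>UNIV. pure_tensor scale [act (hbas b) w, coact v b]) fs"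
    unfolding sum_fun_apply
  proof (cases "length fs = 2 \<and> (\<forall>f\<in>set fs. linear_form scale f)")
    case True
    then obtain f g where fs: "fs = [f, g]"
      by (auto simp: numeral_2_eq_2 length_Suc_conv)
    with True show "yd_braiding scale act coact (pure_tensor scale [v, w]) fs =
        (\<Sum>b\<in>UNIV. pure_tensor scale [act (hbas b) w, coact v b] fs)"
      by (simp add: yd_braiding_def pure_tensor_def linear_form_comp[OF _ act_linear] linear_form_comp[OF _ coact_linear]
          numeral_2_eq_2 lessThan_Suc mult.commute)
  next
    case False
    then have "pure_tensor scale [act (hbas b) w, coact v b] fs = 0" for b
      by (auto simp: pure_tensor_def)
    with False show "yd_braiding scale act coact (pure_tensor scale [v, w]) fs =
        (\<Sum>b\<in>UNIV. pure_tensor scale [act (hbas b) w, coact v b] fs)"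
      by (auto simp: yd_braiding_def)
  qed
qed

text \<open>
  \<open>braid_at c i\<close> is \<open>c\<^sub>i\<close>: the braiding applied in the (1-based) positions \<open>i\<close>, \<open>i + 1\<close>.
\<close>

definition braid_at ::
    "(('v, 'k::field) tensor \<Rightarrow> ('v, 'k) tensor) \<Rightarrow> nat \<Rightarrow> ('v, 'k) tensor \<Rightarrow> ('v, 'k) tensor" where
  "braid_at c i T = (\<lambda>fs.
     if 1 \<le> i \<and> i < length fs
     then c (\<lambda>gs. T (take (i - 1) fs @ gs @ drop (i + 1) fs)) [fs ! (i - 1), fs ! i]
     else 0)"

lemma pure_tensor_append:
  assumes "length fs = length vs"
  shows "pure_tensor scale (vs @ ws) (fs @ gs) = pure_tensor scale vs fs * pure_tensor scale ws gs"
proof -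
  define F where "F = (\<lambda>i. ((fs @ gs) ! i) ((vs @ ws) ! i))"
  let ?n = "length vs" and ?m = "length ws"
  have "prod F {0..<?n + ?m} = prod F {0..<?n} * prod F {?n..<?n + ?m}"
    by (simp add: prod.atLeastLessThan_concat)
  also have "prod F {?n..<?n + ?m} = (\<Prod>i<?m. F (i + ?n))"
    using prod.shift_bounds_nat_ivl[of F 0 ?n ?m] by (simp add: add.commute lessThan_atLeast0)
  also have "\<dots> = (\<Prod>i<?m. (gs ! i) (ws ! i))"
    using assms by (simp add: F_def nth_append)
  also have "prod F {0..<?n} = (\<Prod>i<?n. (fs ! i) (vs ! i))"
    using assms by (intro prod.cong) (auto simp: F_def nth_append)
  finally have "(\<Prod>i<?n + ?m. ((fs @ gs) ! i) ((vs @ ws) ! i)) =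
      (\<Prod>i<?n. (fs ! i) (vs ! i)) * (\<Prod>i<?m. (gs ! i) (ws ! i))"
    by (simp add: F_def lessThan_atLeast0)
  then show ?thesis using assms by (auto simp: pure_tensor_def)
qed

lemma (in yd_module) braid_at_pure_tensor:
  "braid_at (yd_braiding scale act coact) (Suc (length us)) (pure_tensor scale (us @ [v, w] @ ws)) =
     (\<Sum>b\<in>UNIV. pure_tensor scale (us @ [act (hbas b) w, coact v b] @ ws))"
    (is "?L = _")
proof
  fix fs :: "('v \<Rightarrow> 'k) list"
  show "?L fs = (\<Sum>b\<in>UNIV. pure_tensor scale (us @ [act (hbas b) w, coact v b] @ ws)) fs"
    unfolding sum_fun_apply
  proof (cases "length fs = length us + 2 + length ws")
    case True
    define A C where "A = take (length us) fs" and "C = drop (length us + 2) fs"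
    define f g where "f = fs ! length us" and "g = fs ! Suc (length us)"
    have fs: "fs = A @ [f, g] @ C" and A: "length A = length us" and C: "length C = length ws"
      using True by (auto simp: A_def C_def f_def g_def Cons_nth_drop_Suc)
    have split: "pure_tensor scale (us @ [x, y] @ ws) (A @ [h, k] @ C) =
        pure_tensor scale us A * pure_tensor scale ws C * pure_tensor scale [x, y] [h, k]" for x y h k
      unfolding pure_tensor_append[OF A]
      by (subst pure_tensor_append) (simp_all only: list.size mult_ac)
    let ?c = "yd_braiding scale act coact"
    have "?L fs = ?c (\<lambda>gs. pure_tensor scale (us @ [v, w] @ ws) (A @ gs @ C)) [f, g]"
      using A by (simp add: braid_at_def fs nth_append)
    also have "\<dots> = pure_tensor scale us A * pure_tensor scale ws C * ?c (pure_tensor scale [v, w]) [f, g]"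
      unfolding yd_braiding_def split by (simp add: sum_distrib_left)
    also have "\<dots> = (\<Sum>b\<in>UNIV. pure_tensor scale (us @ [act (hbas b) w, coact v b] @ ws) fs)"
      unfolding yd_braiding_pure_tensor sum_fun_apply fs split by (simp add: sum_distrib_left)
    finally show "?L fs = (\<Sum>b\<in>UNIV. pure_tensor scale (us @ [act (hbas b) w, coact v b] @ ws) fs)" .
  next
    case False
    then have "length (take (length us) fs @ gs @ drop (length us + 2) fs) \<noteq> length (us @ [v, w] @ ws)"
      if "Suc (length us) < length fs" "length gs = 2" for gs
      using that by auto
    with False show "?L fs = (\<Sum>b\<in>UNIV. pure_tensor scale (us @ [act (hbas b) w, coact v b] @ ws) fs)"
      by (auto simp: braid_at_def yd_braiding_def pure_tensor_def)
  qed
qed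

text \<open>\<open>braid_chain c n k\<close> is \<open>c\<^sub>n c\<^sub>n\<^sub>-\<^sub>1 \<cdots> c\<^sub>n\<^sub>-\<^sub>k\<^sub>+\<^sub>1\<close>, a product of \<open>k\<close> factors.\<close>

primrec braid_chain ::
    "(('v, 'k::field) tensor \<Rightarrow> ('v, 'k) tensor) \<Rightarrow> nat \<Rightarrow> nat \<Rightarrow> ('v, 'k) tensor \<Rightarrow> ('v, 'k) tensor" where
  "braid_chain c n 0 T = T"
| "braid_chain c n (Suc k) T = braid_chain c n k (braid_at c (n - k) T)"

text \<open>\<open>\<Omega>\<^bsub>n,1\<^esub> = id + c\<^sub>n + c\<^sub>n c\<^sub>n\<^sub>-\<^sub>1 + \<cdots> + c\<^sub>n c\<^sub>n\<^sub>-\<^sub>1 \<cdots> c\<^sub>1\<close>, acting on tensors of degree \<open>n + 1\<close>.\<close>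

definition quantum_shuffle ::
    "(('v, 'k::field) tensor \<Rightarrow> ('v, 'k) tensor) \<Rightarrow> nat \<Rightarrow> ('v, 'k) tensor \<Rightarrow> ('v, 'k) tensor" where
  "quantum_shuffle c n T = (\<Sum>k\<le>n. braid_chain c n k T)"

text \<open>
  The quantum symmetrizers, by \<open>\<Omega>\<^sub>n = (\<Omega>\<^sub>n\<^sub>-\<^sub>1 \<otimes> id) \<Omega>\<^bsub>n-1,1\<^esub>\<close>.  As \<open>braid_at c i\<close> acts on tensors
  of any degree greater than \<open>i\<close>, the operator \<open>quantum_symm c n\<close> applied to tensors of degree
  \<open>n + 1\<close> is \<open>\<Omega>\<^sub>n \<otimes> id\<close>.  For \<open>n = 1\<close> the recursion gives the identity.
\<close>

primrec quantum_symm ::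
    "(('v, 'k::field) tensor \<Rightarrow> ('v, 'k) tensor) \<Rightarrow> nat \<Rightarrow> ('v, 'k) tensor \<Rightarrow> ('v, 'k) tensor" where
  "quantum_symm c 0 T = T"
| "quantum_symm c (Suc n) T = quantum_symm c n (quantum_shuffle c n T)"


section \<open>The Nichols algebra as a graded vector space\<close>

text \<open>
  \<open>B(V)\<close> is the quotient of the tensor algebra by the direct sum of the kernels of the
  \<open>\<Omega>\<^sub>n\<close>; in degrees \<open>0\<close> and \<open>1\<close> the kernel is zero.  A finite set \<open>S\<close> represents a basis of a
  quotient \<open>A / K\<close> if its classes span \<open>A / K\<close> and are linearly independent in it.
\<close>

definition nichols_ideal ::
    "('k::field \<Rightarrow> 'v::ab_group_add \<Rightarrow> 'v) \<Rightarrow> (('v, 'k) tensor \<Rightarrow> ('v, 'k) tensor)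
      \<Rightarrow> ('v, 'k) tensor set" where
  "nichols_ideal scale c =
     {T \<in> tensor_algebra scale. \<forall>n. quantum_symm c n (tcomp n T) = 0}"

definition quotient_basis ::
    "('k::field \<Rightarrow> 'w::ab_group_add \<Rightarrow> 'w) \<Rightarrow> 'w set \<Rightarrow> 'w set \<Rightarrow> 'w set \<Rightarrow> bool" where
  "quotient_basis sc A K S \<longleftrightarrow>
     finite S \<and> S \<subseteq> A \<and> A = {s + t |s t. s \<in> module.span sc S \<and> t \<in> K} \<and>
     (\<forall>a. (\<Sum>s\<in>S. sc (a s) s) \<in> K \<longrightarrow> (\<forall>s\<in>S. a s = 0))"

definition nichols_has_dim ::
    "('k::field \<Rightarrow> 'v::ab_group_add \<Rightarrow> 'v) \<Rightarrow> (('v, 'k) tensor \<Rightarrow> ('v, 'k) tensor) \<Rightarrow> nat \<Rightarrow> bool" where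
  "nichols_has_dim scale c d \<longleftrightarrow>
     (\<exists>S. quotient_basis tscale (tensor_algebra scale) (nichols_ideal scale c) S \<and> card S = d)"

definition nichols_finite_dim ::
    "('k::field \<Rightarrow> 'v::ab_group_add \<Rightarrow> 'v) \<Rightarrow> (('v, 'k) tensor \<Rightarrow> ('v, 'k) tensor) \<Rightarrow> bool" where
  "nichols_finite_dim scale c \<longleftrightarrow> (\<exists>d. nichols_has_dim scale c d)"


section \<open>Braidings of diagonal type\<close>

text \<open>
  \<open>xs\<close> is a basis of \<open>V\<close> with \<open>c(x\<^sub>i \<otimes> x\<^sub>j) = q\<^sub>i\<^sub>j x\<^sub>j \<otimes> x\<^sub>i\<close>; indices start at \<open>0\<close>.
\<close>

definition braiding_matrix ::
    "('k::field \<Rightarrow> 'v::ab_group_add \<Rightarrow> 'v) \<Rightarrow> (('v, 'k) tensor \<Rightarrow> ('v, 'k) tensor)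
      \<Rightarrow> 'v list \<Rightarrow> (nat \<Rightarrow> nat \<Rightarrow> 'k) \<Rightarrow> bool" where
  "braiding_matrix scale c xs q \<longleftrightarrow>
     distinct xs \<and> \<not> module.dependent scale (set xs) \<and> module.span scale (set xs) = UNIV \<and>
     (\<forall>i<length xs. \<forall>j<length xs.
        c (pure_tensor scale [xs ! i, xs ! j]) = tscale (q i j) (pure_tensor scale [xs ! j, xs ! i]))"

definition diagonal_type ::
    "('k::field \<Rightarrow> 'v::ab_group_add \<Rightarrow> 'v) \<Rightarrow> (('v, 'k) tensor \<Rightarrow> ('v, 'k) tensor) \<Rightarrow> bool" where
  "diagonal_type scale c \<longleftrightarrow> (\<exists>xs q. braiding_matrix scale c xs q)"

definition nontrivial_root_diagonal :: "nat \<Rightarrow> (nat \<Rightarrow> nat \<Rightarrow> 'k::field) \<Rightarrow> bool" where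
  "nontrivial_root_diagonal \<theta> q \<longleftrightarrow> (\<forall>i<\<theta>. q i i \<noteq> 1 \<and> (\<exists>N>0. q i i ^ N = 1))"

text \<open>The types of \<open>B(V)\<close>, for \<open>V\<close> of dimension \<open>\<theta>\<close> with braiding matrix \<open>q\<close>.\<close>

definition type_A1 :: "nat \<Rightarrow> (nat \<Rightarrow> nat \<Rightarrow> 'k::field) \<Rightarrow> bool" where
  "type_A1 \<theta> q \<longleftrightarrow> nontrivial_root_diagonal \<theta> q \<and> \<theta> = 1"

definition type_A2 :: "nat \<Rightarrow> (nat \<Rightarrow> nat \<Rightarrow> 'k::field) \<Rightarrow> bool" where
  "type_A2 \<theta> q \<longleftrightarrow>
     nontrivial_root_diagonal \<theta> q \<and> \<theta> = 2 \<and> q 0 0 = q 1 1 \<and> q 0 1 * q 1 0 = inverse (q 0 0)"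

definition quantum_plane :: "nat \<Rightarrow> (nat \<Rightarrow> nat \<Rightarrow> 'k::field) \<Rightarrow> bool" where
  "quantum_plane \<theta> q \<longleftrightarrow> nontrivial_root_diagonal \<theta> q \<and> \<theta> = 2 \<and> q 0 1 * q 1 0 = 1"


section \<open>The group \<open>G\<close> and the Hopf algebra \<open>H\<close>\<close>

text \<open>The pair \<open>(i, j)\<close> represents \<open>x\<^sup>i y\<^sup>j\<close>.\<close>

typedef grp = "{0..<4::nat} \<times> {0..<2::nat}"
  morphisms expo Abs_grp
  by (rule exI[of _ "(0, 0)"]) simp

definition gel :: "nat \<Rightarrow> nat \<Rightarrow> grp" where
  "gel i j = Abs_grp (i mod 4, j mod 2)"

definition ex :: "grp \<Rightarrow> nat" where "ex g = fst (expo g)"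
definition ey :: "grp \<Rightarrow> nat" where "ey g = snd (expo g)"

definition gone :: grp where "gone = gel 0 0"

definition gmul :: "grp \<Rightarrow> grp \<Rightarrow> grp" where
  "gmul g h = gel (ex g + ex h) (ey g + ey h)"

definition ginv :: "grp \<Rightarrow> grp" where
  "ginv g = gel (4 - ex g) (2 - ey g)"

text \<open>The action of \<open>t\<close>: \<open>x\<^sup>i y\<^sup>j \<triangleleft> t = (xy)\<^sup>i y\<^sup>j\<close>.\<close>

definition gact :: "grp \<Rightarrow> grp" where
  "gact g = gel (ex g) (ex g + ey g)"

definition sig :: "grp \<Rightarrow> 'k::field" where
  "sig g = (- 1) ^ (ex g * (ex g - 1) div 2)"

definition tau :: "grp \<Rightarrow> grp \<Rightarrow> 'k::field" where
  "tau g h = (- 1) ^ (ey g * ex h)"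

instance grp :: finite
proof
  have "range expo \<subseteq> {0..<4} \<times> {0..<2}" using expo by blast
  then have "finite (range expo)" by (rule finite_subset) simp
  then show "finite (UNIV :: grp set)"
    by (rule finite_imageD) (simp add: expo_inject inj_on_def)
qed

text \<open>
  The basis of \<open>H\<close>: \<open>(g, False)\<close> is \<open>e\<^sub>g\<close> and \<open>(g, True)\<close> is \<open>e\<^sub>g t\<close>.  The structure maps are given on
  the basis and extended linearly.  The products of basis elements are the normal forms obtained
  from \<open>e\<^sub>g e\<^sub>h = \<delta>\<^bsub>g,h\<^esub> e\<^sub>g\<close>, \<open>t e\<^sub>g = e\<^bsub>g \<triangleleft> t\<^esub> t\<close> and \<open>t\<^sup>2 = \<Sum>\<^sub>g \<sigma>(g; t, t) e\<^sub>g\<close>; similarly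
  \<open>\<Delta>(e\<^sub>g t) = \<Delta>(e\<^sub>g) \<Delta>(t) = \<Sum>\<^bsub>hk = g\<^esub> \<tau>(h, k; t) e\<^sub>h t \<otimes> e\<^sub>k t\<close>.
\<close>

fun bas_mult :: "grp \<times> bool \<Rightarrow> grp \<times> bool \<Rightarrow> grp \<times> bool \<Rightarrow> 'k::field" where
  "bas_mult (g, False) (h, b) = (if g = h then hbas (g, b) else 0)"
| "bas_mult (g, True) (h, False) = (if g = gact h then hbas (g, True) else 0)"
| "bas_mult (g, True) (h, True) = (if g = gact h then (\<lambda>c. sig g * hbas (g, False) c) else 0)"

fun bas_comult :: "grp \<times> bool \<Rightarrow> (grp \<times> bool) \<times> (grp \<times> bool) \<Rightarrow> 'k::field" where
  "bas_comult (g, b) ((h, b'), (k, b'')) =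
     (if gmul h k = g \<and> b' = b \<and> b'' = b then (if b then tau h k else 1) else 0)"

fun bas_counit :: "grp \<times> bool \<Rightarrow> 'k::field" where
  "bas_counit (g, b) = (if g = gone then 1 else 0)"

fun bas_antipode :: "grp \<times> bool \<Rightarrow> grp \<times> bool \<Rightarrow> 'k::field" where
  "bas_antipode (g, False) = hbas (ginv g, False)"
| "bas_antipode (g, True) =
     (\<lambda>c. inverse (sig (ginv g)) * inverse (tau (ginv g) g) * hbas (ginv (gact g), True) c)"

definition Hcs :: "(grp \<times> bool, 'k::field) hopf" where
  "Hcs = \<lparr>
     hmult = (\<lambda>h h' c. \<Sum>a\<in>UNIV. \<Sum>b\<in>UNIV. h a * h' b * bas_mult a b c),
     hone = (\<lambda>(g, b). if b then 0 else 1),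
     hcomult = (\<lambda>h c. \<Sum>a\<in>UNIV. h a * bas_comult a c),
     hcounit = (\<lambda>h. \<Sum>a\<in>UNIV. h a * bas_counit a),
     hantipode = (\<lambda>h c. \<Sum>a\<in>UNIV. h a * bas_antipode a c)\<rparr>"

text \<open>The defining relations of \<open>H\<close>, with \<open>t = \<Sum>\<^sub>g e\<^sub>g t\<close>.\<close>

definition tH :: "grp \<times> bool \<Rightarrow> 'k::field" where
  "tH = (\<lambda>(g, b). if b then 1 else 0)"

lemma ex_gel [simp]: "ex (gel i j) = i mod 4" and ey_gel [simp]: "ey (gel i j) = j mod 2"
  by (simp_all add: ex_def ey_def gel_def Abs_grp_inverse)

lemma gel_ex_ey: "gel (ex g) (ey g) = g"
proof -
  have "fst (expo g) < 4" "snd (expo g) < 2"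
    using expo[of g] by (auto simp: mem_Times_iff)
  then have "(ex g mod 4, ey g mod 2) = expo g"
    by (simp add: ex_def ey_def)
  then show ?thesis by (simp add: gel_def expo_inverse)
qed

lemma grp_eqI: "ex g = ex h \<Longrightarrow> ey g = ey h \<Longrightarrow> g = h"
  by (metis gel_ex_ey)

lemma ex_less: "ex g < 4" and ey_less: "ey g < 2"
  by (metis gel_ex_ey ex_gel mod_less_divisor zero_less_numeral)
    (metis gel_ex_ey ey_gel mod_less_divisor zero_less_numeral)

lemma gact_gact [simp]: "gact (gact g) = g"
proof (rule grp_eqI)
  show "ex (gact (gact g)) = ex g" by (simp add: gact_def ex_less)
  have "(ex g + (ex g + ey g) mod 2) mod 2 = (2 * ex g + ey g) mod 2"
    by (simp only: mod_add_right_eq mult_2 add.assoc)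
  also have "\<dots> = ey g" using ey_less[of g] by simp
  finally have "(ex g mod 4 + (ex g + ey g) mod 2) mod 2 = ey g"
    by (simp only: mod_less[OF ex_less])
  then show "ey (gact (gact g)) = ey g" by (simp add: gact_def)
qed

lemma sum_grp_bool:
  fixes f :: "grp \<times> bool \<Rightarrow> 'k::field"
  shows "(\<Sum>a\<in>UNIV. f a) = (\<Sum>g\<in>UNIV. f (g, False) + f (g, True))"
proof -
  have "(\<Sum>a\<in>UNIV. f a) = (\<Sum>g\<in>UNIV. \<Sum>b\<in>UNIV. f (g, b))"
    by (simp add: sum.cartesian_product)
  then show ?thesis by (simp add: UNIV_bool)
qed

lemma sum_hbas:
  fixes f :: "'b::finite \<Rightarrow> 'k::field"
  shows "(\<Sum>a\<in>UNIV. hbas b a * f a) = f b"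
proof -
  have "hbas b a * f a = (if a = b then f a else 0)" for a
    by (simp add: hbas_def)
  then show ?thesis by simp
qed

lemma hmult_hbas_left: "hmult Hcs (hbas a) h c = (\<Sum>b\<in>UNIV. h b * bas_mult a b c)"
  by (simp add: Hcs_def mult.assoc sum_distrib_left[symmetric] sum_hbas)

lemma hmult_hbas_right: "hmult Hcs h (hbas b) c = (\<Sum>a\<in>UNIV. h a * bas_mult a b c)"
  by (simp add: Hcs_def mult.assoc sum_distrib_left[symmetric] sum_hbas)

lemma hmult_hbas: "hmult Hcs (hbas a) (hbas b) = bas_mult a b"
  by (rule ext) (simp add: hmult_hbas_left sum_hbas)

lemma Hcs_one: "hone Hcs (g, b) = (\<Sum>h\<in>UNIV. hbas (h, False) (g, b))"
  by (simp add: Hcs_def hbas_def)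

lemma Hcs_e_e: "hmult Hcs (hbas (g, False)) (hbas (h, False)) = (if g = h then hbas (g, False) else 0)"
  by (simp add: hmult_hbas)

lemma Hcs_e_t: "hmult Hcs (hbas (g, False)) tH = hbas (g, True)"
proof
  fix c
  have "hmult Hcs (hbas (g, False)) tH c = (\<Sum>b\<in>UNIV. tH b * bas_mult (g, False) b c)"
    by (rule hmult_hbas_left)
  also have "\<dots> = (\<Sum>h\<in>UNIV. if g = h then hbas (g, True) c else 0)"
    unfolding sum_grp_bool by (rule sum.cong) (auto simp: tH_def)
  finally show "hmult Hcs (hbas (g, False)) tH c = hbas (g, True) c" by simp
qed

lemma Hcs_t_e: "hmult Hcs tH (hbas (g, False)) = hbas (gact g, True)"
proof
  fix c
  have "hmult Hcs tH (hbas (g, False)) c = (\<Sum>b\<in>UNIV. tH b * bas_mult b (g, False) c)"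
    by (rule hmult_hbas_right)
  also have "\<dots> = (\<Sum>h\<in>UNIV. if h = gact g then hbas (gact g, True) c else 0)"
    unfolding sum_grp_bool by (rule sum.cong) (auto simp: tH_def)
  finally show "hmult Hcs tH (hbas (g, False)) c = hbas (gact g, True) c" by simp
qed

lemma Hcs_t_t: "hmult Hcs tH tH (g, b) = (\<Sum>h\<in>UNIV. sig h * hbas (h, False) (g, b))"
proof -
  have "hmult Hcs tH tH (g, b) =
      (\<Sum>h\<in>UNIV. \<Sum>k\<in>UNIV. bas_mult (h, True) (k, True) (g, b))"
    by (simp add: Hcs_def sum_grp_bool tH_def)
  also have "\<dots> = (\<Sum>h\<in>UNIV. \<Sum>k\<in>UNIV. if k = gact h then sig h * hbas (h, False) (g, b) else 0)"
    by (intro sum.cong refl) auto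
  finally show ?thesis by simp
qed

lemma Hcs_comult_e:
  "hcomult Hcs (hbas (g, False)) (p, q) =
     (\<Sum>h\<in>UNIV. \<Sum>k\<in>UNIV. if gmul h k = g then hbas (h, False) p * hbas (k, False) q else 0)"
proof -
  obtain p1 p2 q1 q2 where pq: "p = (p1, p2)" "q = (q1, q2)" by fastforce
  have "(\<Sum>h\<in>UNIV. \<Sum>k\<in>UNIV. if gmul h k = g then hbas (h, False) p * hbas (k, False) q else 0 :: 'a) =
      (\<Sum>h\<in>UNIV. \<Sum>k\<in>UNIV. if k = q1 then if h = p1 then
         if gmul h k = g \<and> \<not> p2 \<and> \<not> q2 then 1 else 0 else 0 else 0)"
    by (intro sum.cong refl) (auto simp: hbas_def pq)
  then show ?thesis
    by (simp add: Hcs_def sum_hbas pq)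
qed

text \<open>
  \<open>\<Delta>(t) = (\<Sum>\<^bsub>g,h\<^esub> \<tau>(g, h; t) e\<^sub>g \<otimes> e\<^sub>h) (t \<otimes> t)\<close>:
\<close>

lemma Hcs_comult_t:
  "hcomult Hcs tH (p, q) =
     (\<Sum>g\<in>UNIV. \<Sum>h\<in>UNIV. tau g h * (hmult Hcs (hbas (g, False)) tH p * hmult Hcs (hbas (h, False)) tH q))"
proof -
  obtain p1 p2 q1 q2 where pq: "p = (p1, p2)" "q = (q1, q2)" by fastforce
  have "(\<Sum>g\<in>UNIV. \<Sum>h\<in>UNIV. tau g h * (hbas (g, True) p * hbas (h, True) q) :: 'a) =
      (\<Sum>g\<in>UNIV. \<Sum>h\<in>UNIV. if h = q1 then if g = p1 then
         if p2 \<and> q2 then tau g h else 0 else 0 else 0)"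
    unfolding hbas_def pq by (intro sum.cong refl) (simp split: if_split)
  also have "\<dots> = (if p2 \<and> q2 then tau p1 q1 else 0)"
    by simp
  also have "\<dots> = (\<Sum>g\<in>UNIV. if g = gmul p1 q1 then if p2 \<and> q2 then tau p1 q1 else 0 else 0)"
    by simp
  also have "\<dots> = (\<Sum>g\<in>UNIV. bas_comult (g, True) (p, q))"
    unfolding pq by (intro sum.cong refl) (simp split: if_split)
  also have "\<dots> = hcomult Hcs tH (p, q)"
    by (simp add: Hcs_def sum_grp_bool tH_def del: bas_comult.simps)
  finally show ?thesis by (simp only: Hcs_e_t)
qed

end

theory Submission
  imports Defs
begin

text \<open>
  The coalgebra \<open>H\<close> is the direct sum of \<open>k\<^sup>G\<close>, spanned by the \<open>e\<^sub>g\<close>, and \<open>k\<^sup>G t\<close>, spanned by the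
  \<open>e\<^sub>g t\<close>, and accordingly every Yetter-Drinfel'd module is the direct sum of two submodules.  So the
  coaction of a simple module \<open>V\<close> takes values in one of the two.  It has components \<open>P\<^sub>a\<close>, along
  \<open>e\<^sub>a\<close>, or \<open>U\<^sub>a\<close>, along \<open>e\<^sub>a t\<close>, and a nonzero subspace stable under these, under the projections
  \<open>e\<^sub>g\<close> and under \<open>t\<close> is all of \<open>V\<close>.  The \<open>P\<^sub>a\<close> represent the abelian group \<open>G\<close> and commute with the \<open>e\<^sub>g\<close>.  The \<open>U\<^sub>a\<close>
  represent a twisted group algebra in which \<open>x\<close> and \<open>y\<close> anticommute.  Starting with a common
  eigenvector \<open>v\<close> of suitable commuting operators, one finds that \<open>V\<close> is spanned by \<open>v\<close>, by \<open>v\<close> and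
  \<open>t v\<close>, or by \<open>v\<close> and \<open>U\<^sub>x v\<close>.  If \<open>w\<close> is homogeneous of degree \<open>h\<close>, then
  \<open>c (v \<otimes> w) = w \<otimes> P\<^sub>h v\<close> in the first case, and \<open>c (v \<otimes> w) = t w \<otimes> U\<^sub>h v\<close> in the second if \<open>t w\<close>
  has degree \<open>h\<close>.  This leaves three kinds of braidings (lemma \<open>classification\<close>): dimension one;
  diagonal type of dimension two with \<open>q\<^sub>1\<^sub>1 = q\<^sub>2\<^sub>2 = q\<close>, \<open>q\<^sup>4 = 1\<close> and
  \<open>q\<^sub>1\<^sub>2 q\<^sub>2\<^sub>1 = - q\<^sup>2\<close>, or \<open>q\<^sup>2 = 1\<close> and \<open>q\<^sub>1\<^sub>2 q\<^sub>2\<^sub>1 = 1\<close>; and the twisted pairs, for which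
  \<open>c (v \<otimes> v) = \<beta> w \<otimes> w\<close>, \<open>c (w \<otimes> w) = - \<beta> v \<otimes> v\<close> and \<open>c\<close> is multiplication by \<open>\<beta>\<close> on \<open>v \<otimes> w\<close> and
  \<open>w \<otimes> v\<close>, with \<open>\<beta>\<^sup>4 = 1\<close>.

  Finiteness of the dimension enters in one way only: a nonzero tensor of degree \<open>n\<close> that is fixed
  by all \<open>c\<^sub>i\<close> is multiplied by \<open>n!\<close> under \<open>\<Omega>\<^sub>n\<close>, so that it survives in characteristic \<open>0\<close>.  Hence no
  diagonal entry of a braiding matrix is \<open>1\<close>.  In the diagonal case of dimension two this leaves
  type \<open>A\<^sub>2\<close>, with \<open>q = -1\<close> and \<open>q\<^sub>1\<^sub>2 q\<^sub>2\<^sub>1 = -1\<close>, and quantum planes, with \<open>q = -1\<close> or \<open>q\<^sup>2 = -1\<close>.  Any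
  other diagonal basis gives the same \<open>q\<^sub>i\<^sub>i\<close> and the same product \<open>q\<^sub>1\<^sub>2 q\<^sub>2\<^sub>1\<close>.

  The twisted pairs are not of diagonal type.  But exchanging \<open>v\<close> and \<open>w\<close> at every second position
  of a word, and inserting a sign, conjugates all \<open>c\<^sub>i\<close> simultaneously to those of the diagonal
  braiding with matrix entries \<open>\<beta>\<close>, \<open>\<beta>\<close>, \<open>\<beta>\<close>, \<open>- \<beta>\<close> (lemma \<open>twisted_braided_words\<close>), and so does not
  change the ranks of the \<open>\<Omega>\<^sub>n\<close>.  For diagonal braidings the matrix of \<open>\<Omega>\<^sub>n\<close> on words is computed by
  skew derivations.  For \<open>\<beta> = 1\<close> the dimension is infinite, for \<open>\<beta> = -1\<close> one gets the Nichols algebra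
  of type \<open>A\<^sub>2\<close> at \<open>-1\<close>, of dimension \<open>8\<close>, and for \<open>\<beta>\<^sup>2 = -1\<close> a quantum plane with \<open>x\<^sub>1\<^sup>4 = x\<^sub>2\<^sup>4 = 0\<close>, of
  dimension \<open>16\<close>.
\<close>

section \<open>Linearity of the quantum symmetrizers\<close>

text \<open>
  Addition of tensors is kept opaque for the simplifier: otherwise it would be pushed below the
  operators on tensors, and linearity could no longer be applied.
\<close>

declare plus_fun_apply [simp del] zero_fun_apply [simp del]
lemmas fun_arith = fun_eq_iff plus_fun_apply zero_fun_apply sum_fun_apply

interpretation tensor: vector_space "tscale :: 'k::field \<Rightarrow> ('v, 'k) tensor \<Rightarrow> ('v, 'k) tensor"
  by unfold_locales (auto simp: tscale_def fun_arith algebra_simps)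

abbreviation tlinear :: "(('v, 'k::field) tensor \<Rightarrow> ('v, 'k) tensor) \<Rightarrow> bool" where
  "tlinear \<equiv> Vector_Spaces.linear tscale tscale"

lemma tlinearI:
  assumes "\<And>S T. f (S + T) = f S + f T" and "\<And>r T. f (tscale r T) = tscale r (f T)"
  shows "tlinear f"
  using assms by (simp add: Vector_Spaces.linear_iff tensor.vector_space_axioms)

lemma tlinear_add: "tlinear f \<Longrightarrow> f (S + T) = f S + f T"
  and tlinear_scale: "tlinear f \<Longrightarrow> f (tscale r T) = tscale r (f T)"
  by (simp_all add: Vector_Spaces.linear_iff)

lemma tlinear_0: "tlinear f \<Longrightarrow> f 0 = 0"
  using tlinear_scale[of f 0 0] by (metis tensor.scale_zero_left)

lemma tlinear_sum:
  assumes "tlinear f"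
  shows "f (\<Sum>x\<in>X. g x) = (\<Sum>x\<in>X. f (g x))"
  by (induct X rule: infinite_finite_induct) (simp_all add: tlinear_0[OF assms] tlinear_add[OF assms])

lemma tlinear_tcomp: "tlinear (tcomp n)"
  by (rule tlinearI) (auto simp: tcomp_def tscale_def fun_arith)

lemma tlinear_yd_braiding: "tlinear (yd_braiding scale act coact)"
  by (rule tlinearI)
    (auto simp: yd_braiding_def tscale_def fun_arith sum.distrib sum_distrib_left)

lemma tlinear_braid_at:
  fixes c :: "('a, 'b::field) tensor \<Rightarrow> ('a, 'b) tensor"
  assumes "tlinear c"
  shows "tlinear (braid_at c i)"
proof (rule tlinearI)
  fix S T :: "('a, 'b) tensor" and r :: "'b"
  define R where "R fs T = (\<lambda>gs. T (take (i - 1) fs @ gs @ drop (i + 1) fs))"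
    for fs and T :: "('a, 'b) tensor"
  have *: "braid_at c i T fs = (if 1 \<le> i \<and> i < length fs then c (R fs T) [fs ! (i - 1), fs ! i] else 0)" for T fs
    by (simp add: braid_at_def R_def)
  have R_add: "R fs (S + T) = R fs S + R fs T" and R_scale: "R fs (tscale r T) = tscale r (R fs T)" for fs
    by (simp_all add: R_def fun_arith tscale_def)
  have c: "c (R fs (S + T)) gs = c (R fs S) gs + c (R fs T) gs"
      "c (R fs (tscale r T)) gs = r * c (R fs T) gs" for fs gs
    unfolding R_add R_scale tlinear_add[OF assms] tlinear_scale[OF assms] plus_fun_apply
    by (simp_all add: tscale_def)
  show "braid_at c i (S + T) = braid_at c i S + braid_at c i T"
    by (rule ext, subst plus_fun_apply) (simp add: * c)
  show "braid_at c i (tscale r T) = tscale r (braid_at c i T)"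
    by (rule ext, subst (2) tscale_def) (simp add: * c)
qed

lemma tlinear_braid_chain:
  assumes "tlinear c"
  shows "tlinear (braid_chain c n k)"
proof (induct k)
  case 0 show ?case by (rule tlinearI) auto
next
  case (Suc k)
  note lin = Suc tlinear_braid_at[OF assms]
  show ?case by (intro tlinearI) (simp_all add: lin[THEN tlinear_add] lin[THEN tlinear_scale])
qed

lemma tlinear_quantum_shuffle:
  assumes "tlinear c"
  shows "tlinear (quantum_shuffle c n)"
  by (intro tlinearI)
    (simp_all add: quantum_shuffle_def tlinear_add[OF tlinear_braid_chain[OF assms]]
      tlinear_scale[OF tlinear_braid_chain[OF assms]] sum.distrib tensor.scale_sum_right)

lemma tlinear_quantum_symm:
  assumes "tlinear c"
  shows "tlinear (quantum_symm c n)"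
proof (induct n)
  case 0 show ?case by (rule tlinearI) auto
next
  case (Suc k)
  note lin = Suc tlinear_quantum_shuffle[OF assms]
  show ?case by (intro tlinearI) (simp_all add: lin[THEN tlinear_add] lin[THEN tlinear_scale])
qed

section \<open>Infinite-dimensional Nichols algebras\<close>

lemma braid_chain_fixed:
  assumes "\<And>i. 1 \<le> i \<Longrightarrow> i \<le> n \<Longrightarrow> braid_at c i T = T" and "k \<le> n"
  shows "braid_chain c n k T = T"
  using assms(2) by (induct k) (auto simp: assms(1))

text \<open>All \<open>n!\<close> products of the \<open>c\<^sub>i\<close> that make up \<open>\<Omega>\<^sub>n\<close> act as the identity.\<close>

lemma quantum_symm_fixed:
  assumes c: "tlinear c" and fixed: "\<And>i. 1 \<le> i \<Longrightarrow> i < n \<Longrightarrow> braid_at c i T = T"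
  shows "quantum_symm c n T = tscale (fact n) T"
  using fixed
proof (induct n)
  case 0 show ?case by (simp add: tscale_def)
next
  case (Suc n)
  have "quantum_shuffle c n T = (\<Sum>k\<le>n. T)"
    unfolding quantum_shuffle_def using Suc.prems by (intro sum.cong refl braid_chain_fixed) auto
  also have "\<dots> = tscale (of_nat (Suc n)) T"
    by (simp add: fun_arith tscale_def sum_fun_apply)
  finally show ?case
    using Suc tlinear_scale[OF tlinear_quantum_symm[OF c]] by (simp add: tensor.scale_scale)
qed

lemma tcomp_pure_tensor:
  "tcomp n (pure_tensor scale vs) = (if length vs = n then pure_tensor scale vs else 0)"
  by (auto simp: tcomp_def pure_tensor_def fun_arith)

lemma tensor_algebra_bounded:
  assumes "T \<in> tensor_algebra scale"
  shows "\<exists>N. \<forall>n\<ge>N. tcomp n T = 0"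
  using assms unfolding tensor_algebra_def
proof (induct rule: tensor.span_induct_alt)
  case base then show ?case by (simp add: tlinear_0[OF tlinear_tcomp])
next
  case (step r S T)
  then obtain N vs where "\<forall>n\<ge>N. tcomp n T = 0" "S = pure_tensor scale vs" by auto
  then show ?case
    by (intro exI[of _ "max N (Suc (length vs))"])
      (auto simp: tlinear_add[OF tlinear_tcomp] tlinear_scale[OF tlinear_tcomp] tcomp_pure_tensor)
qed

text \<open>
  In a degree above the degrees of all representatives of a finite basis, every tensor lies in the
  ideal; but \<open>\<Omega>\<^sub>n\<close> multiplies \<open>T n\<close> by \<open>n!\<close>.
\<close>

lemma not_nichols_finite_dim:
  fixes scale :: "'k::field_char_0 \<Rightarrow> 'v::ab_group_add \<Rightarrow> 'v"
  assumes c: "tlinear c"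
    and T: "\<And>n. T n \<in> tensor_algebra scale" "\<And>n. tcomp n (T n) = T n" "\<And>n. T n \<noteq> 0"
    and fixed: "\<And>n i. 1 \<le> i \<Longrightarrow> i < n \<Longrightarrow> braid_at c i (T n) = T n"
  shows "\<not> nichols_finite_dim scale c"
proof
  assume "nichols_finite_dim scale c"
  then obtain S where S: "finite S" "S \<subseteq> tensor_algebra scale"
      and gen: "tensor_algebra scale = {s + t |s t. s \<in> tensor.span S \<and> t \<in> nichols_ideal scale c}"
    by (auto simp: nichols_finite_dim_def nichols_has_dim_def quotient_basis_def)
  have "\<forall>s\<in>S. \<exists>N. \<forall>n\<ge>N. tcomp n s = 0" using tensor_algebra_bounded S by blast
  then obtain N where N: "\<And>s n. s \<in> S \<Longrightarrow> n \<ge> N s \<Longrightarrow> tcomp n s = 0" by metis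
  define n where "n = Max (insert 0 (N ` S))"
  have zero: "tcomp n s = 0" if "s \<in> tensor.span S" for s
    using that
  proof (induct rule: tensor.span_induct_alt)
    case base then show ?case by (simp add: tlinear_0[OF tlinear_tcomp])
  next
    case (step r x y)
    have "N x \<le> n" using step S(1) by (simp add: n_def)
    then show ?case using step N
      by (simp add: tlinear_add[OF tlinear_tcomp] tlinear_scale[OF tlinear_tcomp])
  qed
  obtain s t where st: "T n = s + t" "s \<in> tensor.span S" "t \<in> nichols_ideal scale c"
    using T(1)[of n] gen by auto
  have "T n = tcomp n t"
    using st zero T(2)[of n] by (metis add_0 tlinear_add[OF tlinear_tcomp])
  then have "quantum_symm c n (T n) = 0" using st(3) by (simp add: nichols_ideal_def)
  then have "tscale (fact n) (T n) = 0" using quantum_symm_fixed[OF c fixed] by metis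
  then show False using T(3) by (simp add: tensor.scale_eq_0_iff)
qed

section \<open>Braidings that permute words up to scalars\<close>

context
  fixes q :: "'a \<Rightarrow> 'a \<Rightarrow> 'k::field"
begin

text \<open>
  Let \<open>q\<close> be the braiding matrix of a diagonal braiding with a basis of letters.  Moving the letter
  \<open>a\<close> to the end of the word \<open>u\<close> multiplies by \<open>qprod a u\<close>.
\<close>

definition qprod :: "'a \<Rightarrow> 'a list \<Rightarrow> 'k" where
  "qprod a u = prod_list (map (q a) u)"

text \<open>
  The value of the linear form \<open>f\<close> at the skew derivative of a word by the letter \<open>a\<close>: the sum over
  all occurrences of \<open>a\<close>, each moved to the end and removed there.
\<close>

primrec skew_der :: "'a \<Rightarrow> ('a list \<Rightarrow> 'k) \<Rightarrow> 'a list \<Rightarrow> 'k" where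
  "skew_der a f [] = 0"
| "skew_der a f (b # u) = (if a = b then qprod a u * f u else 0) + skew_der a (\<lambda>z. f (b # z)) u"

text \<open>
  \<open>word_form y x\<close> is the entry of \<open>\<Omega>\<^sub>n\<close> at the words \<open>rev y\<close> and \<open>x\<close>; see \<open>quantum_symm_word\<close>.  By the
  recursion \<open>\<Omega>\<^sub>n = (\<Omega>\<^sub>n\<^sub>-\<^sub>1 \<otimes> id) \<Omega>\<^bsub>n-1,1\<^esub>\<close> the last letter is split off first, whence the reversal.
\<close>

primrec word_form :: "'a list \<Rightarrow> 'a list \<Rightarrow> 'k" where
  "word_form [] x = (if x = [] then 1 else 0)"
| "word_form (a # y) x = skew_der a (word_form y) x"

lemma qprod_simps [simp]:
  "qprod a [] = 1" "qprod a (b # u) = q a b * qprod a u" "qprod a (u @ v) = qprod a u * qprod a v"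
  "qprod a (replicate n b) = q a b ^ n"
  by (simp_all add: qprod_def)

lemma skew_der_sum:
  "skew_der a f x = (\<Sum>i<length x. if x ! i = a
     then qprod a (drop (Suc i) x) * f (take i x @ drop (Suc i) x) else 0)"
proof (induct x arbitrary: f)
  case (Cons b u)
  show ?case unfolding skew_der.simps Cons list.size add_0_right add_Suc_right add_0 sum.lessThan_Suc_shift
    by (auto intro!: arg_cong2[of _ _ _ _ "(+)"] sum.cong)
qed simp

lemma skew_der_cmult: "skew_der a (\<lambda>z. r * f z) x = r * skew_der a f x"
  by (induct x arbitrary: f) (simp_all add: algebra_simps)

lemma skew_der_append:
  "skew_der a f (u @ v) = qprod a v * skew_der a (\<lambda>z. f (z @ v)) u + skew_der a (\<lambda>z. f (u @ z)) v"
  by (induct u arbitrary: f) (simp_all add: algebra_simps)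

lemma skew_der_replicate:
  "skew_der a f (replicate n a) = (\<Sum>i<n. q a a ^ i) * f (replicate (n - 1) a)"
proof (induct n arbitrary: f)
  case (Suc n)
  show ?case
    unfolding replicate_Suc skew_der.simps Suc by (cases n) (simp_all add: algebra_simps)
qed simp

lemma skew_der_replicate_other: "a \<noteq> b \<Longrightarrow> skew_der a f (replicate n b) = 0"
  by (induct n arbitrary: f) simp_all

lemma word_form_length: "length y \<noteq> length x \<Longrightarrow> word_form y x = 0"
proof (induct y arbitrary: x)
  case (Cons a y)
  then show ?case by (auto simp: skew_der_sum intro!: sum.neutral)
qed auto

text \<open>
  The kernels of the \<open>\<Omega>\<^sub>n\<close> form an ideal, and a relation \<open>u = \<kappa> u'\<close> holds in the Nichols algebra once
  its skew derivatives hold: a derivative of \<open>p @ u @ r\<close> that removes a letter of \<open>p\<close> or \<open>r\<close> leaves an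
  instance of the relation in lower degree, with a factor that depends on \<open>u\<close> only through
  \<open>qprod a u\<close>.  In \<open>der\<close>, relations proved before may be used to simplify the derivatives.
\<close>

lemma word_form_relation:
  assumes diag: "\<And>a. qprod a u = qprod a u'"
    and der: "\<And>a y p r. skew_der a (\<lambda>z. word_form y (p @ z @ r)) u =
                \<kappa> * skew_der a (\<lambda>z. word_form y (p @ z @ r)) u'"
    and len: "u \<noteq> []" "u' \<noteq> []"
  shows "word_form y (p @ u @ r) = \<kappa> * word_form y (p @ u' @ r)"
proof (induct y arbitrary: p r)
  case Nil then show ?case using len by simp
next
  case (Cons a y)
  show ?case
    by (simp add: skew_der_append diag der Cons skew_der_cmult algebra_simps
        flip: append_assoc) (simp add: Cons der skew_der_cmult algebra_simps)
qed

end

text \<open>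
  A basis of the tensor algebra indexed by words, on which the \<open>c\<^sub>i\<close> act as for a diagonal braiding
  with matrix \<open>q\<close>.  The tensor \<open>W x\<close> need not be the product of the letters of \<open>x\<close>, so that \<open>c\<close> itself
  need not be diagonal.
\<close>

locale braided_words =
  fixes scale :: "'k::field \<Rightarrow> 'v::ab_group_add \<Rightarrow> 'v"
    and c :: "('v, 'k) tensor \<Rightarrow> ('v, 'k) tensor"
    and q :: "'a::finite \<Rightarrow> 'a \<Rightarrow> 'k"
    and W :: "'a list \<Rightarrow> ('v, 'k) tensor"
  assumes linear: "tlinear c"
    and braid: "braid_at c (Suc (length p)) (W (p @ [a, b] @ r)) = tscale (q a b) (W (p @ [b, a] @ r))"
    and homogeneous: "tcomp n (W x) = (if length x = n then W x else 0)"
    and span: "tensor_algebra scale = tensor.span (range W)"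
    and independent: "finite X \<Longrightarrow> (\<Sum>x\<in>X. tscale (k x) (W x)) = 0 \<Longrightarrow> x \<in> X \<Longrightarrow> k x = 0"
begin

lemma braid_chain_word:
  "length u = k \<Longrightarrow> length p + k = n \<Longrightarrow>
    braid_chain c n k (W (p @ a # u @ r)) = tscale (qprod q a u) (W (p @ u @ a # r))"
proof (induct k arbitrary: p u)
  case (Suc k)
  then obtain b u' where u: "u = b # u'" "length u' = k" by (cases u) auto
  have "n - k = Suc (length p)" using Suc by simp
  then have "braid_chain c n (Suc k) (W (p @ a # u @ r)) =
      braid_chain c n k (tscale (q a b) (W ((p @ [b]) @ a # u' @ r)))"
    using braid[of p a b "u' @ r"] by (simp add: u)
  also have "\<dots> = tscale (q a b) (tscale (qprod q a u') (W ((p @ [b]) @ u' @ a # r)))"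
    using Suc u by (subst tlinear_scale[OF tlinear_braid_chain[OF linear]]) (subst Suc.hyps, auto)
  finally show ?case by (simp add: u)
qed simp

lemma quantum_shuffle_word:
  assumes "length x = Suc n"
  shows "quantum_shuffle c n (W (x @ r)) =
    (\<Sum>i<Suc n. tscale (qprod q (x ! i) (drop (Suc i) x)) (W ((take i x @ drop (Suc i) x) @ x ! i # r)))"
proof -
  have "quantum_shuffle c n (W (x @ r)) = (\<Sum>i<Suc n. braid_chain c n (n - i) (W (x @ r)))"
    unfolding quantum_shuffle_def lessThan_Suc_atMost
    by (rule sum.reindex_bij_witness[of _ "\<lambda>i. n - i" "\<lambda>i. n - i"]) auto
  also have "\<dots> = (\<Sum>i<Suc n. tscale (qprod q (x ! i) (drop (Suc i) x)) (W ((take i x @ drop (Suc i) x) @ x ! i # r)))"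
  proof (rule sum.cong[OF refl])
    fix i assume "i \<in> {..<Suc n}"
    then have i: "i < length x" "i \<le> n" using assms by auto
    then have "x @ r = take i x @ x ! i # drop (Suc i) x @ r"
      by (metis append_Cons append_assoc id_take_nth_drop)
    then have "W (x @ r) = W (take i x @ x ! i # drop (Suc i) x @ r)" by (rule arg_cong)
    then show "braid_chain c n (n - i) (W (x @ r)) =
        tscale (qprod q (x ! i) (drop (Suc i) x)) (W ((take i x @ drop (Suc i) x) @ x ! i # r))"
      using i assms braid_chain_word[of "drop (Suc i) x" "n - i" "take i x" n "x ! i" r] by simp
  qed
  finally show ?thesis .
qed

lemma finite_words: "finite {y :: 'a list. length y = n}"
  using finite_lists_length_eq[of "UNIV :: 'a set" n] by simp

lemma sum_words_Suc:
  "(\<Sum>y | length (y :: 'a list) = Suc n. f y) = (\<Sum>a\<in>UNIV. \<Sum>y | length y = n. f (a # y))"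
proof -
  have "(\<Sum>y | length (y :: 'a list) = Suc n. f y) = (\<Sum>(a, y)\<in>UNIV \<times> {y. length y = n}. f (a # y))"
    by (rule sum.reindex_bij_witness[of _ "\<lambda>(a, y). a # y" "\<lambda>y. (hd y, tl y)"])
      (auto simp: length_Suc_conv)
  then show ?thesis by (simp add: sum.cartesian_product)
qed

text \<open>The word \<open>r\<close> is carried along because \<open>\<Omega>\<^sub>n\<close> is applied to the first \<open>n\<close> letters of longer words.\<close>

lemma quantum_symm_word:
  "length x = n \<Longrightarrow> quantum_symm c n (W (x @ r)) =
     (\<Sum>y | length y = n. tscale (word_form q y x) (W (rev y @ r)))"
proof (induct n arbitrary: x r)
  case 0
  have "{y :: 'a list. y = []} = {[]}" by auto
  with 0 show ?case by simp
next
  case (Suc n)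
  let ?d = "\<lambda>i. take i x @ drop (Suc i) x" and ?k = "\<lambda>i. qprod q (x ! i) (drop (Suc i) x)"
  have "quantum_symm c (Suc n) (W (x @ r)) =
      (\<Sum>i<Suc n. tscale (?k i) (quantum_symm c n (W (?d i @ x ! i # r))))"
    by (simp only: quantum_symm.simps quantum_shuffle_word[OF Suc.prems]
        tlinear_sum[OF tlinear_quantum_symm[OF linear]] tlinear_scale[OF tlinear_quantum_symm[OF linear]])
  also have "\<dots> = (\<Sum>i<Suc n. \<Sum>y | length y = n.
      tscale (?k i * word_form q y (?d i)) (W (rev (x ! i # y) @ r)))"
    using Suc.prems by (intro sum.cong refl) (subst Suc.hyps, auto simp: tensor.scale_sum_right)
  also have "\<dots> = (\<Sum>i<Suc n. \<Sum>y | length y = n. \<Sum>a\<in>UNIV. if x ! i = a then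
      tscale (?k i * word_form q y (?d i)) (W (rev (a # y) @ r)) else 0)"
    by simp
  also have "\<dots> = (\<Sum>a\<in>UNIV. \<Sum>y | length y = n. \<Sum>i<Suc n. if x ! i = a then
      tscale (?k i * word_form q y (?d i)) (W (rev (a # y) @ r)) else 0)"
    by (subst sum.swap, subst sum.swap, subst sum.swap) (rule refl)
  also have "\<dots> = (\<Sum>a\<in>UNIV. \<Sum>y | length y = n. tscale (word_form q (a # y) x) (W (rev (a # y) @ r)))"
    unfolding word_form.simps skew_der_sum Suc.prems tensor.scale_sum_left
    by (intro sum.cong refl) simp
  finally show ?case by (simp only: sum_words_Suc)
qed

lemma word_combination_in_ideal_iff:
  assumes X: "finite X"
  shows "(\<Sum>x\<in>X. tscale (r x) (W x)) \<in> nichols_ideal scale c \<longleftrightarrow>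
    (\<forall>y. (\<Sum>x\<in>X. r x * word_form q y x) = 0)"
proof -
  let ?T = "\<Sum>x\<in>X. tscale (r x) (W x)"
  have in_alg: "?T \<in> tensor_algebra scale"
    unfolding span by (intro tensor.span_sum tensor.span_scale tensor.span_base) auto
  have eq: "quantum_symm c n (tcomp n ?T) =
      (\<Sum>y | length y = n. tscale (\<Sum>x\<in>X. r x * word_form q y x) (W (rev y)))" for n
  proof -
    have "quantum_symm c n (tcomp n ?T) =
        (\<Sum>x\<in>X. tscale (r x) (if length x = n then quantum_symm c n (W (x @ [])) else 0))"
      by (simp add: tlinear_sum[OF tlinear_tcomp] tlinear_scale[OF tlinear_tcomp]
          tlinear_sum[OF tlinear_quantum_symm[OF linear]] tlinear_scale[OF tlinear_quantum_symm[OF linear]]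
          homogeneous tlinear_0[OF tlinear_quantum_symm[OF linear]] if_distrib[of "quantum_symm c n"]
          cong: if_cong)
    also have "\<dots> = (\<Sum>x\<in>X. \<Sum>y | length y = n. tscale (r x * word_form q y x) (W (rev y)))"
    proof (intro sum.cong refl)
      fix x
      show "tscale (r x) (if length x = n then quantum_symm c n (W (x @ [])) else 0) =
          (\<Sum>y | length y = n. tscale (r x * word_form q y x) (W (rev y)))"
        by (cases "length x = n")
          (auto simp: quantum_symm_word tensor.scale_sum_right word_form_length intro!: sum.neutral[symmetric]
            simp del: append_Nil2, simp add: quantum_symm_word[where r = "[]", simplified] tensor.scale_sum_right)
    qed
    finally show ?thesis by (subst (asm) sum.swap) (simp add: tensor.scale_sum_left)
  qed
  show ?thesis
  proof
    assume T: "?T \<in> nichols_ideal scale c"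
    show "\<forall>y. (\<Sum>x\<in>X. r x * word_form q y x) = 0"
    proof
      fix y :: "'a list"
      let ?f = "\<lambda>y. \<Sum>x\<in>X. r x * word_form q y x" and ?n = "length y"
      have "0 = (\<Sum>z | length z = ?n. tscale (?f z) (W (rev z)))"
        using T eq[of ?n] by (simp add: nichols_ideal_def)
      also have "\<dots> = (\<Sum>z | length z = ?n. tscale (?f (rev z)) (W z))"
        by (rule sum.reindex_bij_witness[of _ rev rev]) auto
      finally show "?f y = 0"
        using independent[of "{z. length z = ?n}" "\<lambda>z. ?f (rev z)" "rev y"] finite_words by simp
    qed
  next
    assume "\<forall>y. (\<Sum>x\<in>X. r x * word_form q y x) = 0"
    then show "?T \<in> nichols_ideal scale c" using in_alg eq by (simp add: nichols_ideal_def)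
  qed
qed

lemma subspace_nichols_ideal: "tensor.subspace (nichols_ideal scale c)"
proof -
  have lin: "tlinear (\<lambda>T. quantum_symm c n (tcomp n T))" for n
    by (rule tlinearI) (simp_all add: tlinear_add[OF tlinear_tcomp] tlinear_scale[OF tlinear_tcomp]
      tlinear_add[OF tlinear_quantum_symm[OF linear]] tlinear_scale[OF tlinear_quantum_symm[OF linear]])
  show ?thesis
    unfolding nichols_ideal_def tensor.subspace_def span
    by (auto simp: tlinear_0[OF lin] tlinear_add[OF lin] tlinear_scale[OF lin]
        tensor.span_zero tensor.span_add tensor.span_scale)
qed

text \<open>
  The Nichols algebra is the space of columns of \<open>word_form\<close>, so its bases of monomials can be read
  off from this matrix.
\<close>

lemma nichols_has_dim_word_basis:
  assumes S: "finite S"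
    and spanning: "\<And>x. \<exists>r. \<forall>y. word_form q y x = (\<Sum>s\<in>S. r s * word_form q y s)"
    and indep: "\<And>r. \<forall>y. (\<Sum>s\<in>S. r s * word_form q y s) = 0 \<Longrightarrow> \<forall>s\<in>S. r s = 0"
  shows "nichols_has_dim scale c (card S)"
proof -
  let ?K = "nichols_ideal scale c"
  have inj: "inj_on W S"
  proof (rule inj_onI, rule ccontr)
    fix s t assume st: "s \<in> S" "t \<in> S" "W s = W t" "s \<noteq> t"
    have "(\<Sum>x\<in>{s, t}. tscale (if x = s then 1 else -1) (W x)) = 0"
      using st by (simp add: tscale_def fun_arith)
    from independent[OF _ this, of s] show False by simp
  qed
  have "tensor_algebra scale = {s + t |s t. s \<in> tensor.span (W ` S) \<and> t \<in> ?K}" (is "_ = ?R")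
  proof
    have "tensor.subspace ?R"
      by (intro tensor.subspace_sums tensor.subspace_span subspace_nichols_ideal)
    moreover have "range W \<subseteq> ?R"
    proof (intro image_subsetI)
      fix x
      show "W x \<in> ?R"
      proof (cases "x \<in> S")
        case True
        then have "W x = W x + 0" "W x \<in> tensor.span (W ` S)" by (auto intro: tensor.span_base)
        then show ?thesis using tensor.subspace_0[OF subspace_nichols_ideal] by blast
      next
        case False
        obtain r where r: "\<And>y. word_form q y x = (\<Sum>s\<in>S. r s * word_form q y s)" using spanning[of x] by auto
        let ?s = "\<Sum>s\<in>S. tscale (r s) (W s)" and ?r' = "\<lambda>z. if z = x then 1 else - r z"
        have "(\<Sum>z\<in>S. tscale (?r' z) (W z)) = - ?s"
          unfolding sum_negf[symmetric] using False by (intro sum.cong) auto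
        then have "(\<Sum>z\<in>insert x S. tscale (?r' z) (W z)) = W x - ?s"
          using S False by simp
        moreover have "(\<Sum>z\<in>S. ?r' z * word_form q y z) = - (\<Sum>s\<in>S. r s * word_form q y s)" for y
          unfolding sum_negf[symmetric] using False by (intro sum.cong) auto
        then have "(\<Sum>z\<in>insert x S. ?r' z * word_form q y z) = 0" for y
          using S False r by simp
        ultimately have "W x - ?s \<in> ?K"
          using word_combination_in_ideal_iff[of "insert x S" ?r'] S by simp
        moreover have "?s \<in> tensor.span (W ` S)"
          by (intro tensor.span_sum tensor.span_scale tensor.span_base) auto
        moreover have "W x = ?s + (W x - ?s)" by simp
        ultimately show ?thesis by blast
      qed
    qed
    ultimately show "tensor_algebra scale \<subseteq> ?R" unfolding span by (rule tensor.span_minimal[rotated])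
    have "tensor.span (W ` S) \<subseteq> tensor_algebra scale" unfolding span by (intro tensor.span_mono) auto
    moreover have "?K \<subseteq> tensor_algebra scale" by (auto simp: nichols_ideal_def)
    ultimately show "?R \<subseteq> tensor_algebra scale" unfolding span by (auto intro!: tensor.span_add)
  qed
  moreover have "\<forall>a. (\<Sum>T\<in>W ` S. tscale (a T) T) \<in> ?K \<longrightarrow> (\<forall>T\<in>W ` S. a T = 0)"
  proof (intro allI impI)
    fix a assume "(\<Sum>T\<in>W ` S. tscale (a T) T) \<in> ?K"
    then have "\<forall>y. (\<Sum>s\<in>S. a (W s) * word_form q y s) = 0"
      using word_combination_in_ideal_iff[OF S, of "\<lambda>s. a (W s)"] by (simp add: sum.reindex[OF inj])
    then show "\<forall>T\<in>W ` S. a T = 0" using indep[of "\<lambda>s. a (W s)"] by simp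
  qed
  moreover have "W ` S \<subseteq> tensor_algebra scale" unfolding span by (auto intro: tensor.span_base)
  ultimately have "quotient_basis tscale (tensor_algebra scale) ?K (W ` S)"
    using S by (simp add: quotient_basis_def)
  then show ?thesis unfolding nichols_has_dim_def using card_image[OF inj] by blast
qed

end

section \<open>The Nichols algebras of dimension 16 and 8\<close>

text \<open>
  The letters are \<open>False\<close> and \<open>True\<close>.  The matrix satisfies \<open>q\<^sub>1\<^sub>1 = q\<^sub>2\<^sub>2 = \<beta>\<close> and
  \<open>q\<^sub>1\<^sub>2 q\<^sub>2\<^sub>1 = - \<beta>\<^sup>2\<close>.
\<close>

definition twisted_matrix :: "'k::field \<Rightarrow> bool \<Rightarrow> bool \<Rightarrow> 'k" where
  "twisted_matrix \<beta> a b = (if a \<and> \<not> b then - \<beta> else \<beta>)"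

lemma twisted_matrix_simps [simp]:
  "twisted_matrix \<beta> True False = - \<beta>" "twisted_matrix \<beta> False b = \<beta>" "twisted_matrix \<beta> a True = \<beta>" "twisted_matrix \<beta> a a = \<beta>"
  by (simp_all add: twisted_matrix_def)

text \<open>For \<open>\<beta>\<^sup>2 = -1\<close> the product \<open>q\<^sub>1\<^sub>2 q\<^sub>2\<^sub>1\<close> is \<open>1\<close> and the \<open>q\<^sub>i\<^sub>i\<close> have order \<open>4\<close>: a quantum plane.\<close>

context
  fixes \<beta> :: "'k::field_char_0"
  assumes \<beta>: "\<beta> * \<beta> = -1"
begin

abbreviation "plane_form \<equiv> word_form (twisted_matrix \<beta>)"

lemma \<beta>_mult: "\<beta> * (\<beta> * z) = - z" by (simp add: \<beta> mult.assoc[symmetric])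

lemma plane_swap:
  "plane_form y (p @ [True, False] @ r) = - \<beta> * plane_form y (p @ [False, True] @ r)"
  by (rule word_form_relation) (auto simp: \<beta> \<beta>_mult)

text \<open>The skew derivative of \<open>b\<^sup>4\<close> is \<open>1 + \<beta> + \<beta>\<^sup>2 + \<beta>\<^sup>3 = 0\<close> times \<open>b\<^sup>3\<close>.\<close>

lemma plane_power: "plane_form y (p @ replicate 4 b @ r) = 0"
proof -
  have "plane_form y (p @ replicate 4 b @ r) = 0 * plane_form y (p @ replicate 4 b @ r)"
    by (rule word_form_relation)
      (cases b, auto simp: numeral_eq_Suc \<beta> \<beta>_mult)
  then show ?thesis by simp
qed

lemma plane_swap_replicate:
  "plane_form y (p @ True # replicate n False @ r) = (- \<beta>) ^ n * plane_form y (p @ replicate n False @ True # r)"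
proof (induct n arbitrary: p)
  case (Suc n)
  show ?case
    using plane_swap[of y p "replicate n False @ r"] Suc[of "p @ [False]"]
    by simp
qed simp

lemma plane_sorted:
  "\<exists>k a b. \<forall>y p. plane_form y (p @ x) = k * plane_form y (p @ replicate a False @ replicate b True)"
proof (induct x)
  case Nil
  have "\<forall>y p. plane_form y (p @ []) = 1 * plane_form y (p @ replicate 0 False @ replicate 0 True)" by simp
  then show ?case by blast
next
  case (Cons l x)
  then obtain k a b where IH:
    "\<And>y p. plane_form y (p @ x) = k * plane_form y (p @ replicate a False @ replicate b True)" by blast
  have "plane_form y (p @ l # x) = k * plane_form y (p @ l # replicate a False @ replicate b True)" for y p
    using IH[of y "p @ [l]"] by simp
  moreover have "plane_form y (p @ l # replicate a False @ replicate b True) =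
      (if l then (- \<beta>) ^ a else 1) * plane_form y (p @ replicate (if l then a else Suc a) False
         @ replicate (if l then Suc b else b) True)" for y p
    using plane_swap_replicate[of y p a "replicate b True"] by simp
  ultimately have "\<forall>y p. plane_form y (p @ l # x) = (k * (if l then (- \<beta>) ^ a else 1)) *
      plane_form y (p @ replicate (if l then a else Suc a) False @ replicate (if l then Suc b else b) True)"
    by simp
  then show ?case by blast
qed

lemma skew_der_sorted:
  "skew_der (twisted_matrix \<beta>) True f (replicate a False @ replicate b True) =
    (\<Sum>i<b. \<beta> ^ i) * f (replicate a False @ replicate (b - 1) True)"
  "skew_der (twisted_matrix \<beta>) False f (replicate a False @ replicate b True) =
    \<beta> ^ b * (\<Sum>i<a. \<beta> ^ i) * f (replicate (a - 1) False @ replicate b True)"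
  by (simp_all add: skew_der_append skew_der_replicate skew_der_replicate_other)

lemma sum_powers_nonzero: "b < 4 \<Longrightarrow> (\<Sum>i<b. \<beta> ^ i) = 0 \<longleftrightarrow> b = 0"
proof -
  assume "b < 4"
  then have "b = 0 \<or> b = 1 \<or> b = 2 \<or> b = 3" by auto
  moreover have "1 + \<beta> \<noteq> 0"
  proof
    assume "1 + \<beta> = 0"
    then have "\<beta> = -1" by (metis add_eq_0_iff2 add.commute)
    then show False using \<beta> by simp
  qed
  moreover have "\<beta> \<noteq> 0" using \<beta> by auto
  moreover have "(\<Sum>i<2. \<beta> ^ i) = 1 + \<beta>" "(\<Sum>i<3. \<beta> ^ i) = \<beta>"
    by (simp_all add: numeral_eq_Suc \<beta>)
  ultimately show ?thesis by auto
qed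

text \<open>
  Removing the letters \<open>True\<close> first, then the letters \<open>False\<close>, yields the product of the quantum
  factorials of \<open>b\<close> and \<open>a\<close> up to a power of \<open>\<beta>\<close>, which is nonzero below the order \<open>4\<close> of \<open>\<beta>\<close>.
\<close>

lemma plane_form_sorted:
  assumes "b < 4" "a < 4"
  shows "plane_form (replicate b True @ replicate a False) (replicate a' False @ replicate b' True) = 0
     \<longleftrightarrow> \<not> (a' = a \<and> b' = b)"
  using \<open>b < 4\<close>
proof (induct b arbitrary: b')
  case 0
  show ?case using \<open>a < 4\<close>
  proof (induct a arbitrary: a')
    case (Suc a)
    have nz: "\<beta> \<noteq> 0" "\<beta> ^ b' \<noteq> 0" "(\<Sum>i<Suc a. \<beta> ^ i) \<noteq> 0" using \<beta> sum_powers_nonzero[OF Suc.prems] by auto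
    have "plane_form (replicate 0 True @ replicate (Suc a) False) (replicate a' False @ replicate b' True) =
        \<beta> ^ b' * (\<Sum>i<a'. \<beta> ^ i) *
          plane_form (replicate 0 True @ replicate a False) (replicate (a' - 1) False @ replicate b' True)"
      by (simp add: skew_der_sorted)
    also have "\<dots> = 0 \<longleftrightarrow> (\<Sum>i<a'. \<beta> ^ i) = 0 \<or> \<not> (a' - 1 = a \<and> b' = 0)"
      using nz Suc by simp
    also have "\<dots> \<longleftrightarrow> \<not> (a' = Suc a \<and> b' = 0)" using nz by (cases a') auto
    finally show ?case .
  qed simp
next
  case (Suc b)
  have nz: "(\<Sum>i<Suc b. \<beta> ^ i) \<noteq> 0" using sum_powers_nonzero[OF Suc.prems] by auto
  have "plane_form (replicate (Suc b) True @ replicate a False) (replicate a' False @ replicate b' True) =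
      (\<Sum>i<b'. \<beta> ^ i) *
        plane_form (replicate b True @ replicate a False) (replicate a' False @ replicate (b' - 1) True)"
    by (simp add: skew_der_sorted)
  also have "\<dots> = 0 \<longleftrightarrow> (\<Sum>i<b'. \<beta> ^ i) = 0 \<or> \<not> (a' = a \<and> b' - 1 = b)"
    using Suc by simp
  also have "\<dots> \<longleftrightarrow> \<not> (a' = a \<and> b' = Suc b)" using nz by (cases b') auto
  finally show ?case .
qed

end

text \<open>For \<open>\<beta> = -1\<close> the squares of the letters vanish, and all words that survive alternate.\<close>

abbreviation "A2_form \<equiv> word_form (twisted_matrix (-1 :: 'k::field_char_0))"

lemma A2_square: "A2_form y (p @ [b, b] @ r) = 0"
proof -
  have "A2_form y (p @ [b, b] @ r) = 0 * A2_form y (p @ [b, b] @ r)"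
    by (rule word_form_relation) (cases b, auto)
  then show ?thesis by simp
qed

lemma A2_square':
  "A2_form y (b # b # r) = 0" "A2_form y (a # b # b # r) = 0" "A2_form y (a # a' # b # b # r) = 0"
  "A2_form y (a # a' # a'' # b # b # r) = 0"
  "A2_form y (p @ b # b # r) = 0" "A2_form y (p @ a # b # b # r) = 0"
  using A2_square[of y "[]" b r] A2_square[of y "[a]" b r] A2_square[of y "[a, a']" b r]
    A2_square[of y "[a, a', a'']" b r] A2_square[of y p b r] A2_square[of y "p @ [a]" b r]
  by simp_all

text \<open>
  This is \<open>z\<^sup>2 = 0\<close> for the root vector \<open>z = x\<^sub>1 x\<^sub>2 - q\<^sub>1\<^sub>2 x\<^sub>2 x\<^sub>1\<close>, written out modulo the squares of the
  letters.
\<close>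

lemma A2_alternating:
  "A2_form y (p @ [True, False, True, False] @ r) = - 1 * A2_form y (p @ [False, True, False, True] @ r)"
  by (rule word_form_relation) (auto simp: A2_square')

lemma A2_alternating':
  "A2_form y (True # False # True # False # r) = - A2_form y (False # True # False # True # r)"
  using A2_alternating[of y "[]" r] by simp

lemma A2_length5: "length x \<ge> 5 \<Longrightarrow> A2_form y x = 0"
proof -
  assume "length x \<ge> 5"
  then obtain a b c d e r where x: "x = a # b # c # d # e # r"
    by (auto simp: Suc_le_length_iff numeral_eq_Suc)
  have "A2_form y (True # False # True # False # True # r) = 0"
    unfolding A2_alternating' by (simp add: A2_square')
  moreover have "A2_form y (False # True # False # True # False # r) =
      - A2_form y (True # False # True # False # False # r)"
    unfolding A2_alternating' by simp
  ultimately show ?thesis unfolding x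
    by (cases a; cases b; cases c; cases d; cases e) (simp_all add: A2_square')
qed

context braided_words
begin

lemma nichols_has_dim_monomial_basis:
  assumes S: "finite S"
    and spanning: "\<And>x. \<exists>k. \<exists>s\<in>S. \<forall>y. word_form q y x = k * word_form q y s"
    and indep: "\<And>r. \<forall>y. (\<Sum>s\<in>S. r s * word_form q y s) = 0 \<Longrightarrow> \<forall>s\<in>S. r s = 0"
  shows "nichols_has_dim scale c (card S)"
proof (rule nichols_has_dim_word_basis[OF S _ indep])
  fix x
  obtain k s where s: "s \<in> S" "\<And>y. word_form q y x = k * word_form q y s" using spanning by blast
  have "word_form q y x = (\<Sum>s'\<in>S. (if s' = s then k else 0) * word_form q y s')" for y
    using S s by (simp add: if_distrib[of "\<lambda>k. k * _"] cong: if_cong)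
  then show "\<exists>r. \<forall>y. word_form q y x = (\<Sum>s\<in>S. r s * word_form q y s)"
    by (intro exI[of _ "\<lambda>s'. if s' = s then k else 0"] allI)
qed

end

text \<open>The monomials \<open>False\<^sup>a True\<^sup>b\<close> with \<open>a, b < 4\<close> form a basis.\<close>

theorem nichols_has_dim_16:
  assumes W: "braided_words scale c (twisted_matrix \<beta>) W" and \<beta>: "\<beta> * \<beta> = (-1 :: 'k::field_char_0)"
  shows "nichols_has_dim scale c 16"
proof -
  interpret braided_words scale c "twisted_matrix \<beta>" W by (rule W)
  let ?form = "word_form (twisted_matrix \<beta>)"
  define w where "w = (\<lambda>(a :: nat, b). replicate a False @ replicate b True)"
  define S where "S = w ` ({..<4} \<times> {..<4})"
  have "inj w"
  proof (rule injI, clarify)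
    fix a b a' b' assume "w (a, b) = w (a', b')"
    then have "length (filter P (w (a, b))) = length (filter P (w (a', b')))" for P by simp
    from this[of Not] this[of "\<lambda>l. l"] show "a = a' \<and> b = b'" by (simp add: w_def)
  qed
  then have card: "card S = 16" unfolding S_def by (subst card_image[OF inj_on_subset[OF _ subset_UNIV]]) simp_all
  have fin: "finite S" by (simp add: S_def)
  have "nichols_has_dim scale c (card S)"
  proof (rule nichols_has_dim_monomial_basis[OF fin])
    fix x
    obtain k a b where x: "\<And>y. ?form y x = k * ?form y (w (a, b))"
      using plane_sorted[OF \<beta>, of x] unfolding w_def by (metis append_Nil case_prod_conv)
    show "\<exists>k. \<exists>s\<in>S. \<forall>y. ?form y x = k * ?form y s"
    proof (cases "a < 4 \<and> b < 4")
      case True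
      then show ?thesis using x unfolding S_def by blast
    next
      case False
      then have "a \<ge> 4 \<or> b \<ge> 4" by auto
      then have "?form y (w (a, b)) = 0" for y
      proof
        assume "a \<ge> 4"
        then have "w (a, b) = [] @ replicate 4 False @ (replicate (a - 4) False @ replicate b True)"
          by (simp add: w_def replicate_add[symmetric] flip: append_assoc)
        then show ?thesis using plane_power[OF \<beta>] by metis
      next
        assume "b \<ge> 4"
        then have "w (a, b) = replicate a False @ replicate 4 True @ replicate (b - 4) True"
          by (simp add: w_def replicate_add[symmetric])
        then show ?thesis using plane_power[OF \<beta>] by metis
      qed
      then have "\<forall>y. ?form y x = 0 * ?form y (w (0, 0))" using x by simp
      moreover have "w (0, 0) \<in> S" by (auto simp: S_def)
      ultimately show ?thesis by blast
    qed
  next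
    fix r assume r: "\<forall>y. (\<Sum>s\<in>S. r s * ?form y s) = 0"
    show "\<forall>s\<in>S. r s = 0"
    proof
      fix s assume "s \<in> S"
      then obtain a b where ab: "a < 4" "b < 4" "s = w (a, b)" by (auto simp: S_def)
      let ?y = "replicate b True @ replicate a False"
      have *: "?form ?y s' = 0 \<longleftrightarrow> s' \<noteq> s" if "s' \<in> S" for s'
      proof -
        have "s' \<in> range w" using that unfolding S_def by blast
        then obtain z where "s' = w z" by (rule rangeE)
        then obtain a' b' where s': "s' = w (a', b')" by (cases z) blast
        have "?form ?y s' = 0 \<longleftrightarrow> \<not> (a' = a \<and> b' = b)"
          using plane_form_sorted[OF \<beta> ab(2,1), of a' b'] by (simp only: s' w_def case_prod_conv)
        then show ?thesis using injD[OF \<open>inj w\<close>, of "(a', b')" "(a, b)"] ab(3) s' by blast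
      qed
      have "(\<Sum>s'\<in>S - {s}. r s' * ?form ?y s') = 0"
        by (rule sum.neutral) (simp add: *)
      then have "(\<Sum>s'\<in>S. r s' * ?form ?y s') = r s * ?form ?y s"
        using sum.remove[OF fin \<open>s \<in> S\<close>, of "\<lambda>s'. r s' * ?form ?y s'"] by simp
      then have "r s * ?form ?y s = 0" using r by metis
      then show "r s = 0" using * \<open>s \<in> S\<close> by simp
    qed
  qed
  then show ?thesis by (simp add: card)
qed

text \<open>The alternating words of length at most \<open>4\<close>, only one of them of length \<open>4\<close>, form a basis.\<close>

theorem nichols_has_dim_8:
  fixes scale :: "'k::field_char_0 \<Rightarrow> 'v::ab_group_add \<Rightarrow> 'v"
  assumes W: "braided_words scale c (twisted_matrix (-1)) W"
  shows "nichols_has_dim scale c 8"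
proof -
  interpret braided_words scale c "twisted_matrix (-1)" W by (rule W)
  define S where "S = {[], [False], [True], [False, True], [True, False], [False, True, False],
    [True, False, True], [False, True, False, True]}"
  have fin: "finite S" and card: "card S = 8" by (simp_all add: S_def)
  have "nichols_has_dim scale c (card S)"
  proof (rule nichols_has_dim_monomial_basis[OF fin])
    fix x :: "bool list"
    consider "length x \<ge> 5" | "x = []" | a where "x = [a]" | a b where "x = [a, b]"
      | a b d where "x = [a, b, d]" | a b d e where "x = [a, b, d, e]"
    proof -
      have "length x < 5 \<Longrightarrow> x = [] \<or> (\<exists>a. x = [a]) \<or> (\<exists>a b. x = [a, b]) \<or>
          (\<exists>a b d. x = [a, b, d]) \<or> (\<exists>a b d e. x = [a, b, d, e])"
        by (auto simp: less_Suc_eq numeral_eq_Suc length_Suc_conv)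
      then show thesis using that by (meson not_less)
    qed
    then have "x \<in> S \<or> x = [True, False, True, False] \<or> (\<forall>y. A2_form y x = (0 :: 'k))"
    proof cases
      case 1 then show ?thesis using A2_length5 by blast
    next
      case 4 then show ?thesis by (cases a; cases b) (simp_all add: S_def A2_square')
    next
      case 5 then show ?thesis by (cases a; cases b; cases d) (simp_all add: S_def A2_square')
    next
      case 6 then show ?thesis
        by (cases a; cases b; cases d; cases e) (simp_all add: S_def A2_square')
    qed (auto simp: S_def)
    then consider "x \<in> S" | "x = [True, False, True, False]" | "\<And>y. A2_form y x = (0 :: 'k)" by blast
    then show "\<exists>k :: 'k. \<exists>s\<in>S. \<forall>y. A2_form y x = k * A2_form y s"
    proof cases
      case 1
      then show ?thesis by (intro exI[of _ 1] bexI[of _ x]) auto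
    next
      case 2
      then show ?thesis
        by (intro exI[of _ "-1"] bexI[of _ "[False, True, False, True]"])
          (auto simp: S_def A2_alternating' simp del: word_form.simps)
    next
      case 3
      then show ?thesis by (intro exI[of _ 0] bexI[of _ "[]"]) (auto simp: S_def)
    qed
  next
    fix r assume "\<forall>y. (\<Sum>s\<in>S. r s * A2_form y s) = 0"
    then have r: "(\<Sum>s\<in>S. r s * A2_form y s) = 0" for y by simp
    \<comment> \<open>rows of the matrix that already separate the eight words\<close>
    show "\<forall>s\<in>S. r s = 0"
      using r[of "[]"] r[of "[False]"] r[of "[True]"] r[of "[True, False]"] r[of "[False, True]"]
        r[of "[False, True, False]"] r[of "[True, False, True]"] r[of "[True, False, True, False]"]
      by (simp add: S_def)
  qed
  then show ?thesis by (simp add: card)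
qed

lemma braid_at_replicate_fixed:
  assumes "\<And>p r. braid_at c (Suc (length p)) (W (p @ [a, a] @ r)) = W (p @ [a, a] @ r)"
    and "1 \<le> i" "i < n"
  shows "braid_at c i (W (replicate n a)) = W (replicate n a)"
proof -
  have "replicate n a = replicate (i - 1) a @ [a, a] @ replicate (n - i - 1) a"
  proof -
    have "n = (i - 1) + (2 + (n - i - 1))" using assms(2,3) by simp
    then have "replicate n a = replicate (i - 1) a @ replicate 2 a @ replicate (n - i - 1) a"
      by (metis replicate_add)
    then show ?thesis by (simp add: numeral_2_eq_2)
  qed
  then show ?thesis using assms(1)[of "replicate (i - 1) a" "replicate (n - i - 1) a"] assms(2) by simp
qed

lemma braided_words_not_nichols_finite_dim:
  fixes scale :: "'k::field_char_0 \<Rightarrow> 'v::ab_group_add \<Rightarrow> 'v"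
  assumes W: "braided_words scale c q W" and a: "q a a = 1"
  shows "\<not> nichols_finite_dim scale c"
proof -
  interpret braided_words scale c q W by (rule W)
  show ?thesis
  proof (rule not_nichols_finite_dim[where T = "\<lambda>n. W (replicate n a)"])
    show "W (replicate n a) \<noteq> 0" for n
      using independent[of "{replicate n a}" "\<lambda>_. 1"] by auto
    show "braid_at c i (W (replicate n a)) = W (replicate n a)" if "1 \<le> i" "i < n" for n i
      using braid_at_replicate_fixed[OF _ that, of c W a] braid[of _ a a] a by simp
  qed (auto simp: linear homogeneous span intro: tensor.span_base)
qed

section \<open>Pure tensors and their braiding\<close>

lemma pure_tensor_Nil: "pure_tensor scale [] [] = 1"
  by (simp add: pure_tensor_def)

lemma pure_tensor_single: "pure_tensor scale [v] [f] = (if linear_form scale f then f v else 0)"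
  by (simp add: pure_tensor_def)

lemma pure_tensor_Cons:
  "pure_tensor scale (v # vs) (f # fs) = (if linear_form scale f then f v else 0) * pure_tensor scale vs fs"
  using pure_tensor_append[of "[f]" "[v]" scale vs fs] by (simp add: pure_tensor_single)

lemma pure_tensor_length: "length fs \<noteq> length vs \<Longrightarrow> pure_tensor scale vs fs = 0"
  by (auto simp: pure_tensor_def)

context vector_space
begin

interpretation dual: vector_space_pair scale "(*) :: 'a \<Rightarrow> 'a \<Rightarrow> 'a"
  by unfold_locales (auto simp: algebra_simps)

lemma pure_tensor_linear: "Vector_Spaces.linear scale tscale (\<lambda>x. pure_tensor scale (p @ x # r))"
proof -
  have "pure_tensor scale (p @ (x + y) # r) fs = pure_tensor scale (p @ x # r) fs + pure_tensor scale (p @ y # r) fs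
      \<and> pure_tensor scale (p @ scale k x # r) fs = k * pure_tensor scale (p @ x # r) fs" for x y k fs
  proof (cases "length fs = Suc (length p + length r)")
    case True
    define A f C where "A = take (length p) fs" and "f = fs ! length p" and "C = drop (Suc (length p)) fs"
    have fs: "fs = A @ f # C" and A: "length A = length p"
      using True by (simp_all add: A_def f_def C_def id_take_nth_drop)
    have "linear_form scale f \<Longrightarrow> f (x + y) = f x + f y" "linear_form scale f \<Longrightarrow> f (scale k x) = k * f x"
      by (simp_all add: linear_form_def Vector_Spaces.linear_iff)
    note lin = this
    have "pure_tensor scale (p @ z # r) fs =
        pure_tensor scale p A * ((if linear_form scale f then f z else 0) * pure_tensor scale r C)" for z
      by (simp only: fs pure_tensor_append[OF A] pure_tensor_Cons)
    then show ?thesis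
      by (simp add: lin distrib_left distrib_right)
  qed (simp add: pure_tensor_length)
  then show ?thesis
    using vector_space_axioms tensor.vector_space_axioms
    by (auto simp: Vector_Spaces.linear_iff fun_arith tscale_def)
qed

lemma tensor_algebra_basis:
  assumes B: "span B = UNIV"
  shows "tensor_algebra scale = tensor.span (pure_tensor scale ` lists B)" (is "_ = ?R")
proof
  have "pure_tensor scale (p @ vs) \<in> ?R" if "p \<in> lists B" for p vs
    using that
  proof (induct vs arbitrary: p)
    case Nil then show ?case by (auto intro: tensor.span_base)
  next
    case (Cons v vs)
    let ?f = "\<lambda>x. pure_tensor scale (p @ x # vs)"
    have f: "?f (x + y) = ?f x + ?f y" "?f (scale k x) = tscale k (?f x)" for x y k
      using pure_tensor_linear[of p vs] by (simp_all add: Vector_Spaces.linear_iff)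
    have "v \<in> span B" using B by simp
    then show ?case
    proof (induct rule: span_induct_alt)
      case base
      have "?f 0 = 0" using f(2)[of 0 0] by simp
      then show ?case by (simp add: tensor.span_zero)
    next
      case (step k x y)
      have "?f x \<in> ?R" using Cons.hyps[of "p @ [x]"] Cons.prems step by simp
      then show ?case using step by (simp add: f tensor.span_add tensor.span_scale)
    qed
  qed
  from this[of "[]"] have "range (pure_tensor scale) \<subseteq> ?R" by auto
  then show "tensor_algebra scale \<subseteq> ?R"
    unfolding tensor_algebra_def by (rule tensor.span_minimal) (rule tensor.subspace_span)
  show "?R \<subseteq> tensor_algebra scale"
    unfolding tensor_algebra_def by (rule tensor.span_mono) auto
qed

lemma dual_basis:
  assumes "\<not> dependent B"
  obtains f where "\<And>b. linear_form scale (f b)" "\<And>a b. a \<in> B \<Longrightarrow> f b a = (if a = b then 1 else 0)"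
proof -
  have "\<exists>g. linear_form scale g \<and> (\<forall>a\<in>B. g a = (if a = b then 1 else 0))" for b
    using dual.linear_independent_extend[OF assms, of "\<lambda>a. if a = b then 1 else 0"] by (simp add: linear_form_def)
  then obtain f where "\<And>b. linear_form scale (f b) \<and> (\<forall>a\<in>B. f b a = (if a = b then 1 else 0))" by metis
  then show thesis by (intro that[of f]) simp_all
qed

lemma pure_tensor_nonzero:
  assumes "0 \<notin> set vs"
  shows "pure_tensor scale vs \<noteq> 0"
proof -
  have "\<exists>fs. pure_tensor scale vs fs \<noteq> 0"
    using assms
  proof (induct vs)
    case Nil then show ?case by (intro exI[of _ "[]"]) (simp add: pure_tensor_Nil)
  next
    case (Cons v vs)
    then obtain fs where fs: "pure_tensor scale vs fs \<noteq> 0" by auto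
    have "\<not> dependent {v}" using Cons.prems by simp
    then obtain f where "\<And>b. linear_form scale (f b)" "\<And>a b. a \<in> {v} \<Longrightarrow> f b a = (if a = b then 1 else 0)"
      by (rule dual_basis) blast
    then have "pure_tensor scale (v # vs) (f v # fs) \<noteq> 0" using fs by (simp add: pure_tensor_Cons)
    then show ?case by blast
  qed
  then show ?thesis by (auto simp: fun_arith)
qed

end

context yd_module
begin

abbreviation "braiding \<equiv> yd_braiding scale act coact"

lemma braid_at_pure_tensor_pair:
  assumes "braiding (pure_tensor scale [v, w]) = tscale k (pure_tensor scale [v', w'])"
  shows "braid_at braiding (Suc (length us)) (pure_tensor scale (us @ [v, w] @ ws)) =
    tscale k (pure_tensor scale (us @ [v', w'] @ ws))"
proof
  fix fs
  show "braid_at braiding (Suc (length us)) (pure_tensor scale (us @ [v, w] @ ws)) fs =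
    tscale k (pure_tensor scale (us @ [v', w'] @ ws)) fs"
  proof (cases "length fs = length us + 2 + length ws")
    case True
    define A C where "A = take (length us) fs" and "C = drop (length us + 2) fs"
    define f g where "f = fs ! length us" and "g = fs ! Suc (length us)"
    have fs: "fs = A @ [f, g] @ C" and A: "length A = length us" 
      using True by (auto simp: A_def C_def f_def g_def Cons_nth_drop_Suc)
    have split: "pure_tensor scale (us @ [x, y] @ ws) fs =
        pure_tensor scale us A * pure_tensor scale ws C * pure_tensor scale [x, y] [f, g]" for x y
      unfolding fs pure_tensor_append[OF A]
      by (subst pure_tensor_append) (simp_all only: list.size mult_ac)
    have "(\<Sum>b\<in>UNIV. pure_tensor scale [act (hbas b) w, coact v b] [f, g]) = k * pure_tensor scale [v', w'] [f, g]"
      using fun_cong[OF assms, of "[f, g]"] unfolding yd_braiding_pure_tensor sum_fun_apply by (simp add: tscale_def)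
    then show ?thesis
      unfolding braid_at_pure_tensor sum_fun_apply split tscale_def
      by (simp add: sum_distrib_left[symmetric] algebra_simps)
  next
    case False
    then show ?thesis
      unfolding braid_at_pure_tensor sum_fun_apply tscale_def by (simp add: pure_tensor_length)
  qed
qed

end

lemma fixed_square_not_nichols_finite_dim:
  fixes scale :: "'k::field_char_0 \<Rightarrow> 'v::ab_group_add \<Rightarrow> 'v"
  assumes yd: "yd_module scale H act coact" and x: "x \<noteq> 0"
    and c: "yd_braiding scale act coact (pure_tensor scale [x, x]) = pure_tensor scale [x, x]"
  shows "\<not> nichols_finite_dim scale (yd_braiding scale act coact)"
proof -
  interpret yd_module scale H act coact by (rule yd)
  show ?thesis
  proof (rule not_nichols_finite_dim[where T = "\<lambda>n. pure_tensor scale (replicate n x)"])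
    show "pure_tensor scale (replicate n x) \<noteq> 0" for n
      using x by (intro pure_tensor_nonzero) simp
    show "braid_at braiding i (pure_tensor scale (replicate n x)) = pure_tensor scale (replicate n x)"
      if "1 \<le> i" "i < n" for n i
      using braid_at_replicate_fixed[OF _ that, of braiding "pure_tensor scale" x]
        braid_at_pure_tensor_pair[of x x 1 x x] c by simp
    show "pure_tensor scale (replicate n x) \<in> tensor_algebra scale" for n
      unfolding tensor_algebra_def by (auto intro: tensor.span_base)
  qed (simp_all add: tlinear_yd_braiding tcomp_pure_tensor)
qed

section \<open>Words with letters exchanged at every second position\<close>

text \<open>
  If \<open>c (a \<otimes> b)\<close> is a multiple of \<open>b' \<otimes> a'\<close>, where \<open>'\<close> exchanges \<open>v\<close> and \<open>w\<close>, then every step of a letter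
  to a neighbouring position exchanges it.  Reading the letters with the parity of their position
  removes this exchange: at position \<open>n\<close>, counted from \<open>0\<close>, the letter \<open>True\<close> stands for \<open>w\<close> if \<open>n\<close> is
  even and for \<open>v\<close> if \<open>n\<close> is odd.
\<close>

primrec twisted_word :: "'b \<Rightarrow> 'b \<Rightarrow> nat \<Rightarrow> bool list \<Rightarrow> 'b list" where
  "twisted_word v w n [] = []"
| "twisted_word v w n (a # x) = (if a = even n then w else v) # twisted_word v w (Suc n) x"

text \<open>
  After that, the coefficients of \<open>c\<^sub>i\<close> at \<open>True False\<close> and \<open>False True\<close> still depend on the parity of
  the position.  Moving \<open>True\<close> from position \<open>n\<close> to \<open>n + 1\<close> adds \<open>n\<close> to \<open>n (n - 1) / 2\<close>, so that the
  following sign changes by \<open>(-1)\<^sup>n\<close>, which compensates for it.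
\<close>

primrec twist_sign :: "nat \<Rightarrow> bool list \<Rightarrow> 'k::field" where
  "twist_sign n [] = 1"
| "twist_sign n (a # x) = (if a then (-1) ^ (n * (n - 1) div 2) else 1) * twist_sign (Suc n) x"

lemma length_twisted_word [simp]: "length (twisted_word v w n x) = length x"
  by (induct x arbitrary: n) simp_all

lemma twisted_word_append:
  "twisted_word v w n (p @ x) = twisted_word v w n p @ twisted_word v w (n + length p) x"
  by (induct p arbitrary: n) simp_all

lemma twist_sign_append: "twist_sign n (p @ x) = twist_sign n p * twist_sign (n + length p) x"
  by (induct p arbitrary: n) simp_all

lemma twist_sign_nonzero: "twist_sign n x \<noteq> 0"
  by (induct x arbitrary: n) simp_all

lemma twist_sign_swap:
  "twist_sign n [True, False] = (-1) ^ n * (twist_sign n [False, True] :: 'k::field)"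
proof -
  have "Suc n * n div 2 = n * (n - 1) div 2 + n"
  proof (cases n)
    case (Suc m)
    have "Suc n * n = n * (n - 1) + n * 2" by (simp add: Suc)
    then show ?thesis by simp
  qed simp
  then have "twist_sign n [False, True] = (-1) ^ (n * (n - 1) div 2) * (-1 :: 'k) ^ n"
    by (simp only: twist_sign.simps if_True if_False diff_Suc_1 mult_1_left mult_1_right power_add)
  moreover have "(-1) ^ n * ((-1) ^ (n * (n - 1) div 2) * (-1) ^ n) = ((-1) ^ (n * (n - 1) div 2) :: 'k)"
    by (simp add: mult.left_commute[of "(-1) ^ n"] flip: power_mult_distrib)
  ultimately show ?thesis by simp
qed

lemma (in vector_space) surj_twisted_word:
  "xs \<in> lists {v, w} \<Longrightarrow> \<exists>x. xs = twisted_word v w n x"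
proof (induct xs arbitrary: n)
  case Nil
  have "[] = twisted_word v w n []" by simp
  then show ?case by blast
next
  case (Cons a xs)
  then obtain x where x: "xs = twisted_word v w (Suc n) x" by auto
  from Cons.prems have "a = w \<or> a = v" by auto
  then have "a # xs = twisted_word v w n ((if a = w then even n else odd n) # x)" using x by auto
  then show ?case by blast
qed

context yd_module
begin

lemma twisted_braided_words:
  assumes basis: "v \<noteq> w" "\<not> dependent {v, w}" "span {v, w} = UNIV"
    and c: "braiding (pure_tensor scale [v, v]) = tscale \<beta> (pure_tensor scale [w, w])"
      "braiding (pure_tensor scale [v, w]) = tscale \<beta> (pure_tensor scale [v, w])"
      "braiding (pure_tensor scale [w, v]) = tscale \<beta> (pure_tensor scale [w, v])"
      "braiding (pure_tensor scale [w, w]) = tscale (- \<beta>) (pure_tensor scale [v, v])"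
  shows "braided_words scale braiding (twisted_matrix \<beta>)
    (\<lambda>x. tscale (twist_sign 0 x) (pure_tensor scale (twisted_word v w 0 x)))"
proof (rule braided_words.intro)
  let ?W = "\<lambda>x. tscale (twist_sign 0 x) (pure_tensor scale (twisted_word v w 0 x))"
  show "tlinear braiding" by (rule tlinear_yd_braiding)
next
  let ?W = "\<lambda>x. tscale (twist_sign 0 x) (pure_tensor scale (twisted_word v w 0 x))"
  fix p r :: "bool list" and a b
  let ?n = "length p"
  let ?l = "\<lambda>m a. if a = even m then w else v"
  have "braiding (pure_tensor scale [?l ?n a, ?l (Suc ?n) b]) =
      tscale (if a = even ?n \<and> b = odd ?n then - \<beta> else \<beta>) (pure_tensor scale [?l ?n b, ?l (Suc ?n) a])"
    using c by (cases a; cases b; cases "even ?n") simp_all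
  note pair = braid_at_pure_tensor_pair[OF this, of "twisted_word v w 0 p" "twisted_word v w (Suc (Suc ?n)) r"]
  have sign: "(if a = even ?n \<and> b = odd ?n then - \<beta> else \<beta>) * twist_sign ?n [a, b] =
      twisted_matrix \<beta> a b * twist_sign ?n [b, a]"
  proof (cases "a = b")
    case False
    then have b: "b = (\<not> a)" by auto
    show ?thesis unfolding b
      by (cases a; cases "even ?n") (simp_all add: twist_sign_swap del: twist_sign.simps)
  qed auto
  have W: "?W (p @ [a, b] @ r) = tscale (twist_sign 0 p * twist_sign (Suc (Suc ?n)) r * twist_sign ?n [a, b])
      (pure_tensor scale (twisted_word v w 0 p @ [?l ?n a, ?l (Suc ?n) b] @ twisted_word v w (Suc (Suc ?n)) r))" for a b
    unfolding twisted_word_append twist_sign_append by (simp add: mult_ac del: twist_sign.simps)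
  show "braid_at braiding (Suc ?n) (?W (p @ [a, b] @ r)) = tscale (twisted_matrix \<beta> a b) (?W (p @ [b, a] @ r))"
    unfolding W tlinear_scale[OF tlinear_braid_at[OF tlinear_yd_braiding]]
    using pair sign by (simp add: mult_ac del: twist_sign.simps)
next
  fix n x
  show "tcomp n (tscale (twist_sign 0 x) (pure_tensor scale (twisted_word v w 0 x))) =
      (if length x = n then tscale (twist_sign 0 x) (pure_tensor scale (twisted_word v w 0 x)) else 0)"
    by (simp add: tlinear_scale[OF tlinear_tcomp] tcomp_pure_tensor)
next
  let ?W = "\<lambda>x. tscale (twist_sign 0 x) (pure_tensor scale (twisted_word v w 0 x))"
  show "tensor_algebra scale = tensor.span (range ?W)"
  proof
    have "pure_tensor scale xs \<in> tensor.span (range ?W)" if xs: "xs \<in> lists {v, w}" for xs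
    proof -
      obtain x where x: "xs = twisted_word v w 0 x" using surj_twisted_word[OF xs] by blast
      have "tscale (inverse (twist_sign 0 x)) (?W x) \<in> tensor.span (range ?W)"
        by (intro tensor.span_scale tensor.span_base) auto
      then show ?thesis by (simp add: x twist_sign_nonzero)
    qed
    then show "tensor_algebra scale \<subseteq> tensor.span (range ?W)"
      unfolding tensor_algebra_basis[OF basis(3)]
      by (intro tensor.span_minimal tensor.subspace_span) auto
    show "tensor.span (range ?W) \<subseteq> tensor_algebra scale"
      unfolding tensor_algebra_def
      by (intro tensor.span_minimal tensor.subspace_span) (auto intro: tensor.span_scale tensor.span_base)
  qed
next
  fix X :: "bool list set" and k x
  assume X: "finite X" "x \<in> X"
    and eq: "(\<Sum>x\<in>X. tscale (k x) (tscale (twist_sign 0 x) (pure_tensor scale (twisted_word v w 0 x)))) = 0"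
  obtain f where f: "\<And>b. linear_form scale (f b)" "\<And>a b. a \<in> {v, w} \<Longrightarrow> f b a = (if a = b then 1 else 0)"
    using dual_basis[OF basis(2)] by blast
  have eval: "pure_tensor scale (twisted_word v w n z) (map f (twisted_word v w n x)) = (if z = x then 1 else 0)"
    for n z x
  proof (induct x arbitrary: n z)
    case Nil then show ?case by (cases z) (simp_all add: pure_tensor_Nil pure_tensor_length)
  next
    case (Cons a x)
    then show ?case using basis(1)
      by (cases z) (auto simp: pure_tensor_Cons pure_tensor_length f)
  qed
  have "0 = (\<Sum>z\<in>X. k z * (twist_sign 0 z * (if z = x then 1 else 0)))"
    using fun_cong[OF eq, of "map f (twisted_word v w 0 x)"]
    by (simp add: sum_fun_apply zero_fun_apply tscale_def eval)
  also have "\<dots> = k x * twist_sign 0 x"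
    using X by (simp add: if_distrib[of "\<lambda>k. _ * k"] cong: if_cong)
  finally show "k x = 0" by (simp add: twist_sign_nonzero)
qed

end

section \<open>Calculations in the group\<close>

lemma gel_eq_iff: "gel i j = gel k l \<longleftrightarrow> i mod 4 = k mod 4 \<and> j mod 2 = l mod 2"
  by (metis ex_gel ey_gel gel_def)

lemma grp_cases:
  obtains i j where "g = gel i j" "i \<in> {0, 1, 2, 3}" "j \<in> {0, 1}"
proof -
  have "ex g \<in> {0, 1, 2, 3}" "ey g \<in> {0, 1}" using ex_less[of g] ey_less[of g] by auto
  then show thesis using that[of "ex g" "ey g"] by (simp add: gel_ex_ey)
qed

lemma gmul_gel: "gmul (gel i j) (gel k l) = gel (i + k) (j + l)"
  by (simp only: gmul_def ex_gel ey_gel gel_eq_iff mod_add_eq simp_thms)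

lemma gact_gel: "gact (gel i j) = gel i (i + j)"
proof -
  have "i mod 4 mod 2 = i mod 2" by (simp add: mod_mod_cancel)
  then have "(i mod 4 + j mod 2) mod 2 = (i + j) mod 2" by (rule mod_add_cong) simp
  then show ?thesis by (simp only: gact_def ex_gel ey_gel gel_eq_iff mod_mod_trivial simp_thms)
qed

lemma tau_gel: "tau (gel i j) (gel k l) = ((-1) ^ (j * k) :: 'k::field)"
proof -
  have "even (j mod 2 * (k mod 4)) \<longleftrightarrow> even (j * k)"
    by (simp add: even_even_mod_4_iff[of k])
  then show ?thesis by (simp add: tau_def minus_one_power_iff)
qed

lemma gone_gmul [simp]: "gmul gone g = g" "gmul g gone = g"
  by (rule grp_eqI; simp add: gmul_def gone_def ex_less ey_less)+

lemma tau_gone [simp]: "tau gone g = 1" "tau g gone = 1"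
  by (simp_all add: tau_def gone_def)

lemma gact_gone [simp]: "gact gone = gone"
  by (simp add: gone_def gact_gel)

text \<open>
  The degrees in the Yetter-Drinfel'd condition: \<open>a q a\<inverse> = q\<close>, but \<open>a q (a \<triangleleft> t)\<inverse>\<close> is \<open>q\<close> times the
  power of \<open>y\<close> with exponent \<open>ex a\<close>, an element of order at most \<open>2\<close>.
\<close>

lemma gmul_gmul_ginv: "gmul (gmul a q) (ginv a) = q"
  and gmul_gmul_ginv_gact: "gmul (gmul (gmul a q) (ginv (gact a))) (gel 0 (ex a)) = q"
  and ginv_ginv: "ginv (ginv a) = a"
  and gact_ginv: "gact (ginv a) = ginv (gact a)"
  by (rule grp_cases[of a]; rule grp_cases[of q]; auto simp: gmul_def ginv_def gact_def gel_eq_iff)+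

text \<open>
  The values of \<open>\<sigma>\<close> and \<open>\<tau>\<close> that occur in \<open>h\<^sub>1 v\<^sub>-\<^sub>1 S(h\<^sub>3) \<otimes> h\<^sub>2 \<cdot> v\<^sub>0\<close> for \<open>h = e\<^sub>g t\<close>, with \<open>v\<^sub>-\<^sub>1\<close> in \<open>k\<^sup>G\<close> in
  the first case and in \<open>k\<^sup>G t\<close> in the second.
\<close>

lemma adjoint_sign_P:
  "tau (gmul a q) (ginv a) * tau a q * (sig a * (inverse (sig (ginv (ginv a))) * inverse (tau (ginv (ginv a)) (ginv a))))
     = ((-1) ^ (ey a * ex q + ey q * ex a) :: 'k::field)"
  by (rule grp_cases[of a]; rule grp_cases[of q])
    (auto simp: tau_def sig_def gmul_def ginv_def gact_def)

lemma adjoint_sign_U: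
  "tau (gmul a q) (ginv (gact a)) * tau a q * (sig a * (inverse (sig (ginv (ginv (gact a)))) * inverse (tau (ginv (ginv (gact a))) (ginv (gact a)))))
     = ((-1) ^ (ey a * ex q + ey q * ex a + ex a) :: 'k::field)"
  by (rule grp_cases[of a]; rule grp_cases[of q])
    (auto simp: tau_def sig_def gmul_def ginv_def gact_def)

section \<open>Action and coaction of basis elements\<close>

lemma sum_UNIV_grp_bool:
  "(\<Sum>a\<in>UNIV. f a) = (\<Sum>g\<in>(UNIV :: grp set). f (g, False) + f (g, True) :: 'c::comm_monoid_add)"
proof -
  have "(\<Sum>a\<in>UNIV. f a) = (\<Sum>g\<in>UNIV. \<Sum>b\<in>UNIV. f (g, b))"
    by (simp add: sum.cartesian_product)
  then show ?thesis by (simp add: UNIV_bool)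
qed

lemma sum4_single:
  fixes F :: "'a::finite \<Rightarrow> 'a \<Rightarrow> 'a \<Rightarrow> 'a \<Rightarrow> 'c::comm_monoid_add"
  assumes "\<And>p q r b. F p q r b \<noteq> 0 \<Longrightarrow> p = p0 \<and> q = q0 \<and> r = r0 \<and> b = b0"
  shows "(\<Sum>p\<in>UNIV. \<Sum>q\<in>UNIV. \<Sum>r\<in>UNIV. \<Sum>b\<in>UNIV. F p q r b) = F p0 q0 r0 b0"
proof -
  have "F p q r b = (if b = b0 then if r = r0 then if q = q0 then
      if p = p0 then F p0 q0 r0 b0 else 0 else 0 else 0 else 0)" for p q r b
    using assms[of p q r b] by (cases "F p q r b = 0") auto
  then have "(\<Sum>p\<in>UNIV. \<Sum>q\<in>UNIV. \<Sum>r\<in>UNIV. \<Sum>b\<in>UNIV. F p q r b) =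
      (\<Sum>p\<in>UNIV. \<Sum>q\<in>UNIV. \<Sum>r\<in>UNIV. \<Sum>b\<in>UNIV. if b = b0 then if r = r0 then if q = q0 then
        if p = p0 then F p0 q0 r0 b0 else 0 else 0 else 0 else 0)"
    by (intro sum.cong refl)
  then show ?thesis by simp
qed

lemma bas_mult_eq: "bas_mult (g, x) (h, y) = (\<lambda>c. (if g = (if x then gact h else h) then if x \<and> y then sig g else 1 else 0)
    * hbas (g, x \<noteq> y) c)"
  by (cases x; cases y) (auto simp: zero_fun_def)

lemma bas_antipode_eq: "bas_antipode (g, x) = (\<lambda>c. (if x then inverse (sig (ginv g)) * inverse (tau (ginv g) g) else 1)
    * hbas (ginv (if x then gact g else g), x) c)"
  by (cases x) auto

lemma hmult_hbas_scaled:
  "hmult Hcs (\<lambda>c. k * hbas a c) (\<lambda>c. l * hbas b c) d = k * l * bas_mult a b d"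
proof -
  have "hmult Hcs (\<lambda>c. k * hbas a c) (\<lambda>c. l * hbas b c) d =
      (\<Sum>a'\<in>UNIV. hbas a a' * (\<Sum>b'\<in>UNIV. hbas b b' * (k * l * bas_mult a' b' d)))"
    by (simp add: Hcs_def sum_distrib_left mult_ac)
  then show ?thesis by (simp add: sum_hbas)
qed

lemma Hcs_hcomult2:
  "hcomult2 Hcs (hbas (g, x)) ((p, a), (q, b), (r, d)) =
    (if gmul (gmul p q) r = g \<and> a = x \<and> b = x \<and> d = x then if x then tau (gmul p q) r * tau p q else 1 else 0)"
proof -
  have "hcomult2 Hcs (hbas (g, x)) ((p, a), (q, b), (r, d)) =
      (\<Sum>s\<in>UNIV. bas_comult (g, x) (s, (r, d)) * bas_comult s ((p, a), (q, b)))"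
    by (simp add: hcomult2_def Hcs_def sum_hbas)
  also have "\<dots> = (\<Sum>s\<in>UNIV. if s = (gmul p q, x) then
      if gmul (gmul p q) r = g \<and> a = x \<and> b = x \<and> d = x then if x then tau (gmul p q) r * tau p q else 1 else 0 else 0)"
    by (intro sum.cong refl) (auto split: if_splits)
  finally show ?thesis by simp
qed

lemma Hcs_adjoint:
  "hmult Hcs (hmult Hcs (hbas (p, x)) (hbas (b, y))) (hantipode Hcs (hbas (r, x))) d =
    (if p = (if x then gact b else b) \<and> p = ginv (if y then gact r else r) \<and> d = (p, y)
     then if x then sig p * (inverse (sig (ginv r)) * inverse (tau (ginv r) r)) else 1 else 0)"
proof -
  have S: "hantipode Hcs (hbas (r, x)) = bas_antipode (r, x)"
    by (rule ext) (simp add: Hcs_def sum_hbas)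
  have "hmult Hcs (hmult Hcs (hbas (p, x)) (hbas (b, y))) (hantipode Hcs (hbas (r, x))) d =
      (if p = (if x then gact b else b) then if x \<and> y then sig p else 1 else 0) *
      (if x then inverse (sig (ginv r)) * inverse (tau (ginv r) r) else 1) *
      bas_mult (p, x \<noteq> y) (ginv (if x then gact r else r), x) d"
    unfolding S hmult_hbas bas_mult_eq[of p x b y] bas_antipode_eq hmult_hbas_scaled ..
  then show ?thesis
    by (cases x; cases y) (auto simp: bas_mult_eq hbas_def gact_ginv)
qed

text \<open>
  \<open>E g\<close> is the projection to the part of degree \<open>g\<close>, and \<open>P a\<close>, \<open>U a\<close> are the components of the
  coaction along \<open>e\<^sub>a\<close> and \<open>e\<^sub>a t\<close>.
\<close>

locale hcs_yd_module = yd_module scale Hcs act coact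
  for scale :: "'k::{alg_closed_field, field_char_0} \<Rightarrow> 'v::ab_group_add \<Rightarrow> 'v"
    and act :: "(grp \<times> bool \<Rightarrow> 'k) \<Rightarrow> 'v \<Rightarrow> 'v"
    and coact :: "'v \<Rightarrow> grp \<times> bool \<Rightarrow> 'v"
begin

abbreviation "E g \<equiv> act (hbas (g, False))"
abbreviation "t \<equiv> act tH"
abbreviation "P a v \<equiv> coact v (a, False)"
abbreviation "U a v \<equiv> coact v (a, True)"

lemma act_plus: "act h (x + y) = act h x + act h y"
  and act_smult: "act h (scale k x) = scale k (act h x)"
  and act_0: "act h 0 = 0"
  and act_minus: "act h (- x) = - act h x"
  and act_diff: "act h (x - y) = act h x - act h y"
  using act_linear[of h, unfolded linear_iff_module_hom]
  by (simp_all add: module_hom.add module_hom.scale module_hom.zero module_hom.neg module_hom.diff)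

lemma coact_plus: "coact (x + y) b = coact x b + coact y b"
  and coact_smult: "coact (scale k x) b = scale k (coact x b)"
  and coact_0: "coact 0 b = 0"
  and coact_minus: "coact (- x) b = - coact x b"
  and coact_diff: "coact (x - y) b = coact x b - coact y b"
  using coact_linear[of b, unfolded linear_iff_module_hom]
  by (simp_all add: module_hom.add[where f = "\<lambda>v. coact v b"] module_hom.scale[where f = "\<lambda>v. coact v b"]
      module_hom.zero[where f = "\<lambda>v. coact v b"] module_hom.neg[where f = "\<lambda>v. coact v b"]
      module_hom.diff[where f = "\<lambda>v. coact v b"])

lemmas lin = act_plus act_smult act_0 act_minus act_diff coact_plus coact_smult coact_0 coact_minus coact_diff

lemma coact_sum: "coact (\<Sum>i\<in>I. f i) b = (\<Sum>i\<in>I. coact (f i) b)"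
  by (induct I rule: infinite_finite_induct) (simp_all add: lin)

lemma act_zero: "act (\<lambda>b. 0) v = 0"
  using act_scale[of 0 "\<lambda>b. 0" v] by simp

lemma act_sum: "act (\<lambda>b. \<Sum>i\<in>I. h i b) v = (\<Sum>i\<in>I. act (h i) v)"
  by (induct I rule: infinite_finite_induct) (simp_all add: act_zero act_add)

lemma act_expand: "act h v = (\<Sum>a\<in>UNIV. scale (h a) (act (hbas a) v))"
proof -
  have "h = (\<lambda>b. \<Sum>a\<in>UNIV. h a * hbas a b)"
    by (rule ext) (simp add: hbas_def if_distrib[of "\<lambda>k. _ * k"] cong: if_cong)
  then have "act h v = act (\<lambda>b. \<Sum>a\<in>UNIV. h a * hbas a b) v" by simp
  then show ?thesis by (simp only: act_sum act_scale)
qed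

lemma act_hbas_True: "act (hbas (g, True)) v = E g (t v)"
  by (simp flip: act_mult Hcs_e_t)

lemma E_E: "E g (E h v) = (if g = h then E g v else 0)"
  using act_zero[of v] by (simp add: Hcs_e_e zero_fun_def flip: act_mult)

lemma t_E: "t (E g v) = E (gact g) (t v)"
  by (simp add: Hcs_t_e act_hbas_True flip: act_mult)

lemma sum_E: "(\<Sum>g\<in>UNIV. E g v) = v"
proof -
  have one: "hone Hcs = (\<lambda>c. \<Sum>h\<in>UNIV. hbas (h, False) c :: 'k)" by (auto simp: fun_eq_iff Hcs_one)
  show ?thesis using act_one[of v] unfolding one act_sum .
qed

lemma E_orthogonal: "E g v = v \<Longrightarrow> h \<noteq> g \<Longrightarrow> E h v = 0"
  using E_E[of h g v] by simp

lemma t_t: "E g v = v \<Longrightarrow> t (t v) = scale (sig g) v"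
proof -
  assume v: "E g v = v"
  have tt: "hmult Hcs tH tH = (\<lambda>c. \<Sum>h\<in>UNIV. sig h * hbas (h, False) c :: 'k)"
    by (auto simp: fun_eq_iff Hcs_t_t)
  have "t (t v) = (\<Sum>h\<in>UNIV. scale (sig h) (E h v))"
    unfolding act_mult[symmetric] tt act_sum act_scale ..
  also have "\<dots> = (\<Sum>h\<in>UNIV. if h = g then scale (sig h) v else 0)"
    using v by (intro sum.cong) (auto simp: E_orthogonal)
  finally show ?thesis by simp
qed

lemma t_homogeneous: "E g v = v \<Longrightarrow> E (gact g) (t v) = t v"
  using t_E[of g v] by simp

lemma coassoc: "coact (coact v p) q = (\<Sum>b\<in>UNIV. scale (bas_comult b (p, q)) (coact v b))"
  by (simp add: coact_coassoc Hcs_def sum_hbas)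

text \<open>
  The maps \<open>P a\<close> represent the group \<open>G\<close>, and the maps \<open>U a\<close> its group algebra twisted by \<open>\<tau>\<close>.
\<close>

lemma P_P: "P b (P a v) = P (gmul a b) v"
  and U_U: "U b (U a v) = scale (tau a b) (U (gmul a b) v)"
  and U_P: "U b (P a v) = 0"
  by (simp_all add: coassoc sum_UNIV_grp_bool if_distrib[of "\<lambda>k. scale k _"] cong: if_cong)

lemma counit: "P gone v + U gone v = v"
proof -
  have "hcounit Hcs (hbas b) = (bas_counit b :: 'k)" for b by (simp add: Hcs_def sum_hbas)
  then show ?thesis using coact_counit[of v]
    by (simp add: sum_UNIV_grp_bool if_distrib[of "\<lambda>k. scale k _"] sum.distrib cong: if_cong)
qed

text \<open>
  For a basis element acting and a component of the coaction, the Yetter-Drinfel'd condition has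
  only one nonzero summand.
\<close>

lemma coact_act_basis:
  fixes g x a y v
  defines "q \<equiv> if y then gmul g (gel 0 (ex a)) else g"
  shows "coact (act (hbas (g, x)) v) (a, y) =
    scale (if x then (-1) ^ (ey a * ex q + ey q * ex a + (if y then ex a else 0)) else 1)
      (act (hbas (q, x)) (coact v (if x then gact a else a, y)))"
proof -
  let ?b = "if x then gact a else a" and ?r = "ginv (if y then gact a else a)"
  let ?F = "\<lambda>p q r b. scale (hcomult2 Hcs (hbas (g, x)) (p, q, r)
      * hmult Hcs (hmult Hcs (hbas p) (hbas b)) (hantipode Hcs (hbas r)) (a, y)) (act (hbas q) (coact v b))"
  have q: "gmul (gmul a q) ?r = g"
    by (rule grp_cases[of a]; rule grp_cases[of g]) (auto simp: q_def gmul_def ginv_def gact_def gel_eq_iff)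
  have "coact (act (hbas (g, x)) v) (a, y) = ?F (a, x) (q, x) (?r, x) (?b, y)"
    unfolding yetter_drinfeld
  proof (rule sum4_single)
    fix p' q' r' b' :: "grp \<times> bool"
    assume "?F p' q' r' b' \<noteq> 0"
    then have nz: "hcomult2 Hcs (hbas (g, x)) (p', q', r') \<noteq> (0 :: 'k)"
      "hmult Hcs (hmult Hcs (hbas p') (hbas b')) (hantipode Hcs (hbas r')) (a, y) \<noteq> (0 :: 'k)"
      by auto
    obtain p1 q1 r1 b1 b2 where eqs: "p' = (p1, x)" "q' = (q1, x)" "r' = (r1, x)" "b' = (b1, b2)"
        and g: "gmul (gmul p1 q1) r1 = g"
      using nz(1) by (cases p'; cases q'; cases r'; cases b') (auto simp: Hcs_hcomult2 split: if_splits)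
    have p1: "p1 = (if x then gact b1 else b1)" "p1 = ginv (if y then gact r1 else r1)" "a = p1" "b2 = y"
      using nz(2) by (auto simp: eqs Hcs_adjoint split: if_splits)
    have "ginv a = (if y then gact r1 else r1)"
      unfolding p1(3) by (subst p1(2)) (rule ginv_ginv)
    then have r1: "r1 = ?r" by (cases y) (simp_all flip: gact_ginv)
    moreover have "b1 = ?b" using p1(1,3) by simp
    moreover have "q1 = q" using g r1 p1(3) gmul_gmul_ginv[of a q1] gmul_gmul_ginv_gact[of a q1] by (auto simp: q_def)
    ultimately show "p' = (a, x) \<and> q' = (q, x) \<and> r' = (?r, x) \<and> b' = (?b, y)" using p1(3,4) by (simp only: eqs simp_thms)
  qed
  also have "hcomult2 Hcs (hbas (g, x)) ((a, x), (q, x), (?r, x))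
      * hmult Hcs (hmult Hcs (hbas (a, x)) (hbas (?b, y))) (hantipode Hcs (hbas (?r, x))) (a, y) =
      (if x then (-1) ^ (ey a * ex q + ey q * ex a + (if y then ex a else 0)) else (1 :: 'k))"
    using q adjoint_sign_P[of a q, where 'k = 'k] adjoint_sign_U[of a q, where 'k = 'k]
    by (cases x; cases y) (simp_all add: Hcs_hcomult2 Hcs_adjoint ginv_ginv flip: gact_ginv)
  finally show ?thesis .
qed

lemma P_homogeneous: "E g v = v \<Longrightarrow> E g (P a v) = P a v"
  using coact_act_basis[of g False v a False] by simp

lemma U_homogeneous: "E g v = v \<Longrightarrow> E (gmul g (gel 0 (ex a))) (U a v) = U a v"
  using coact_act_basis[of g False v a True] by simp

text \<open>
  On homogeneous vectors the last lemma becomes a commutation rule with \<open>t\<close>; the degree that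
  determines the sign is that of the result.
\<close>

lemma P_t:
  assumes v: "E g v = v"
  shows "P a (t v) = scale ((-1) ^ (ey a * ex g + ey (gact g) * ex a)) (t (P (gact a) v))"
proof -
  have [simp]: "ex (gact g) = ex g" by (simp add: gact_def ex_less)
  have "P a (t v) = P a (act (hbas (gact g, True)) v)" using t_homogeneous[OF v] by (simp add: act_hbas_True)
  also have "\<dots> = scale ((-1) ^ (ey a * ex g + ey (gact g) * ex a)) (E (gact g) (t (P (gact a) v)))"
    unfolding coact_act_basis by (simp add: act_hbas_True)
  finally show ?thesis using t_homogeneous[OF P_homogeneous[OF v]] by simp
qed

lemma U_t:
  fixes a
  assumes v: "E g v = v"
  defines "q \<equiv> gmul (gact g) (gel 0 (ex a))"
  shows "U a (t v) = scale ((-1) ^ (ey a * ex q + ey q * ex a + ex a)) (t (U (gact a) v))"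
proof -
  have q: "gact (gmul g (gel 0 (ex (gact a)))) = q"
    unfolding q_def by (rule grp_cases[of a]; rule grp_cases[of g]) (auto simp: gmul_def gact_def gel_eq_iff)
  have "U a (t v) = U a (act (hbas (gact g, True)) v)" using t_homogeneous[OF v] by (simp add: act_hbas_True)
  also have "\<dots> = scale ((-1) ^ (ey a * ex q + ey q * ex a + ex a)) (E q (t (U (gact a) v)))"
    unfolding coact_act_basis q_def by (simp add: act_hbas_True)
  finally show ?thesis using t_homogeneous[OF U_homogeneous[OF v, of "gact a"]] by (simp add: q)
qed

lemma eigenvector:
  assumes Z: "subspace Z" "v \<in> Z" "v \<noteq> 0"
    and A: "\<And>x y. A (x - y) = A x - A y" "\<And>k x. A (scale k x) = scale k (A x)"
    and inv: "\<And>z. z \<in> Z \<Longrightarrow> A z \<in> Z" and sq: "\<And>z. z \<in> Z \<Longrightarrow> A (A z) = scale \<mu> z"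
  obtains w e where "w \<in> Z" "w \<noteq> 0" "A w = scale e w" "e * e = \<mu>"
proof -
  obtain s where s: "s * s = \<mu>"
    using nth_root_exists[of 2 \<mu>] by (auto simp: power2_eq_square)
  show thesis
  proof (cases "A v = scale s v")
    case True
    then show thesis using that[of v s] Z s by blast
  next
    case False
    have "A (A v - scale s v) = scale (- s) (A v - scale s v)"
      using sq[OF Z(2)] by (simp add: A s scale_right_diff_distrib)
    moreover have "A v - scale s v \<in> Z"
      using Z inv by (intro subspace_diff subspace_scale) auto
    ultimately show thesis using that[of "A v - scale s v" "- s"] False s by simp
  qed
qed

lemma subspace_homogeneous: "subspace {v. E g v = v}"
  by (rule subspaceI) (simp_all add: lin)

lemma subspace_coact_eigen: "subspace Z \<Longrightarrow> subspace {v \<in> Z. coact v a = scale e v}"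
  by (rule subspaceI) (auto simp: lin scale_right_distrib scale_left_commute subspace_0 subspace_add subspace_scale)

lemma independent_pairI:
  assumes "\<And>a b. scale a v + scale b w = 0 \<Longrightarrow> a = 0 \<and> b = 0"
  shows "v \<noteq> w" "\<not> dependent {v, w}"
proof -
  show ne: "v \<noteq> w" using assms[of 1 "-1"] by auto
  have "w \<noteq> 0" using assms[of 0 1] by auto
  moreover have "v \<notin> span {w}"
  proof
    assume "v \<in> span {w}"
    then obtain k where "v = scale k w" by (auto simp: span_singleton)
    then show False using assms[of 1 "- k"] by simp
  qed
  ultimately show "\<not> dependent {v, w}" by (simp add: independent_insert)
qed

lemma independent_homogeneous:
  assumes "E g v = v" "E h w = w" "g \<noteq> h" "v \<noteq> 0" "w \<noteq> 0"
  shows "v \<noteq> w" "\<not> dependent {v, w}"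
proof -
  have "a = 0 \<and> b = 0" if "scale a v + scale b w = 0" for a b
  proof -
    have "E g (scale a v + scale b w) = 0" "E h (scale a v + scale b w) = 0" using that by (simp_all add: lin)
    then show ?thesis using assms E_orthogonal[of g v h] E_orthogonal[of h w g] by (simp add: lin)
  qed
  then show "v \<noteq> w" "\<not> dependent {v, w}" by (rule independent_pairI; blast)+
qed

lemma pure_tensor_scale:
  "pure_tensor scale [scale k v, w] = tscale k (pure_tensor scale [v, w])"
  "pure_tensor scale [v, scale k w] = tscale k (pure_tensor scale [v, w])"
  using pure_tensor_linear[of "[]" "[w]"] pure_tensor_linear[of "[v]" "[]"]
  by (simp_all add: Vector_Spaces.linear_iff)

lemma pure_tensor_minus:
  "pure_tensor scale [- v, w] = - pure_tensor scale [v, w]"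
  "pure_tensor scale [v, - w] = - pure_tensor scale [v, w]"
  using pure_tensor_scale(1)[of "-1" v w] pure_tensor_scale(2)[of v "-1" w] by simp_all

lemma pure_tensor_zero: "pure_tensor scale [0, w] = 0" "pure_tensor scale [v, 0] = 0"
  using pure_tensor_scale(1)[of 0 0 w] pure_tensor_scale(2)[of v 0 0] by simp_all

text \<open>
  Only the summand of the braiding at the degree of \<open>w\<close>, respectively \<open>t w\<close>, survives.
\<close>

lemma braiding_P:
  assumes "\<And>a v. U a v = 0" and w: "E h w = w"
  shows "braiding (pure_tensor scale [v, w]) = pure_tensor scale [w, P h v]"
proof -
  have "braiding (pure_tensor scale [v, w]) = (\<Sum>g\<in>UNIV. if g = h then pure_tensor scale [w, P h v] else 0)"
    unfolding yd_braiding_pure_tensor sum_UNIV_grp_bool using assms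
    by (intro sum.cong refl) (auto simp: pure_tensor_zero E_orthogonal)
  then show ?thesis by simp
qed

lemma braiding_U:
  assumes "\<And>a v. P a v = 0" and w: "E h (t w) = t w"
  shows "braiding (pure_tensor scale [v, w]) = pure_tensor scale [t w, U h v]"
proof -
  have "braiding (pure_tensor scale [v, w]) = (\<Sum>g\<in>UNIV. if g = h then pure_tensor scale [t w, U h v] else 0)"
    unfolding yd_braiding_pure_tensor sum_UNIV_grp_bool using assms
    by (intro sum.cong refl) (auto simp: pure_tensor_zero E_orthogonal act_hbas_True)
  then show ?thesis by simp
qed

lemma act_closed:
  assumes "subspace W" "\<And>g w. w \<in> W \<Longrightarrow> E g w \<in> W" "\<And>w. w \<in> W \<Longrightarrow> t w \<in> W" "w \<in> W"
  shows "act h w \<in> W"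
proof -
  have "act (hbas a) w \<in> W" for a
    using assms by (cases a; cases "snd a") (auto simp: act_hbas_True)
  then show ?thesis unfolding act_expand[of h] using assms(1) by (intro subspace_sum subspace_scale)
qed

end

section \<open>Simple modules\<close>

locale simple_hcs_yd_module = simple_yd_module scale Hcs act coact
  for scale :: "'k::{alg_closed_field, field_char_0} \<Rightarrow> 'v::ab_group_add \<Rightarrow> 'v"
    and act :: "(grp \<times> bool \<Rightarrow> 'k) \<Rightarrow> 'v \<Rightarrow> 'v"
    and coact :: "'v \<Rightarrow> grp \<times> bool \<Rightarrow> 'v"
begin

sublocale hcs_yd_module ..

text \<open>
  \<open>P gone\<close> and \<open>U gone\<close> are complementary projections to the submodules with coaction in \<open>k\<^sup>G\<close> and in
  \<open>k\<^sup>G t\<close>.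
\<close>

lemma P_or_U: "(\<forall>a v. U a v = 0) \<or> (\<forall>a v. P a v = 0)"
proof -
  let ?W = "{v. U gone v = 0}"
  have sub: "subspace ?W" by (rule subspaceI) (simp_all add: lin)
  have "U a v = 0" if "U gone v = 0" for a v
    using U_U[where a = gone and b = a and v = v] that by (simp add: lin)
  then have coact: "coact w b \<in> ?W" if "w \<in> ?W" for w b
    using that by (cases b; cases "snd b") (auto simp: U_P coact_0)
  have "act h w \<in> ?W" if "w \<in> ?W" for h w
  proof (rule act_closed[OF sub _ _ that])
    show "E g w \<in> ?W" if "w \<in> ?W" for g w
      using that coact_act_basis[of g False w gone True] by (simp add: lin)
    show "t w \<in> ?W" if "w \<in> ?W" for w
    proof -
      have "U gone (t w) = (\<Sum>g\<in>UNIV. U gone (act (hbas (g, True)) w))"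
        using sum_E[of "t w"] coact_sum[of "\<lambda>g. E g (t w)" UNIV "(gone, True)"] by (simp add: act_hbas_True)
      then show ?thesis using that by (simp add: coact_act_basis lin)
    qed
  qed
  from simple[OF sub this coact] consider "?W = {0}" | "?W = UNIV" by blast
  then show ?thesis
  proof cases
    case 1
    have "P gone v = 0" for v using U_P[where a = gone and b = gone and v = v] 1 by blast
    then have "P a v = 0" for a v using P_P[where a = gone and b = a and v = v] by (simp add: lin)
    then show ?thesis by blast
  next
    case 2
    then have "U gone v = 0" for v by blast
    then have "U a v = 0" for a v using U_U[where a = gone and b = a and v = v] by (simp add: lin)
    then show ?thesis by blast
  qed
qed

lemma homogeneous_vector: obtains g v where "E g v = v" "v \<noteq> 0"
proof -
  obtain v :: 'v where "v \<noteq> 0" using nonzero by blast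
  have "\<exists>g. E g v \<noteq> 0"
  proof (rule ccontr)
    assume "\<not> ?thesis"
    then have "(\<Sum>g\<in>UNIV. E g v) = 0" by simp
    then show False using sum_E[of v] \<open>v \<noteq> 0\<close> by simp
  qed
  then obtain g where "E g v \<noteq> 0" by blast
  then show thesis using that[of g "E g v"] by (simp add: E_E)
qed

text \<open>By simplicity it is enough that the span is stable under action and coaction.\<close>

lemma span_UNIV:
  assumes B: "b \<in> B" "b \<noteq> 0"
    and E: "\<And>b. b \<in> B \<Longrightarrow> \<exists>g. E g b = b" and t: "\<And>b. b \<in> B \<Longrightarrow> t b \<in> span B"
    and coact: "\<And>b a. b \<in> B \<Longrightarrow> coact b a \<in> span B"
  shows "span B = UNIV"
proof -
  have in_span: "f w \<in> span B" if "w \<in> span B" "Vector_Spaces.linear scale scale f" "\<And>b. b \<in> B \<Longrightarrow> f b \<in> span B" for f w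
    using that(1)
  proof (induct rule: span_induct_alt)
    case base
    have "f 0 = 0" using that(2) by (simp add: linear_iff_module_hom module_hom.zero)
    then show ?case by (simp add: span_zero)
  next
    case (step k x y)
    then show ?case using that(2,3) by (simp add: Vector_Spaces.linear_iff span_add span_scale)
  qed
  have "act h w \<in> span B" if "w \<in> span B" for h w
  proof (rule act_closed[OF subspace_span _ _ that])
    show "t w \<in> span B" if "w \<in> span B" for w
      using in_span[OF that act_linear t] .
    show "E g w \<in> span B" if "w \<in> span B" for g w
    proof (rule in_span[OF that act_linear])
      fix b assume b: "b \<in> B"
      then obtain h where "E h b = b" using E by blast
      then show "E g b \<in> span B"
        using E_orthogonal[of h b g] span_base[OF b] span_zero[of B] by (cases "g = h") auto
    qed
  qed
  moreover have "coact w a \<in> span B" if "w \<in> span B" for w a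
    using in_span[OF that coact_linear coact] .
  moreover have "span B \<noteq> {0}" using B span_base[of b B] by auto
  ultimately show ?thesis using simple[OF subspace_span] by blast
qed

end

section \<open>The braidings of the simple modules\<close>

text \<open>The exponents in \<open>gel 1 0\<close> and \<open>gel 0 1\<close>, that is, \<open>x\<close> and \<open>y\<close>, are kept as numerals.\<close>

declare One_nat_def [simp del]

context simple_hcs_yd_module
begin

definition diagonal_line :: "'v \<Rightarrow> 'k \<Rightarrow> bool" where
  "diagonal_line v q \<longleftrightarrow> v \<noteq> 0 \<and> span {v} = UNIV \<and> q ^ 4 = 1 \<and>
     braiding (pure_tensor scale [v, v]) = tscale q (pure_tensor scale [v, v])"

definition diagonal_pair :: "'v \<Rightarrow> 'v \<Rightarrow> 'k \<Rightarrow> 'k \<Rightarrow> 'k \<Rightarrow> bool" where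
  "diagonal_pair v w q p p' \<longleftrightarrow> v \<noteq> w \<and> \<not> dependent {v, w} \<and> span {v, w} = UNIV \<and>
     q ^ 4 = 1 \<and> (p * p' = - (q * q) \<or> p * p' = 1 \<and> q * q = 1) \<and>
     braiding (pure_tensor scale [v, v]) = tscale q (pure_tensor scale [v, v]) \<and>
     braiding (pure_tensor scale [v, w]) = tscale p (pure_tensor scale [w, v]) \<and>
     braiding (pure_tensor scale [w, v]) = tscale p' (pure_tensor scale [v, w]) \<and>
     braiding (pure_tensor scale [w, w]) = tscale q (pure_tensor scale [w, w])"

definition twisted_pair :: "'v \<Rightarrow> 'v \<Rightarrow> 'k \<Rightarrow> bool" where
  "twisted_pair v w \<beta> \<longleftrightarrow> v \<noteq> w \<and> \<not> dependent {v, w} \<and> span {v, w} = UNIV \<and> \<beta> ^ 4 = 1 \<and>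
     braiding (pure_tensor scale [v, v]) = tscale \<beta> (pure_tensor scale [w, w]) \<and>
     braiding (pure_tensor scale [v, w]) = tscale \<beta> (pure_tensor scale [v, w]) \<and>
     braiding (pure_tensor scale [w, v]) = tscale \<beta> (pure_tensor scale [w, v]) \<and>
     braiding (pure_tensor scale [w, w]) = tscale (- \<beta>) (pure_tensor scale [v, v])"

lemma P_power:
  assumes "\<And>a v. U a v = 0" "P (gel 1 0) v = scale \<zeta> v" "P (gel 0 1) v = scale \<epsilon> v"
  shows "P (gel i j) v = scale (\<zeta> ^ i * \<epsilon> ^ j) v"
proof -
  have "P (gel i 0) v = scale (\<zeta> ^ i) v"
  proof (induct i)
    case 0 then show ?case using counit[of v] assms(1)[of v gone] by (simp add: gone_def)
  next
    case (Suc i)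
    then show ?case using P_P[where a = "gel i 0" and b = "gel 1 0" and v = v] assms(2) by (simp add: gmul_gel lin mult_ac power_add Suc_eq_plus1)
  qed
  then show ?thesis
  proof (induct j)
    case (Suc j)
    then show ?case using P_P[where a = "gel i j" and b = "gel 0 1" and v = v] assms(3) by (simp add: gmul_gel lin mult_ac power_add Suc_eq_plus1)
  qed simp
qed

lemma P_closed:
  assumes "\<And>a v. U a v = 0" and "\<And>b. b \<in> B \<Longrightarrow> \<exists>\<zeta>. P (gel 1 0) b = scale \<zeta> b"
    and "\<And>b. b \<in> B \<Longrightarrow> \<exists>\<epsilon>. P (gel 0 1) b = scale \<epsilon> b" and b: "b \<in> B"
  shows "coact b a \<in> span B"
proof -
  obtain \<zeta> \<epsilon> where eig: "P (gel 1 0) b = scale \<zeta> b" "P (gel 0 1) b = scale \<epsilon> b" using assms(2,3) b by blast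
  obtain g x where a: "a = (g, x)" by (cases a)
  obtain i j where "g = gel i j" by (rule grp_cases)
  then show ?thesis using P_power[OF assms(1) eig, of i j] assms(1) b
    by (cases x) (simp_all add: a span_zero span_scale span_base)
qed

lemma gmul_square:
  "gmul (gel 0 1) (gel 0 1) = gone" "gmul (gel 2 0) (gel 2 0) = gone" "gmul (gel 1 0) (gel 1 0) = gel 2 0"
  by (simp_all add: gmul_gel gone_def gel_eq_iff)

text \<open>
  The operators \<open>P\<^sub>y\<close>, \<open>P\<^bsub>x\<^sup>2\<^esub>\<close> and \<open>P\<^sub>x\<close> commute, and each of them has a scalar square on the common
  eigenspaces of the preceding ones.
\<close>

lemma P_eigenvector:
  assumes U: "\<And>a v. U a v = 0" and v: "E g v = v" "v \<noteq> 0"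
  obtains w \<zeta> \<epsilon> where "E g w = w" "w \<noteq> 0" "P (gel 1 0) w = scale \<zeta> w" "P (gel 0 1) w = scale \<epsilon> w"
    "\<epsilon> * \<epsilon> = 1" "\<zeta> ^ 4 = 1"
proof -
  have P1: "P gone v = v" for v using counit[of v] U by simp
  have sq: "P (gel 0 1) (P (gel 0 1) v) = v" "P (gel 2 0) (P (gel 2 0) v) = v"
    "P (gel 1 0) (P (gel 1 0) v) = P (gel 2 0) v" for v
    by (simp_all only: P_P gmul_square P1)
  have comm: "P a (P b v) = P b (P a v)" for a b v
    by (simp add: P_P gmul_def add.commute)
  define Z0 where "Z0 = {v. E g v = v}"
  have Z0: "subspace Z0" unfolding Z0_def by (rule subspace_homogeneous)
  obtain v1 \<epsilon> where v1: "v1 \<in> Z0" "v1 \<noteq> 0" "P (gel 0 1) v1 = scale \<epsilon> v1" "\<epsilon> * \<epsilon> = 1"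
    by (rule eigenvector[OF Z0, of v "P (gel 0 1)" 1]) (use v in \<open>auto simp: Z0_def lin sq P_homogeneous\<close>)
  define Z1 where "Z1 = {v \<in> Z0. P (gel 0 1) v = scale \<epsilon> v}"
  have Z1: "subspace Z1" unfolding Z1_def by (rule subspace_coact_eigen[OF Z0])
  have Z1_P: "P a v \<in> Z1" if "v \<in> Z1" for a v
    using that comm[where a = "gel 0 1" and b = a and v = v] by (simp add: Z1_def Z0_def P_homogeneous lin)
  obtain v2 \<mu> where v2: "v2 \<in> Z1" "v2 \<noteq> 0" "P (gel 2 0) v2 = scale \<mu> v2" "\<mu> * \<mu> = 1"
    by (rule eigenvector[OF Z1, of v1 "P (gel 2 0)" 1]) (use v1 Z1_P in \<open>auto simp: Z1_def lin sq\<close>)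
  define Z2 where "Z2 = {v \<in> Z1. P (gel 2 0) v = scale \<mu> v}"
  have Z2: "subspace Z2" unfolding Z2_def by (rule subspace_coact_eigen[OF Z1])
  have Z2_P: "P a v \<in> Z2" if "v \<in> Z2" for a v
    using that Z1_P[of v a] comm[where a = "gel 2 0" and b = a and v = v] by (simp add: Z2_def lin)
  obtain v3 \<zeta> where v3: "v3 \<in> Z2" "v3 \<noteq> 0" "P (gel 1 0) v3 = scale \<zeta> v3" "\<zeta> * \<zeta> = \<mu>"
    by (rule eigenvector[OF Z2, of v2 "P (gel 1 0)" \<mu>]) (use v2 Z2_P in \<open>auto simp: Z2_def lin sq\<close>)
  have "\<zeta> ^ 4 = (\<zeta> * \<zeta>) * (\<zeta> * \<zeta>)" by (simp add: numeral_eq_Suc)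
  then have "\<zeta> ^ 4 = 1" using v3(4) v2(4) by simp
  then show thesis using that[of v3 \<zeta> \<epsilon>] v3 v1(4) by (simp add: Z2_def Z1_def Z0_def)
qed

lemma sig_square: "sig g * sig g = (1 :: 'k)"
  by (simp add: sig_def flip: power_mult_distrib)

text \<open>
  For odd \<open>i\<close> the operator \<open>t\<close> exchanges the degrees \<open>x\<^sup>i\<close> and \<open>x\<^sup>i y\<close>, and \<open>t v\<close> is an eigenvector of
  the \<open>P\<^sub>a\<close> as well.
\<close>

lemma classification_P_odd:
  assumes U: "\<And>a v. U a v = 0" and i: "odd i" and v: "E (gel i 0) v = v" "v \<noteq> 0"
  shows "\<exists>v w q p p'. diagonal_pair v w q p p'"
proof -
  define g where "g = gel i 0"
  obtain v \<zeta> \<epsilon> where v: "E g v = v" "v \<noteq> 0" and eig: "P (gel 1 0) v = scale \<zeta> v" "P (gel 0 1) v = scale \<epsilon> v"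
    and \<epsilon>: "\<epsilon> * \<epsilon> = 1" and \<zeta>: "\<zeta> ^ 4 = 1"
    using P_eigenvector[OF U v] unfolding g_def by metis
  have g': "gact g = gel i 1" "g \<noteq> gel i 1"
    using i by (simp_all add: g_def gact_gel gel_eq_iff odd_iff_mod_2_eq_one)
  define w where "w = t v"
  have w: "E (gel i 1) w = w" using t_homogeneous[OF v(1)] by (simp add: w_def g')
  have tw: "t w = scale (sig g) v" unfolding w_def by (rule t_t[OF v(1)])
  have "w \<noteq> 0"
  proof
    assume "w = 0"
    then have "scale (sig g * sig g) v = 0" using tw by (simp add: lin flip: scale_scale)
    then show False using v(2) by (simp add: sig_square)
  qed
  have "odd (i mod 4)" using i by (simp add: even_even_mod_4_iff[of i])
  have eig': "P (gel 1 0) w = scale (- (\<zeta> * \<epsilon>)) w" "P (gel 0 1) w = scale (- \<epsilon>) w"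
    using P_t[OF v(1), of "gel 1 0"] P_t[OF v(1), of "gel 0 1"] P_power[OF U eig, of 1 1] eig i \<open>odd (i mod 4)\<close>
    by (simp_all add: w_def g' gact_gel lin) (simp_all add: g_def)
  note pw = P_power[OF U eig] P_power[OF U eig']
  have \<epsilon>i: "\<epsilon> ^ i = \<epsilon>"
    using i \<epsilon> by (auto elim!: oddE simp: power_mult power_add power2_eq_square)
  have ind: "v \<noteq> w" "\<not> dependent {v, w}"
    using independent_homogeneous[OF v(1) w g'(2) v(2) \<open>w \<noteq> 0\<close>] by auto
  have "span {v, w} = UNIV"
  proof (rule span_UNIV[of v])
    show "\<exists>h. E h b = b" if "b \<in> {v, w}" for b using that v w by blast
    show "t b \<in> span {v, w}" if "b \<in> {v, w}" for b
      using that by (auto simp: tw span_scale span_base simp flip: w_def)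
    show "coact b a \<in> span {v, w}" if "b \<in> {v, w}" for b a
      by (rule P_closed[OF U _ _ that]) (use eig eig' in blast)+
  qed (use v in auto)
  moreover have "(\<zeta> ^ i) ^ 4 = 1" using \<zeta> by (metis power_mult mult.commute power_one)
  ultimately have "diagonal_pair v w (\<zeta> ^ i) (\<zeta> ^ i * \<epsilon>) (- (\<zeta> ^ i * \<epsilon>))"
    using ind \<epsilon> i unfolding diagonal_pair_def braiding_P[OF U v(1)] braiding_P[OF U w]
    by (simp add: g_def pw pure_tensor_scale pure_tensor_minus power_mult_distrib \<epsilon>i algebra_simps)
  then show ?thesis by blast
qed

lemma t_nonzero: "E g v = v \<Longrightarrow> v \<noteq> 0 \<Longrightarrow> t v \<noteq> 0"
proof
  assume v: "E g v = v" "v \<noteq> 0" and "t v = 0"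
  then have "scale (sig g * sig g) v = 0" using t_t[OF v(1)] by (simp add: lin flip: scale_scale)
  then show False using v(2) by (simp add: sig_square)
qed

text \<open>
  If \<open>g\<close> is fixed by \<open>t\<close>, then \<open>t\<close> preserves the degree \<open>g\<close> and commutes with \<open>P\<^sub>y\<close>; with \<open>P\<^sub>x\<close> it
  commutes up to a sign \<open>s\<close>.  If \<open>s = 1\<close>, then \<open>v\<close> can be chosen as an eigenvector of \<open>t\<close> too and spans
  the module.  If \<open>s = -1\<close>, then \<open>v\<close> and \<open>t v\<close> belong to different eigenvalues of \<open>P\<^sub>x\<close>.
\<close>

lemma classification_P_even:
  assumes U: "\<And>a v. U a v = 0" and even: "even (ex g)" and v: "E g v = v" "v \<noteq> 0"
  shows "(\<exists>v q. diagonal_line v q) \<or> (\<exists>v w q p p'. diagonal_pair v w q p p')"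
proof -
  obtain v \<zeta> \<epsilon> where v: "E g v = v" "v \<noteq> 0" and eig: "P (gel 1 0) v = scale \<zeta> v" "P (gel 0 1) v = scale \<epsilon> v"
    and \<epsilon>: "\<epsilon> * \<epsilon> = 1" and \<zeta>: "\<zeta> ^ 4 = 1"
    using P_eigenvector[OF U v] by metis
  have gact: "gact g = g"
    using even by (intro grp_eqI) (auto simp: gact_def ex_less ey_less mod_add_eq elim!: evenE)
  define s where "s = (-1) ^ ey g * \<epsilon>"
  define q where "q = \<zeta> ^ ex g * \<epsilon> ^ ey g"
  obtain m where m: "ex g = 2 * m" using even by (auto elim: evenE)
  have "(\<zeta> * \<zeta>) * (\<zeta> * \<zeta>) = 1" using \<zeta> by (simp add: numeral_eq_Suc mult.assoc)
  then have qq: "q * q = 1"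
    using \<epsilon> by (simp add: q_def m power_mult power2_eq_square mult_ac flip: power_mult_distrib)
  then have q4: "q ^ 4 = 1" by (simp add: numeral_eq_Suc mult.assoc)
  have t_eig: "P (gel 1 0) (t z) = scale (s * \<zeta>) (t z)" "P (gel 0 1) (t z) = scale \<epsilon> (t z)"
    if "E g z = z" "P (gel 1 0) z = scale \<zeta> z" "P (gel 0 1) z = scale \<epsilon> z" for z
    using P_t[OF that(1), of "gel 1 0"] P_t[OF that(1), of "gel 0 1"] P_power[OF U that(2,3), of 1 1] even that(3)
    by (simp_all add: gact gact_gel lin s_def mult_ac)
  have "s * s = 1" using \<epsilon> by (simp add: s_def mult_ac flip: power_mult_distrib)
  then have "s = 1 \<or> s = -1" by (metis square_eq_1_iff)
  then show ?thesis
  proof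
    assume s: "s = 1"
    define Z where "Z = {v \<in> {v \<in> {v. E g v = v}. P (gel 1 0) v = scale \<zeta> v}. P (gel 0 1) v = scale \<epsilon> v}"
    have Z: "subspace Z" unfolding Z_def by (intro subspace_coact_eigen subspace_homogeneous)
    have t_Z: "t z \<in> Z" if "z \<in> Z" for z
      using that t_eig[of z] t_homogeneous[of g z] by (simp add: Z_def gact s)
    obtain u l where u: "u \<in> Z" "u \<noteq> 0" "t u = scale l u"
      by (rule eigenvector[OF Z, of v t "sig g"]) (use v eig t_Z in \<open>auto simp: Z_def lin t_t\<close>)
    then have u': "E g u = u" and eig_u: "P (gel 1 0) u = scale \<zeta> u" "P (gel 0 1) u = scale \<epsilon> u"
      by (simp_all add: Z_def)
    have "span {u} = UNIV"
    proof (rule span_UNIV[of u])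
      show "\<exists>h. E h b = b" if "b \<in> {u}" for b using that u' by blast
      show "t b \<in> span {u}" if "b \<in> {u}" for b
        using that by (auto simp: u(3) span_scale span_base)
      show "coact b a \<in> span {u}" if "b \<in> {u}" for b a
        by (rule P_closed[OF U _ _ that]) (use eig_u in blast)+
    qed (use u in auto)
    then have "diagonal_line u q"
      unfolding diagonal_line_def braiding_P[OF U u']
      using u(2) q4 P_power[OF U eig_u, of "ex g" "ey g"]
      by (simp add: gel_ex_ey pure_tensor_scale q_def)
    then show ?thesis by blast
  next
    assume s: "s = -1"
    define w where "w = t v"
    have w: "E g w = w" "w \<noteq> 0" using t_homogeneous[OF v(1)] t_nonzero[OF v] by (simp_all add: w_def gact)
    have eig_w: "P (gel 1 0) w = scale (- \<zeta>) w" "P (gel 0 1) w = scale \<epsilon> w"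
      using t_eig[OF v(1) eig] by (simp_all add: w_def s)
    have tw: "t w = scale (sig g) v" unfolding w_def by (rule t_t[OF v(1)])
    have "\<zeta> \<noteq> 0" using \<zeta> by auto
    have "a = 0 \<and> b = 0" if eq: "scale a v + scale b w = 0" for a b
    proof -
      have "P (gel 1 0) (scale a v + scale b w) = 0" using eq by (simp add: lin)
      then have "scale \<zeta> (scale a v - scale b w) = 0"
        by (simp add: lin eig eig_w scale_right_diff_distrib mult.commute)
      then have "scale a v - scale b w = 0" using \<open>\<zeta> \<noteq> 0\<close> by simp
      moreover have "scale (a + a) v = (scale a v + scale b w) + (scale a v - scale b w)"
        by (subst scale_left_distrib) simp
      ultimately have "scale (a + a) v = 0" using eq by simp
      then have "a + a = 0" using v(2) by simp
      then have "a = 0" by simp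
      then show ?thesis using eq w(2) by simp
    qed
    from independent_pairI[OF this] have ind: "v \<noteq> w" "\<not> dependent {v, w}" by blast+
    have "span {v, w} = UNIV"
    proof (rule span_UNIV[of v])
      show "\<exists>h. E h b = b" if "b \<in> {v, w}" for b using that v w by blast
      show "t b \<in> span {v, w}" if "b \<in> {v, w}" for b
        using that by (auto simp: tw span_scale span_base simp flip: w_def)
      show "coact b a \<in> span {v, w}" if "b \<in> {v, w}" for b a
        by (rule P_closed[OF U _ _ that]) (use eig eig_w in blast)+
    qed (use v in auto)
    moreover have "P g v = scale q v" "P g w = scale q w"
      using P_power[OF U eig, of "ex g" "ey g"] P_power[OF U eig_w, of "ex g" "ey g"] even
      by (simp_all add: gel_ex_ey q_def)
    ultimately have "diagonal_pair v w q q q"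
      using ind q4 qq unfolding diagonal_pair_def braiding_P[OF U v(1)] braiding_P[OF U w(1)]
      by (simp add: pure_tensor_scale)
    then show ?thesis by blast
  qed
qed

lemma classification_P:
  assumes U: "\<And>a v. U a v = 0"
  shows "(\<exists>v q. diagonal_line v q) \<or> (\<exists>v w q p p'. diagonal_pair v w q p p')"
proof -
  obtain g v where v: "E g v = v" "v \<noteq> 0" by (rule homogeneous_vector)
  show ?thesis
  proof (cases "even (ex g)")
    case True
    then show ?thesis using classification_P_even[OF U _ v] by blast
  next
    case False
    \<comment> \<open>\<open>t\<close> exchanges the degrees \<open>x\<^sup>i\<close> and \<open>x\<^sup>i y\<close> for odd \<open>i\<close>, so the degree may be taken to be \<open>x\<^sup>i\<close>\<close>
    define u where "u = (if ey g = 0 then v else t v)"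
    have "E (gel (ex g) 0) u = u"
    proof (cases "ey g = 0")
      case True then show ?thesis using v gel_ex_ey[of g] by (simp add: u_def)
    next
      case 2: False
      then have "ey g = 1" using ey_less[of g] by linarith
      then have "gact g = gel (ex g) 0" using False by (simp add: gact_def gel_eq_iff odd_iff_mod_2_eq_one mod_simps)
      then show ?thesis using t_homogeneous[OF v(1)] 2 by (simp add: u_def)
    qed
    moreover have "u \<noteq> 0" using v t_nonzero[OF v] by (simp add: u_def)
    ultimately show ?thesis using classification_P_odd[OF U False] by blast
  qed
qed

lemma U_power:
  assumes P: "\<And>a v. P a v = 0"
  shows "U gone v = v" "U (gel i j) v = ((\<lambda>u. U (gel 0 1) u) ^^ j) (((\<lambda>u. U (gel 1 0) u) ^^ i) v)"
proof -
  show U1: "U gone v = v" using counit[of v] P by simp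
  have "U (gel i 0) v = ((\<lambda>u. U (gel 1 0) u) ^^ i) v"
  proof (induct i)
    case 0 then show ?case using U1 by (simp add: gone_def)
  next
    case (Suc i)
    then show ?case using U_U[where a = "gel i 0" and b = "gel 1 0" and v = v]
      by (simp add: gmul_gel tau_gel flip: Suc_eq_plus1)
  qed
  then show "U (gel i j) v = ((\<lambda>u. U (gel 0 1) u) ^^ j) (((\<lambda>u. U (gel 1 0) u) ^^ i) v)"
  proof (induct j)
    case (Suc j)
    then show ?case using U_U[where a = "gel i j" and b = "gel 0 1" and v = v]
      by (simp add: gmul_gel tau_gel flip: Suc_eq_plus1)
  qed simp
qed

lemma gel_mod: "gel (i mod 4) j = gel i j"
  by (simp add: gel_eq_iff)

lemma U_relations:
  assumes P: "\<And>a v. P a v = 0"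
  shows "U (gel 0 1) (U (gel 0 1) v) = v" "U (gel 2 0) (U (gel 2 0) v) = v"
    "U (gel 1 0) (U (gel 1 0) v) = U (gel 2 0) v"
    "U (gel 0 1) (U (gel 1 0) v) = U (gel 1 1) v"
    "U (gel 1 0) (U (gel 0 1) v) = - U (gel 1 1) v"
    "U (gel 2 0) (U a v) = U a (U (gel 2 0) v)"
    "U (gel 0 0) v = v" "U (gel 3 0) v = U (gel 1 0) (U (gel 2 0) v)" "U (gel i 1) v = U (gel 0 1) (U (gel i 0) v)"
  using U_power(1)[OF P] gmul_square
  by (simp_all add: U_U tau_gel) (simp_all add: gmul_gel tau_def gmul_def add.commute gel_mod flip: gone_def)

lemma U_closed:
  assumes P: "\<And>a v. P a v = 0"
    and UY: "\<And>b. b \<in> B \<Longrightarrow> U (gel 0 1) b \<in> span B" and UX: "\<And>b. b \<in> B \<Longrightarrow> U (gel 1 0) b \<in> span B"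
    and b: "b \<in> span B"
  shows "coact b a \<in> span B"
proof -
  have in_span: "U a w \<in> span B" if "w \<in> span B" "\<And>b. b \<in> B \<Longrightarrow> U a b \<in> span B" for a w
    using that(1)
  proof (induct rule: span_induct_alt)
    case base
    then show ?case by (simp add: lin span_zero)
  next
    case (step k x y)
    then show ?case using that(2) by (simp add: lin span_add span_scale)
  qed
  have pow: "((\<lambda>u. U a u) ^^ n) w \<in> span B" if "w \<in> span B" "\<And>b. b \<in> B \<Longrightarrow> U a b \<in> span B" for a w n
    using that(1) by (induct n) (auto intro: in_span that(2))
  obtain g x where a: "a = (g, x)" by (cases a)
  obtain i j where g: "g = gel i j" by (rule grp_cases)
  have "U g b \<in> span B"
    unfolding g by (subst U_power(2)[OF P]) (intro pow UX UY b)
  then show ?thesis by (cases x) (simp_all add: a P span_zero)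
qed

text \<open>
  The operators \<open>U\<^sub>y\<close> and \<open>U\<^bsub>x\<^sup>2\<^esub>\<close> preserve degrees and commute, unlike \<open>U\<^sub>x\<close>, which multiplies the
  degree by \<open>y\<close>.
\<close>

definition U_space :: "nat \<Rightarrow> 'k \<Rightarrow> 'k \<Rightarrow> 'v set" where
  "U_space i \<epsilon> \<mu> = {v. E (gel i 0) v = v \<and> U (gel 0 1) v = scale \<epsilon> v \<and> U (gel 2 0) v = scale \<mu> v}"

lemma subspace_U_space: "subspace (U_space i \<epsilon> \<mu>)"
proof -
  have "U_space i \<epsilon> \<mu> = {v \<in> {v \<in> {v. E (gel i 0) v = v}. U (gel 0 1) v = scale \<epsilon> v}. U (gel 2 0) v = scale \<mu> v}"
    by (auto simp: U_space_def)
  then show ?thesis by (simp only: subspace_coact_eigen subspace_homogeneous)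
qed

lemma U_eigenvector:
  assumes P: "\<And>a v. P a v = 0"
  obtains i v \<epsilon> \<mu> where "i < 4" "v \<in> U_space i \<epsilon> \<mu>" "v \<noteq> 0" "\<epsilon> * \<epsilon> = 1" "\<mu> * \<mu> = 1"
proof -
  note rel = U_relations[OF P]
  obtain g v where v: "E g v = v" "v \<noteq> 0" by (rule homogeneous_vector)
  define i where "i = ex g"
  \<comment> \<open>a multiplication of the degree by \<open>y\<close> makes it a power of \<open>x\<close>\<close>
  define u where "u = (if ey g = 0 then v else U (gel 1 0) v)"
  have u: "E (gel i 0) u = u" 
  proof (cases "ey g = 0")
    case True then show ?thesis using v gel_ex_ey[of g] by (simp add: u_def i_def)
  next
    case False
    then have "ey g = 1" using ey_less[of g] by linarith
    then have "gmul g (gel 0 (ex (gel 1 0))) = gel i 0"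
      by (simp add: gmul_def gel_eq_iff i_def)
    then show ?thesis using U_homogeneous[OF v(1), of "gel 1 0"] False by (simp add: u_def)
  qed
  have u0: "u \<noteq> 0"
  proof
    assume "u = 0"
    then have "U (gel 1 0) v = 0" using v(2) by (simp add: u_def split: if_splits)
    then have "U (gel 2 0) v = 0" using rel(3)[of v] by (simp add: lin)
    then show False using rel(2)[of v] v(2) by (simp add: lin)
  qed
  define Z0 where "Z0 = {v. E (gel i 0) v = v}"
  have Z0: "subspace Z0" unfolding Z0_def by (rule subspace_homogeneous)
  have Z0_U: "U (gel 0 1) z \<in> Z0" "U (gel 2 0) z \<in> Z0" if "z \<in> Z0" for z
    using that U_homogeneous[of "gel i 0" z "gel 0 1"] U_homogeneous[of "gel i 0" z "gel 2 0"]
    by (simp_all add: Z0_def gmul_gel) (simp add: gel_def)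
  obtain v1 \<epsilon> where v1: "v1 \<in> Z0" "v1 \<noteq> 0" "U (gel 0 1) v1 = scale \<epsilon> v1" "\<epsilon> * \<epsilon> = 1"
    by (rule eigenvector[OF Z0, of u "\<lambda>v. U (gel 0 1) v" 1]) (use u u0 Z0_U in \<open>auto simp: Z0_def lin rel(1)\<close>)
  define Z1 where "Z1 = {v \<in> Z0. U (gel 0 1) v = scale \<epsilon> v}"
  have Z1: "subspace Z1" unfolding Z1_def by (rule subspace_coact_eigen[OF Z0])
  have Z1_U: "U (gel 2 0) z \<in> Z1" if "z \<in> Z1" for z
    using that Z0_U(2)[of z] rel(6)[where a = "gel 0 1" and v = z] by (simp add: Z1_def lin)
  obtain v2 \<mu> where v2: "v2 \<in> Z1" "v2 \<noteq> 0" "U (gel 2 0) v2 = scale \<mu> v2" "\<mu> * \<mu> = 1"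
    by (rule eigenvector[OF Z1, of v1 "\<lambda>v. U (gel 2 0) v" 1]) (use v1 Z1_U in \<open>auto simp: Z1_def lin rel(2)\<close>)
  have "i < 4" by (simp add: i_def ex_less)
  then show thesis using that[of i v2 \<epsilon> \<mu>] v2 v1(4) by (simp add: Z1_def Z0_def U_space_def)
qed

text \<open>
  For even \<open>i\<close> the operator \<open>t\<close> preserves degrees and commutes with \<open>U\<^sub>y\<close> and \<open>U\<^bsub>x\<^sup>2\<^esub>\<close>.  So \<open>v\<close> may be
  taken to be an eigenvector of \<open>t\<close>, and then \<open>U\<^sub>x v\<close> is one as well; the braiding is diagonal.
\<close>

lemma classification_U_even:
  assumes P: "\<And>a v. P a v = 0" and i: "even i" "i < 4"
    and v: "v \<in> U_space i \<epsilon> \<mu>" "v \<noteq> 0" and \<epsilon>: "\<epsilon> * \<epsilon> = 1" and \<mu>: "\<mu> * \<mu> = 1"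
  shows "\<exists>v w q p p'. diagonal_pair v w q p p'"
proof -
  note rel = U_relations[OF P]
  have gact: "gact (gel i 0) = gel i 0" using i(1) by (simp add: gact_gel gel_eq_iff)
  have t_inv: "t z \<in> U_space i \<epsilon> \<mu>" if "z \<in> U_space i \<epsilon> \<mu>" for z
  proof -
    have z: "E (gel i 0) z = z" "U (gel 0 1) z = scale \<epsilon> z" "U (gel 2 0) z = scale \<mu> z"
      using that by (simp_all add: U_space_def)
    have "gel 2 2 = gel 2 0" "gel i 2 = gel i 0" "gel i i = gel i 0" using i by (simp_all add: gel_eq_iff)
    then show ?thesis
      using U_t[OF z(1), of "gel 0 1"] U_t[OF z(1), of "gel 2 0"] t_homogeneous[OF z(1)] z(2,3) i
      by (simp add: U_space_def gact gact_gel gmul_gel lin)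
  qed
  obtain v l where v: "v \<in> U_space i \<epsilon> \<mu>" "v \<noteq> 0" and tv: "t v = scale l v" and l: "l * l = sig (gel i 0)"
    by (rule eigenvector[OF subspace_U_space v, of t "sig (gel i 0)"])
      (use t_inv in \<open>auto simp: lin t_t U_space_def\<close>)
  have E: "E (gel i 0) v = v" and Uy: "U (gel 0 1) v = scale \<epsilon> v" and U2: "U (gel 2 0) v = scale \<mu> v"
    using v(1) by (simp_all add: U_space_def)
  define w where "w = U (gel 1 0) v"
  have Ew: "E (gel i 1) w = w" using U_homogeneous[OF E, of "gel 1 0"] by (simp add: w_def gmul_gel)
  have Uxw: "U (gel 1 0) w = scale \<mu> v" using rel(3)[of v] U2 by (simp add: w_def)
  have Uyw: "U (gel 0 1) w = scale (- \<epsilon>) w"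
    using rel(4)[of v] rel(5)[of v] Uy by (simp add: w_def lin)
  have tw: "t w = scale (- (\<epsilon> * l)) w"
  proof -
    have "(i + 1) mod 2 = 1" using i(1) by presburger
    then have "scale l w = t (U (gel 1 1) v)"
      using U_t[OF E, of "gel 1 0"] tv by (simp add: gact gact_gel gmul_gel lin w_def)
    also have "\<dots> = - scale \<epsilon> (t w)" using rel(4)[of v] Uyw unfolding w_def[symmetric]
      by (metis act_minus act_smult scale_minus_left)
    finally have "scale \<epsilon> (scale l w) = scale \<epsilon> (- scale \<epsilon> (t w))" by simp
    then show ?thesis using \<epsilon> by simp
  qed
  have "w \<noteq> 0" 
  proof
    assume "w = 0"
    then have "scale \<mu> v = 0" using Uxw by (simp add: lin)
    then show False using v(2) \<mu> by auto
  qed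
  have ind: "v \<noteq> w" "\<not> dependent {v, w}"
    using independent_homogeneous[OF E Ew _ v(2) \<open>w \<noteq> 0\<close>] by (simp_all add: gel_eq_iff)
  have span: "span {v, w} = UNIV"
  proof (rule span_UNIV[of v])
    show "\<exists>h. E h b = b" if "b \<in> {v, w}" for b using that E Ew by blast
    show "t b \<in> span {v, w}" if "b \<in> {v, w}" for b
      using that by (auto simp: tv tw span_scale span_base span_neg)
    show "coact b a \<in> span {v, w}" if "b \<in> {v, w}" for b a
    proof (rule U_closed[OF P])
      show "U (gel 0 1) b \<in> span {v, w}" if "b \<in> {v, w}" for b
        using that by (auto simp: Uy Uyw span_scale span_base span_neg)
      show "U (gel 1 0) b \<in> span {v, w}" if "b \<in> {v, w}" for b
        using that by (auto simp: Uxw span_scale span_base simp flip: w_def)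
    qed (use that in \<open>auto intro: span_base\<close>)
  qed (use v in auto)
  define m where "m = (if i = 0 then 1 else \<mu>)"
  have U2w: "U (gel 2 0) w = scale \<mu> w" using rel(6)[where a = "gel 1 0" and v = v] U2 by (simp add: w_def lin)
  have "i = 0 \<or> i = 2" using i by presburger
  then have Ug: "U (gel i 0) v = scale m v" "U (gel i 0) w = scale m w"
    using U2 U2w by (auto simp: m_def rel(7))
  have Ug': "U (gel i 1) v = scale (\<epsilon> * m) v" "U (gel i 1) w = scale (- (\<epsilon> * m)) w"
    unfolding rel(9)[where i = i] Ug lin Uy Uyw by (simp_all add: mult.commute)
  have Et: "E (gel i 0) (t v) = t v" "E (gel i 1) (t w) = t w" using E Ew by (simp_all add: tv tw lin)
  have mm: "m * m = 1" using \<mu> by (simp add: m_def)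
  define q where "q = l * m"
  have qq: "q * q = sig (gel i 0)" using l mm by (simp add: q_def mult_ac)
  moreover have "q ^ 4 = (q * q) * (q * q)" by (simp add: numeral_eq_Suc mult.assoc)
  ultimately have "q ^ 4 = 1" using sig_square[of "gel i 0"] by simp
  then have "diagonal_pair v w q (- q) q"
    using ind span \<epsilon> unfolding diagonal_pair_def braiding_U[OF P Et(1)] braiding_U[OF P Et(2)]
    by (simp add: tv tw Ug Ug' pure_tensor_scale pure_tensor_minus q_def mult_ac)
  then show ?thesis by blast
qed

text \<open>
  For odd \<open>i\<close> both \<open>t\<close> and \<open>U\<^sub>x\<close> exchange the degrees \<open>x\<^sup>i\<close> and \<open>x\<^sup>i y\<close>.  Now \<open>U\<^sub>x t\<close> preserves degrees
  and commutes with \<open>U\<^sub>y\<close> and \<open>U\<^bsub>x\<^sup>2\<^esub>\<close>, and for an eigenvector \<open>v\<close> of it, \<open>t v\<close> is a multiple of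
  \<open>w = U\<^sub>x v\<close> and \<open>t w\<close> one of \<open>v\<close>.  Therefore \<open>c (a \<otimes> b)\<close> is a multiple of \<open>b' \<otimes> a'\<close> for
  \<open>a, b \<in> {v, w}\<close>, where \<open>'\<close> exchanges \<open>v\<close> and \<open>w\<close>.
\<close>

lemma classification_U_odd:
  assumes P: "\<And>a v. P a v = 0" and i: "odd i" "i < 4"
    and v: "v \<in> U_space i \<epsilon> \<mu>" "v \<noteq> 0" and \<epsilon>: "\<epsilon> * \<epsilon> = 1" and \<mu>: "\<mu> * \<mu> = 1"
  shows "\<exists>v w \<beta>. twisted_pair v w \<beta>"
proof -
  note rel = U_relations[OF P]
  have gel: "gel 2 2 = gel 2 0" "gel i 2 = gel i 0" "gel i 3 = gel i 1" "gel i i = gel i 1" "gel i (i + 1) = gel i 0"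
      "gel i (i + 2) = gel i 1"
    using i by (auto simp: gel_eq_iff odd_iff_mod_2_eq_one elim!: oddE)
  have gact: "gact (gel i 0) = gel i 1" using gel by (simp add: gact_gel)
  have odd': "odd (i mod 4)" using i by simp
  have sig: "sig (gel i j) = (sig (gel i 0) :: 'k)" for j by (simp add: sig_def)
  let ?A = "\<lambda>z. U (gel 1 0) (t z)"
  have A: "?A z \<in> U_space i \<epsilon> \<mu>" "?A z = scale \<epsilon> (t (U (gel 1 0) z))"
      "U (gel 2 0) (t z) = scale \<mu> (t z)" "?A (?A z) = scale (\<epsilon> * \<mu> * sig (gel i 0)) z"
    if "z \<in> U_space i \<epsilon> \<mu>" for z
  proof -
    have z: "E (gel i 0) z = z" "U (gel 0 1) z = scale \<epsilon> z" "U (gel 2 0) z = scale \<mu> z"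
      using that by (simp_all add: U_space_def)
    have Ez: "E (gel i 1) (t z) = t z" using t_homogeneous[OF z(1)] by (simp add: gact)
    have deg: "E (gel i 0) (?A z) = ?A z" using U_homogeneous[OF Ez, of "gel 1 0"] by (simp add: gmul_gel gel)
    have y: "U (gel 0 1) (t z) = scale (- \<epsilon>) (t z)"
      using U_t[OF z(1), of "gel 0 1"] z(2) odd' by (simp add: gact gact_gel gmul_gel lin)
    show x2: "U (gel 2 0) (t z) = scale \<mu> (t z)"
      using U_t[OF z(1), of "gel 2 0"] z(3) by (simp add: gact gact_gel gmul_gel lin gel)
    have "U (gel 0 1) (?A z) = scale \<epsilon> (?A z)"
      using y rel(4)[of "t z"] rel(5)[of "t z"] by (simp add: lin)
    moreover have "U (gel 2 0) (?A z) = scale \<mu> (?A z)"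
      using rel(6)[where a = "gel 1 0" and v = "t z"] x2 by (simp add: lin)
    ultimately show "?A z \<in> U_space i \<epsilon> \<mu>" using deg by (simp add: U_space_def)
    have z11: "U (gel 1 1) z = - scale \<epsilon> (U (gel 1 0) z)"
      using rel(5)[of z] unfolding z(2) lin by simp
    have "?A z = - t (U (gel 1 1) z)"
      using U_t[OF z(1), of "gel 1 0"] by (simp add: gact gact_gel gmul_gel lin gel)
    then show A: "?A z = scale \<epsilon> (t (U (gel 1 0) z))"
      using z11 by (simp add: lin)
    have "E (gel i 1) (U (gel 1 0) z) = U (gel 1 0) z" using U_homogeneous[OF z(1), of "gel 1 0"] by (simp add: gmul_gel)
    then have "?A (?A z) = scale \<epsilon> (scale (sig (gel i 1)) (U (gel 1 0) (U (gel 1 0) z)))"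
      unfolding A by (simp add: lin t_t)
    then show "?A (?A z) = scale (\<epsilon> * \<mu> * sig (gel i 0)) z"
      by (simp add: rel(3) z(3) sig[of 1] mult_ac)
  qed
  obtain v n where v: "v \<in> U_space i \<epsilon> \<mu>" "v \<noteq> 0" and Av: "?A v = scale n v" and n: "n * n = \<epsilon> * \<mu> * sig (gel i 0)"
    by (rule eigenvector[OF subspace_U_space v, of ?A "\<epsilon> * \<mu> * sig (gel i 0)"])
      (use A in \<open>auto simp: lin\<close>)
  have E: "E (gel i 0) v = v" and Uy: "U (gel 0 1) v = scale \<epsilon> v" and U2: "U (gel 2 0) v = scale \<mu> v"
    using v(1) by (simp_all add: U_space_def)
  define w where "w = U (gel 1 0) v"
  have Ew: "E (gel i 1) w = w" using U_homogeneous[OF E, of "gel 1 0"] by (simp add: w_def gmul_gel)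
  have Uxw: "U (gel 1 0) w = scale \<mu> v" using rel(3)[of v] U2 by (simp add: w_def)
  have Uyw: "U (gel 0 1) w = scale (- \<epsilon>) w"
    using rel(4)[of v] rel(5)[of v] Uy by (simp add: w_def lin)
  have tw: "t w = scale (\<epsilon> * n) v"
  proof -
    have "scale \<epsilon> (scale n v) = scale \<epsilon> (scale \<epsilon> (t w))" using A(2)[OF v(1)] Av by (simp add: w_def)
    then show ?thesis using \<epsilon> by simp
  qed
  have tv: "t v = scale (\<mu> * n) w"
  proof -
    have "scale \<mu> (t v) = scale n w" using A(3)[OF v(1)] rel(3)[of "t v"] Av by (simp add: lin w_def)
    then have "scale \<mu> (scale \<mu> (t v)) = scale \<mu> (scale n w)" by simp
    then show ?thesis using \<mu> by simp
  qed
  have "w \<noteq> 0" 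
  proof
    assume "w = 0"
    then have "scale \<mu> v = 0" using Uxw by (simp add: lin)
    then show False using v(2) \<mu> by auto
  qed
  have ind: "v \<noteq> w" "\<not> dependent {v, w}"
    using independent_homogeneous[OF E Ew _ v(2) \<open>w \<noteq> 0\<close>] by (simp_all add: gel_eq_iff)
  have span: "span {v, w} = UNIV"
  proof (rule span_UNIV[of v])
    show "\<exists>h. E h b = b" if "b \<in> {v, w}" for b using that E Ew by blast
    show "t b \<in> span {v, w}" if "b \<in> {v, w}" for b
      using that by (auto simp: tv tw span_scale span_base)
    show "coact b a \<in> span {v, w}" if "b \<in> {v, w}" for b a
    proof (rule U_closed[OF P])
      show "U (gel 0 1) b \<in> span {v, w}" if "b \<in> {v, w}" for b
        using that by (auto simp: Uy Uyw span_scale span_base span_neg)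
      show "U (gel 1 0) b \<in> span {v, w}" if "b \<in> {v, w}" for b
        using that by (auto simp: Uxw span_scale span_base simp flip: w_def)
    qed (use that in \<open>auto intro: span_base\<close>)
  qed (use v in auto)
  define m where "m = (if i = 1 then 1 else \<mu>)"
  have U2w: "U (gel 2 0) w = scale \<mu> w" using rel(6)[where a = "gel 1 0" and v = v] U2 by (simp add: w_def lin)
  have "i = 1 \<or> i = 3" using i by presburger
  then have Ug: "U (gel i 0) v = scale m w" "U (gel i 0) w = scale (m * \<mu>) v"
    using U2 U2w Uxw \<mu> by (auto simp: m_def rel(8) lin simp flip: w_def)
  have Ug': "U (gel i 1) v = scale (- (\<epsilon> * m)) w" "U (gel i 1) w = scale (\<epsilon> * m * \<mu>) v"
    unfolding rel(9)[where i = i] Ug lin Uy Uyw by (simp_all add: mult_ac)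
  have Et: "E (gel i 1) (t v) = t v" "E (gel i 0) (t w) = t w" using E Ew by (simp_all add: tv tw lin)
  have mm: "m * m = 1" using \<mu> by (simp add: m_def)
  define \<beta> where "\<beta> = \<epsilon> * n * m"
  have "\<beta> * \<beta> = \<epsilon> * \<mu> * sig (gel i 0)" using n mm \<epsilon> by (simp add: \<beta>_def mult_ac)
  then have "\<beta> ^ 4 = (\<epsilon> * \<epsilon>) * (\<mu> * \<mu>) * (sig (gel i 0) * sig (gel i 0))"
    by (simp add: numeral_eq_Suc mult_ac)
  then have \<beta>4: "\<beta> ^ 4 = 1" using \<epsilon> \<mu> sig_square[of "gel i 0"] by simp
  have br: "braiding (pure_tensor scale [v, v]) = tscale (- (\<mu> * \<beta>)) (pure_tensor scale [w, w])"
    "braiding (pure_tensor scale [v, w]) = tscale \<beta> (pure_tensor scale [v, w])"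
    "braiding (pure_tensor scale [w, v]) = tscale \<beta> (pure_tensor scale [w, v])"
    "braiding (pure_tensor scale [w, w]) = tscale (\<mu> * \<beta>) (pure_tensor scale [v, v])"
    unfolding braiding_U[OF P Et(1)] braiding_U[OF P Et(2)]
    using \<mu> by (simp_all add: tv tw Ug Ug' pure_tensor_scale pure_tensor_minus \<beta>_def mult_ac)
  \<comment> \<open>for \<open>\<mu> = 1\<close> the two basis vectors have to be exchanged\<close>
  have "\<mu> = 1 \<or> \<mu> = -1" using \<mu> by (metis square_eq_1_iff)
  then have "twisted_pair w v \<beta> \<or> twisted_pair v w \<beta>"
    using br ind span \<beta>4 by (auto simp: twisted_pair_def insert_commute)
  then show ?thesis by blast
qed

lemma classification:
  "(\<exists>v q. diagonal_line v q) \<or> (\<exists>v w q p p'. diagonal_pair v w q p p') \<or> (\<exists>v w \<beta>. twisted_pair v w \<beta>)"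
  using P_or_U
proof
  assume "\<forall>a v. U a v = 0"
  then show ?thesis using classification_P by blast
next
  assume P: "\<forall>a v. P a v = 0"
  then obtain i v \<epsilon> \<mu> where v: "i < 4" "v \<in> U_space i \<epsilon> \<mu>" "v \<noteq> 0" "\<epsilon> * \<epsilon> = 1" "\<mu> * \<mu> = 1"
    using U_eigenvector by blast
  then show ?thesis
    using classification_U_even[OF _ _ v] classification_U_odd[OF _ _ v] P by blast
qed

end

section \<open>Comparison with an arbitrary diagonal basis\<close>

context hcs_yd_module
begin

lemma pure_tensor_expand:
  "pure_tensor scale [scale a v + scale b w, scale c v + scale d w] =
     tscale (a * c) (pure_tensor scale [v, v]) + tscale (a * d) (pure_tensor scale [v, w]) +
     tscale (b * c) (pure_tensor scale [w, v]) + tscale (b * d) (pure_tensor scale [w, w])"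
proof -
  have add: "pure_tensor scale [x + y, z] = pure_tensor scale [x, z] + pure_tensor scale [y, z]"
    "pure_tensor scale [z, x + y] = pure_tensor scale [z, x] + pure_tensor scale [z, y]" for x y z
    using pure_tensor_linear[of "[]" "[z]"] pure_tensor_linear[of "[z]" "[]"]
    by (simp_all add: Vector_Spaces.linear_iff)
  show ?thesis by (simp add: add pure_tensor_scale tensor.scale_right_distrib ac_simps)
qed

lemma tensor_square_independent:
  assumes "v \<noteq> w" "\<not> dependent {v, w}"
    and eq: "tscale a (pure_tensor scale [v, v]) + tscale b (pure_tensor scale [v, w]) +
        tscale c (pure_tensor scale [w, v]) + tscale d (pure_tensor scale [w, w]) =
      tscale a' (pure_tensor scale [v, v]) + tscale b' (pure_tensor scale [v, w]) +
        tscale c' (pure_tensor scale [w, v]) + tscale d' (pure_tensor scale [w, w])"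
  shows "a = a' \<and> b = b' \<and> c = c' \<and> d = d'"
proof -
  obtain f where f: "\<And>b. linear_form scale (f b)" "\<And>a b. a \<in> {v, w} \<Longrightarrow> f b a = (if a = b then 1 else 0)"
    using dual_basis[OF assms(2)] by blast
  show ?thesis
    using fun_cong[OF eq, of "[f v, f v]"] fun_cong[OF eq, of "[f v, f w]"]
      fun_cong[OF eq, of "[f w, f v]"] fun_cong[OF eq, of "[f w, f w]"] assms(1)
    by (simp add: plus_fun_apply tscale_def pure_tensor_Cons pure_tensor_Nil f)
qed

lemma braiding_expand:
  "braiding (pure_tensor scale [scale a v + scale b w, scale c v + scale d w]) =
     tscale (a * c) (braiding (pure_tensor scale [v, v])) + tscale (a * d) (braiding (pure_tensor scale [v, w])) +
     tscale (b * c) (braiding (pure_tensor scale [w, v])) + tscale (b * d) (braiding (pure_tensor scale [w, w]))"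
  unfolding pure_tensor_expand tlinear_add[OF tlinear_yd_braiding] tlinear_scale[OF tlinear_yd_braiding] ..

lemma coordinates:
  assumes "span {v, w} = UNIV"
  obtains a b where "x = scale a v + scale b w"
proof -
  have "x \<in> span {v, w}" using assms by simp
  then obtain a where "x - scale a v \<in> span {w}" by (auto simp: span_breakdown_eq)
  then obtain b where "x - scale a v = scale b w" by (auto simp: span_singleton)
  then show thesis using that[of a b] by (simp add: algebra_simps)
qed

lemma independent_pairD:
  assumes "x \<noteq> y" "\<not> dependent {x, y}" "scale a x + scale b y = 0"
  shows "a = 0 \<and> b = 0"
proof -
  have x: "x \<notin> span {y}" and y: "y \<noteq> 0" using assms(1,2) by (auto simp: independent_insert)
  have "a = 0"
  proof (rule ccontr)
    assume a: "a \<noteq> 0"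
    have "scale a x = scale (- b) y" using assms(3) by (simp add: eq_neg_iff_add_eq_0)
    then have "x = scale (inverse a * - b) y" using a by (metis scale_scale left_inverse scale_one)
    then have "x \<in> span {y}" using span_scale[OF span_base, of y "{y}" "inverse a * - b"] by simp
    then show False using x by blast
  qed
  then show ?thesis using assms(3) y by simp
qed

lemma diagonal_entry_nontrivial:
  assumes fin: "nichols_finite_dim scale braiding" and bm: "braiding_matrix scale braiding xs q" and i: "i < length xs"
  shows "q i i \<noteq> 1"
proof
  assume "q i i = 1"
  then have c: "braiding (pure_tensor scale [xs ! i, xs ! i]) = pure_tensor scale [xs ! i, xs ! i]"
    using bm i by (simp add: braiding_matrix_def)
  have "0 \<notin> set xs" using bm dependent_zero[of "set xs"] by (auto simp: braiding_matrix_def)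
  then have "xs ! i \<noteq> 0" using nth_mem[OF i] by metis
  then show False using fixed_square_not_nichols_finite_dim[OF yd_module_axioms _ c] fin by blast
qed

end

context simple_hcs_yd_module
begin

lemma diagonal_line_type:
  assumes line: "diagonal_line v q" and fin: "nichols_finite_dim scale braiding"
    and bm: "braiding_matrix scale braiding xs q'"
  shows "type_A1 (length xs) q'"
proof -
  have v: "v \<noteq> 0" "span {v} = UNIV" "q ^ 4 = 1"
      "braiding (pure_tensor scale [v, v]) = tscale q (pure_tensor scale [v, v])"
    using line by (simp_all add: diagonal_line_def)
  have xs: "distinct xs" "\<not> dependent (set xs)" "span (set xs) = UNIV" using bm by (simp_all add: braiding_matrix_def)
  have "card (set xs) = card {v}"
    using dim_span_eq_card_independent[of "set xs"] dim_span_eq_card_independent[of "{v}"] xs v by simp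
  then have len: "length xs = 1" using distinct_card[OF xs(1)] by simp
  define x where "x = xs ! 0"
  have "x \<in> set xs" using len by (simp add: x_def)
  then have "x \<noteq> 0" using xs(2) dependent_zero[of "set xs"] by auto
  have "x \<in> span {v}" using v(2) by simp
  then obtain a where x: "x = scale a v" by (auto simp: span_singleton)
  have "tscale (q' 0 0) (pure_tensor scale [x, x]) = braiding (pure_tensor scale [x, x])"
    using bm len by (simp add: braiding_matrix_def x_def)
  also have "\<dots> = tscale q (pure_tensor scale [x, x])"
    by (simp add: x pure_tensor_scale tlinear_scale[OF tlinear_yd_braiding] v(4) mult_ac)
  finally have "q' 0 0 = q"
    using pure_tensor_nonzero[of "[x, x]"] \<open>x \<noteq> 0\<close> by (simp add: eq_commute[of 0])
  then show ?thesis
    using diagonal_entry_nontrivial[OF fin bm, of 0] len v(3)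
    by (auto simp: type_A1_def nontrivial_root_diagonal_def intro: exI[of _ 4])
qed

text \<open>
  Write another diagonal basis in terms of \<open>v\<close> and \<open>w\<close> and compare coefficients in \<open>V \<otimes> V\<close>.  A nonzero
  coordinate of a basis vector forces its diagonal entry to be \<open>q\<close>.  One of the two products in the
  determinant of the change of basis is nonzero; according to which, the pair of off-diagonal
  entries is \<open>(p, p')\<close> or \<open>(p', p)\<close>.
\<close>

lemma diagonal_pair_type:
  assumes pair: "diagonal_pair v w q p p'" and fin: "nichols_finite_dim scale braiding"
    and bm: "braiding_matrix scale braiding xs q'"
  shows "type_A2 (length xs) q' \<or> quantum_plane (length xs) q'"
proof -
  have vw: "v \<noteq> w" "\<not> dependent {v, w}" "span {v, w} = UNIV" and q: "q ^ 4 = 1"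
    and pp: "p * p' = - (q * q) \<or> p * p' = 1 \<and> q * q = 1"
    and br: "braiding (pure_tensor scale [v, v]) = tscale q (pure_tensor scale [v, v])"
     "braiding (pure_tensor scale [v, w]) = tscale p (pure_tensor scale [w, v])"
     "braiding (pure_tensor scale [w, v]) = tscale p' (pure_tensor scale [v, w])"
     "braiding (pure_tensor scale [w, w]) = tscale q (pure_tensor scale [w, w])"
    using pair by (simp_all add: diagonal_pair_def)
  have xs: "distinct xs" "\<not> dependent (set xs)" "span (set xs) = UNIV" using bm by (simp_all add: braiding_matrix_def)
  have "card (set xs) = card {v, w}"
    using dim_span_eq_card_independent[of "set xs"] dim_span_eq_card_independent[of "{v, w}"] xs vw by simp
  then have len: "length xs = 2" using distinct_card[OF xs(1)] vw(1) by simp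
  have compare: "q * (a * c) = k * (a * c) \<and> p * (a * d) = k * (a * d) \<and> p' * (b * c) = k * (b * c) \<and> q * (b * d) = k * (b * d)"
    if "braiding (pure_tensor scale [scale a v + scale b w, scale c v + scale d w]) =
      tscale k (pure_tensor scale [scale c v + scale d w, scale a v + scale b w])" for a b c d k
  proof -
    have "tscale (a * c * q) (pure_tensor scale [v, v]) + tscale (b * c * p') (pure_tensor scale [v, w]) +
        tscale (a * d * p) (pure_tensor scale [w, v]) + tscale (b * d * q) (pure_tensor scale [w, w]) =
      tscale (k * (c * a)) (pure_tensor scale [v, v]) + tscale (k * (c * b)) (pure_tensor scale [v, w]) +
        tscale (k * (d * a)) (pure_tensor scale [w, v]) + tscale (k * (d * b)) (pure_tensor scale [w, w])"
      using that unfolding braiding_expand unfolding br pure_tensor_expand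
      by (simp add: tensor.scale_right_distrib add_ac)
    from tensor_square_independent[OF vw(1,2) this] show ?thesis by (simp add: mult_ac)
  qed
  obtain x y where xy: "xs = [x, y]" using len by (auto simp: numeral_2_eq_2 length_Suc_conv)
  obtain a b where x: "x = scale a v + scale b w" by (rule coordinates[OF vw(3)])
  obtain c d where y: "y = scale c v + scale d w" by (rule coordinates[OF vw(3)])
  have nz: "a \<noteq> 0 \<or> b \<noteq> 0" "c \<noteq> 0 \<or> d \<noteq> 0"
    using xs(2) dependent_zero[of "set xs"] by (auto simp: xy x y)
  have br_xs: "braiding (pure_tensor scale [x, x]) = tscale (q' 0 0) (pure_tensor scale [x, x])"
    "braiding (pure_tensor scale [x, y]) = tscale (q' 0 1) (pure_tensor scale [y, x])"
    "braiding (pure_tensor scale [y, x]) = tscale (q' 1 0) (pure_tensor scale [x, y])"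
    "braiding (pure_tensor scale [y, y]) = tscale (q' 1 1) (pure_tensor scale [y, y])"
    using bm[unfolded braiding_matrix_def len, THEN conjunct2, THEN conjunct2, THEN conjunct2, rule_format, of 0 0]
      bm[unfolded braiding_matrix_def len, THEN conjunct2, THEN conjunct2, THEN conjunct2, rule_format, of 0 1]
      bm[unfolded braiding_matrix_def len, THEN conjunct2, THEN conjunct2, THEN conjunct2, rule_format, of 1 0]
      bm[unfolded braiding_matrix_def len, THEN conjunct2, THEN conjunct2, THEN conjunct2, rule_format, of 1 1]
    by (simp_all add: xy)
  note cmp = compare[OF br_xs(1)[unfolded x]] compare[OF br_xs(2)[unfolded x y]]
    compare[OF br_xs(3)[unfolded x y]] compare[OF br_xs(4)[unfolded y]]
  have q00: "q' 0 0 = q" and q11: "q' 1 1 = q" using cmp(1,4) nz by auto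
  have "a * d \<noteq> 0 \<or> b * c \<noteq> 0"
  proof (rule ccontr)
    assume z: "\<not> ?thesis"
    have "scale c x + scale (- a) y = 0" "scale d x + scale (- b) y = 0"
      using z by (auto simp: x y algebra_simps)
    then show False using independent_pairD[of x y] xs(1,2) nz by (metis distinct_length_2_or_more list.simps(15) empty_set neg_equal_0_iff_equal xy)
  qed
  then have prod: "q' 0 1 * q' 1 0 = p * p'"
  proof
    assume "a * d \<noteq> 0"
    then have "q' 0 1 = p" "q' 1 0 = p'" using cmp(2,3) by simp_all
    then show ?thesis by simp
  next
    assume "b * c \<noteq> 0"
    then have "q' 0 1 = p'" "q' 1 0 = p" using cmp(2,3) by simp_all
    then show ?thesis by (simp add: mult.commute)
  qed
  have q1: "q \<noteq> 1" using diagonal_entry_nontrivial[OF fin bm, of 0] len q00 by auto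
  have root: "nontrivial_root_diagonal (length xs) q'"
    using q00 q11[unfolded One_nat_def] q1 q unfolding nontrivial_root_diagonal_def len
    by (auto simp: less_2_cases_iff intro!: exI[of _ 4])
  have "(q * q) * (q * q) = 1" using q by (simp add: numeral_eq_Suc mult.assoc)
  then have "q * q = 1 \<or> q * q = -1" by (metis square_eq_1_iff)
  moreover have "q = -1" if "q * q = 1" using that q1 by (metis square_eq_1_iff)
  ultimately show ?thesis
    using pp root len q00 q11 prod by (auto simp: type_A2_def quantum_plane_def)
qed

text \<open>
  A vector \<open>x = a v + b w\<close> with \<open>c (x \<otimes> x) = k x \<otimes> x\<close> would satisfy \<open>k = \<beta>\<close>, hence \<open>a\<^sup>2 = b\<^sup>2 = - a\<^sup>2\<close>.
\<close>

lemma twisted_pair_not_diagonal: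
  assumes pair: "twisted_pair v w \<beta>" and bm: "braiding_matrix scale braiding xs q'"
  shows False
proof -
  have vw: "v \<noteq> w" "\<not> dependent {v, w}" "span {v, w} = UNIV" and \<beta>: "\<beta> ^ 4 = 1"
    and br: "braiding (pure_tensor scale [v, v]) = tscale \<beta> (pure_tensor scale [w, w])"
     "braiding (pure_tensor scale [v, w]) = tscale \<beta> (pure_tensor scale [v, w])"
     "braiding (pure_tensor scale [w, v]) = tscale \<beta> (pure_tensor scale [w, v])"
     "braiding (pure_tensor scale [w, w]) = tscale (- \<beta>) (pure_tensor scale [v, v])"
    using pair by (simp_all add: twisted_pair_def)
  have xs: "\<not> dependent (set xs)" "span (set xs) = UNIV" using bm by (simp_all add: braiding_matrix_def)
  have "xs \<noteq> []" using xs(2) nonzero by auto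
  define x where "x = xs ! 0"
  define k where "k = q' 0 0"
  have "x \<in> set xs" using \<open>xs \<noteq> []\<close> by (simp add: x_def)
  then have "x \<noteq> 0" using xs(1) dependent_zero[of "set xs"] by auto
  obtain a b where x: "x = scale a v + scale b w" by (rule coordinates[OF vw(3)])
  have "braiding (pure_tensor scale [x, x]) = tscale k (pure_tensor scale [x, x])"
    using bm \<open>xs \<noteq> []\<close> by (simp add: braiding_matrix_def x_def k_def)
  then have "tscale (b * b * - \<beta>) (pure_tensor scale [v, v]) + tscale (a * b * \<beta>) (pure_tensor scale [v, w]) +
      tscale (b * a * \<beta>) (pure_tensor scale [w, v]) + tscale (a * a * \<beta>) (pure_tensor scale [w, w]) =
    tscale (k * (a * a)) (pure_tensor scale [v, v]) + tscale (k * (a * b)) (pure_tensor scale [v, w]) +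
      tscale (k * (b * a)) (pure_tensor scale [w, v]) + tscale (k * (b * b)) (pure_tensor scale [w, w])"
    unfolding x braiding_expand unfolding br pure_tensor_expand
    by (simp add: tensor.scale_right_distrib add_ac del: mult_minus_right tensor.scale_minus_left)
  from tensor_square_independent[OF vw(1,2) this]
  have eqs: "- (b * b * \<beta>) = k * (a * a)" "a * b * \<beta> = k * (a * b)" "a * a * \<beta> = k * (b * b)" by auto
  have "\<beta> \<noteq> 0" using \<beta> by auto
  have "a \<noteq> 0" "b \<noteq> 0" using eqs \<open>\<beta> \<noteq> 0\<close> \<open>x \<noteq> 0\<close> x by auto
  then have "k = \<beta>" using eqs(2) by simp
  then have "a * a = b * b" "- (b * b) = a * a" using eqs \<open>\<beta> \<noteq> 0\<close> by (auto simp: mult.commute)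
  then have "b * b + b * b = 0" by simp
  then show False using \<open>b \<noteq> 0\<close> by simp
qed

lemma twisted_pair_dimension:
  assumes pair: "twisted_pair v w \<beta>" and fin: "nichols_finite_dim scale braiding"
  shows "nichols_has_dim scale braiding 8 \<or> nichols_has_dim scale braiding 16"
proof -
  have \<beta>: "\<beta> ^ 4 = 1" and W: "braided_words scale braiding (twisted_matrix \<beta>)
      (\<lambda>x. tscale (twist_sign 0 x) (pure_tensor scale (twisted_word v w 0 x)))"
    using pair by (auto simp: twisted_pair_def intro: twisted_braided_words)
  have "(\<beta> * \<beta>) * (\<beta> * \<beta>) = 1" using \<beta> by (simp add: numeral_eq_Suc mult.assoc)
  then have "\<beta> * \<beta> = 1 \<or> \<beta> * \<beta> = -1" by (metis square_eq_1_iff)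
  then consider "\<beta> = 1" | "\<beta> = -1" | "\<beta> * \<beta> = -1" by (metis square_eq_1_iff)
  then show ?thesis
  proof cases
    case 1
    then show ?thesis using braided_words_not_nichols_finite_dim[OF W, of True] fin by simp
  next
    case 2
    then show ?thesis using nichols_has_dim_8 W by blast
  next
    case 3
    then show ?thesis using nichols_has_dim_16[OF W] by blast
  qed
qed

lemma diagonal_line_diagonal: "diagonal_line v q \<Longrightarrow> diagonal_type scale braiding"
  unfolding diagonal_type_def braiding_matrix_def diagonal_line_def
  by (intro exI[of _ "[v]"] exI[of _ "\<lambda>_ _. q"]) simp

lemma diagonal_pair_diagonal: "diagonal_pair v w q p p' \<Longrightarrow> diagonal_type scale braiding"
  unfolding diagonal_type_def braiding_matrix_def diagonal_pair_def
  by (intro exI[of _ "[v, w]"] exI[of _ "\<lambda>i j. if i = j then q else if i = 0 then p else p'"])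
    (auto simp: less_Suc_eq)

end

theorem theorem5p6:
  fixes scale :: "'k::{alg_closed_field, field_char_0} \<Rightarrow> 'v::ab_group_add \<Rightarrow> 'v"
    and act :: "(grp \<times> bool \<Rightarrow> 'k) \<Rightarrow> 'v \<Rightarrow> 'v"
    and coact :: "'v \<Rightarrow> grp \<times> bool \<Rightarrow> 'v"
  assumes "simple_yd_module scale Hcs act coact"
    and "nichols_finite_dim scale (yd_braiding scale act coact)"
  shows "(\<forall>xs q. braiding_matrix scale (yd_braiding scale act coact) xs q \<longrightarrow>
            type_A1 (length xs) q \<or> type_A2 (length xs) q \<or> quantum_plane (length xs) q)
       \<and> (\<not> diagonal_type scale (yd_braiding scale act coact) \<longrightarrow>
            nichols_has_dim scale (yd_braiding scale act coact) 8 \<or>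
            nichols_has_dim scale (yd_braiding scale act coact) 16)"
proof -
  interpret simple_yd_module scale Hcs act coact by (rule assms(1))
  interpret simple_hcs_yd_module scale act coact ..
  note fin = assms(2)
  from classification consider v q where "diagonal_line v q" | v w q p p' where "diagonal_pair v w q p p'"
    | v w \<beta> where "twisted_pair v w \<beta>" by blast
  then show ?thesis
  proof cases
    case 1
    then show ?thesis using diagonal_line_type[OF 1 fin] diagonal_line_diagonal[OF 1] by blast
  next
    case 2
    then show ?thesis using diagonal_pair_type[OF 2 fin] diagonal_pair_diagonal[OF 2] by blast
  next
    case 3
    then show ?thesis using twisted_pair_not_diagonal[OF 3] twisted_pair_dimension[OF 3 fin] by blast
  qed
qed

end
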